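(* Let $\mathscr F=(\mathcal F_{\mathfrak q})_{\mathfrak q\in\mathcal Q_H}$ be a filtration indexed by maps with holes. Let $(\mathfrak Q,\phi)$ be an $\mathscr F$-Boltzmann decorated map and $\mathsf Q\in\mathcal Q_H$ an $\mathscr F$-stopping map for $(\mathfrak Q,\phi)$. Then $\mathfrak Q$ and $\phi$ can be decomposed as $$\mathfrak Q=\mathsf Q\odot(\mathfrak Q^{\mathsf Q}_h)_{h\in H(\mathsf Q)},\qquad \phi=\phi|_{\mathsf Q}+\phi^{\mathsf Q},$$ where, conditionally on $\mathcal F_{\mathsf Q}$ and $\phi|_{\mathsf Q}$, $(\mathfrak Q_h^{\mathsf Q},\phi^{\mathsf Q}_h)_{h\in H(\mathsf Q)}$ is a collection of independent Boltzmann decorated maps with boundary $h$ and boundary condition $\phi|_h$ for every $h\in H(\mathsf Q)$.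
   Context: Maps. A planar map is a finite connected graph properly embedded in the sphere with a distinguished oriented edge (the root edge). Each edge consists of two semi-edges, one per side. The root (exterior) face is the face to the right of the root edge; its degree is the perimeter. A quadrangulation with boundary is a planar map in which all faces, except possibly the root face, are surrounded by 4 semi-edges; $\mathcal Q^\ell$ denotes those of perimeter $2\ell$. A quadrangulation with holes is a planar map with boundary which has distinguished faces, called holes, which need not be squares, each one with a marked oriented edge, all non-distinguished interior faces being surrounded by 4 semi-edges. $H(\mathfrak q)$: set of holes of $\mathfrak q$; $\mathcal Q_H$: set of quadrangulations with holes; $F_i(\mathfrak q)$: interior faces (not holes). Gluing $\mathfrak q\odot(\mathfrak u_h)_{h\in H(\mathfrak q)}$ ($\mathfrak u_h$, possibly with holes, of perimeter $\deg h$): identify the root edge of $\mathfrak u_h$ with the marked edge of $h$ and, following the orientation, the boundary edges of $\mathfrak u_h$ with the edges of $h$; the root and boundary of $\mathfrak q$ are kept. $\mathfrak q\subset\mathfrak p$ means $\mathfrak p=\mathfrak q\odot(\mathfrak u_h)_h$ for some (then uniquely defined) $(\mathfrak u_h)_h=:(\mathfrak p_h^{\mathfrak q})_h$. There is a minimal element, the empty map $\dagger$ (cemetery), with $\dagger\subset\mathfrak q$ for all $\mathfrak q\in\mathcal Q_H$. Decorations. Fix $\beta>0$ and a measure $\mu$ on $\mathbb R^n$. Each of the $2\ell$ sides of edges incident to the exterior face gives a phantom face; these are identified with $\{0,\dots,2\ell-1\}$ by following the direction of the root edge. A decoration assigns a value in $\mathbb R^n$ to each face of $F_i(\mathfrak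 q)$ and each phantom face; it has boundary condition $b$ if it equals $b$ on phantom faces. $\mathcal H^b(\mathfrak q,\sigma)=\frac\beta2\sum\|\sigma_i-\sigma_j\|^2$, summed once over all edges of $\mathfrak q$, $i,j$ being the (interior or phantom) faces on its two sides. A ($q$-)Boltzmann decorated map with semi-perimeter $\ell$ and boundary condition $b:\{0,\dots,2\ell-1\}\to\operatorname{supp}\mu$ is a random $(\mathfrak Q,\phi)$ with $\mathbb P^{\ell,b}(\mathfrak Q=\mathfrak q,\phi\in d\sigma)=\frac1{W_q^{\ell,b}}q^{|F_i(\mathfrak q)|}e^{-\mathcal H^b(\mathfrak q,\sigma)}\prod_{f\in F_i(\mathfrak q)}\mu(d\sigma_f)$, $\mathfrak q\in\mathcal Q^\ell$, where $q$ is such that $W_q^{\ell,b}<\infty$. For $\mathfrak q\subset\mathfrak Q$: $\phi|_{\mathfrak q}$ is the restriction of $\phi$ to faces of $\mathfrak q$; $\phi^{\mathfrak q}$ its restriction to the faces inside holes, $\phi^{\mathfrak q}_h$ the part inside $h$ (each extended by $0$, so $\phi=\phi|_{\mathfrak q}+\phi^{\mathfrak q}$). $\phi|_h$ is the boundary condition of $h$: the faces of $\mathfrak q$ adjacent to $h$ keep their spins and become phantom faces seen from $h$. "With boundary $h$" means perimeter $\deg h$. A filtration is a collection of $\mathbb P$-complete $\sigma$-algebras $(\mathcal F_{\mathfrak q})_{\mathfrak q\in\mathcal Q_H}$ with $\mathcal F_{\mathfrak q_1}\subseteq\mathcal F_{\mathfrak q_2}$ if $\mathfrak q_1\subset\mathfrak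 q_2$. A Boltzmann decorated map $(\mathfrak Q,\phi)$ is an $\mathscr F$-Boltzmann decorated map if for every $\mathfrak q\in\mathcal Q_H$: the event $\{\mathfrak q\subset\mathfrak Q\}$ and the function $\phi|_{\mathfrak q}\mathbf 1_{\{\mathfrak q\subset\mathfrak Q\}}$ are $\mathcal F_{\mathfrak q}$-measurable; and conditionally on $\mathcal F_{\mathfrak q}$ and the event $\{\mathfrak q\subset\mathfrak Q\}$, $(\mathfrak Q_h^{\mathfrak q},\phi_h^{\mathfrak q})_{h\in H(\mathfrak q)}$ is a collection of independent $q$-Boltzmann decorated maps with boundary $h$ and boundary condition $\phi|_h$ for every $h\in H(\mathfrak q)$. An $\mathscr F$-stopping map is a random $\mathsf Q$ with almost surely $\mathsf Q\subset\mathfrak Q$ and $\{\mathsf Q\subset\mathfrak q\}\in\mathcal F_{\mathfrak q}$ for any $\mathfrak q\in\mathcal Q_H$; $\mathcal F_{\mathsf Q}=\{\Theta\in\bigvee_{\mathfrak q}\mathcal F_{\mathfrak q}:\Theta\cap\{\mathsf Q\subset\mathfrak q\}\in\mathcal F_{\mathfrak q}\ \text{for any }\mathfrak q\in\mathcal Q_H\}$.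
   Formalization: Maps with holes are required to have no edge between two holes, non-hole faces (root face included) connected through edges, and, for the trivial one-hole cycle, the hole marked at the root edge; otherwise fillings are not unique or mutual inclusion makes the claim fail. *)

theory Defs
  imports "HOL-Probability.Probability" "HOL-Combinatorics.Combinatorics"
begin

section \<open>Planar maps with holes\<close>

text \<open>
  A map is encoded by its semi-edges (sides of edges). A semi-edge is identified with the
  orientation of its edge for which the semi-edge, hence its face, lies on the right.
  The involution \<open>opp\<close> exchanges the two sides of an edge, \<open>nxt\<close> follows the contour of a
  face, so faces are \<open>nxt\<close>-orbits and vertices are \<open>nxt \<circ> opp\<close>-orbits.
  The root face is the face of the semi-edge \<open>rt\<close>, i.e. the face on the right of the root edge.
  A hole is given by one semi-edge on its contour, collected in \<open>marks\<close>; the marked oriented edge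
  of the hole \<open>m\<close> is the orientation \<open>opp m\<close>, which has the hole on its left. This agrees with
  the root edge of a map, which has the interior of the map on its left.
\<close>

record 'd pmap =
  sides :: "'d set"
  opp :: "'d \<Rightarrow> 'd"
  nxt :: "'d \<Rightarrow> 'd"
  rt :: 'd
  marks :: "'d set"

definition face_at :: "'d pmap \<Rightarrow> 'd \<Rightarrow> 'd set" where
  "face_at M d = orbit (nxt M) d"

definition root_face :: "'d pmap \<Rightarrow> 'd set" where
  "root_face M = face_at M (rt M)"

definition perimeter :: "'d pmap \<Rightarrow> nat" where
  "perimeter M = card (root_face M)"

definition hole_deg :: "'d pmap \<Rightarrow> 'd \<Rightarrow> nat" where
  "hole_deg M m = card (face_at M m)"

definition hole_sides :: "'d pmap \<Rightarrow> 'd set" where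
  "hole_sides M = (\<Union>m\<in>marks M. face_at M m)"

definition inner_sides :: "'d pmap \<Rightarrow> 'd set" where
  "inner_sides M = sides M - root_face M - hole_sides M"

definition joined :: "'d pmap \<Rightarrow> 'd set \<Rightarrow> bool" where
  "joined M S \<longleftrightarrow> (\<forall>d\<in>S. (rt M, d) \<in> {(x, y). x \<in> S \<and> y \<in> S \<and> (y = nxt M x \<or> y = opp M x)}\<^sup>*)"

text \<open>The last clause is Euler's formula \<open>V + F = E + 2\<close>, i.e. the surface is the sphere.\<close>

definition planar_map :: "'d pmap \<Rightarrow> bool" where
  "planar_map M \<longleftrightarrow>
     finite (sides M) \<and> rt M \<in> sides M \<and>
     opp M permutes sides M \<and> nxt M permutes sides M \<and>
     (\<forall>d\<in>sides M. opp M d \<noteq> d \<and> opp M (opp M d) = d) \<and>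
     joined M (sides M) \<and>
     card (orbit (nxt M \<circ> opp M) ` sides M) + card (face_at M ` sides M) = card (sides M) div 2 + 2"

text \<open>
  The last three clauses make the order induced by gluing a genuine partial order in which the
  filling is unique and the boundary condition of a hole is defined:
  every edge of a hole has a face that is not a hole on its other side;
  the faces that are not holes (the root face included) are connected through edges, so that
  holes have simple boundaries and the embedding of a map with holes in a larger map is unique;
  and a hole left unfilled keeps its marked edge, i.e. in the trivial map of perimeter \<open>k\<close>
  (a cycle bounding the root face on one side and one hole on the other) the marked edge of the
  hole is the root edge.
\<close>

definition quad_with_holes :: "'d pmap \<Rightarrow> bool" where
  "quad_with_holes M \<longleftrightarrow>
     planar_map M \<and>
     marks M \<subseteq> sides M - root_face M \<and> inj_on (face_at M) (marks M) \<and>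
     (\<forall>d\<in>inner_sides M. card (face_at M d) = 4) \<and>
     (\<forall>d\<in>hole_sides M. opp M d \<notin> hole_sides M) \<and>
     joined M (sides M - hole_sides M) \<and>
     (\<forall>m\<in>marks M. opp M ` face_at M m = root_face M \<longrightarrow> opp M m = rt M)"

text \<open>
  Maps are considered up to root preserving isomorphism; \<open>rep\<close> selects one representative of each
  isomorphism class. An isomorphism of rooted maps is unique, so the faces of the representative
  name the faces of every map in the class.
\<close>

definition map_iso :: "('d \<Rightarrow> 'e) \<Rightarrow> 'd pmap \<Rightarrow> 'e pmap \<Rightarrow> bool" where
  "map_iso f M N \<longleftrightarrow>
     bij_betw f (sides M) (sides N) \<and> f (rt M) = rt N \<and> f ` marks M = marks N \<and>
     (\<forall>d\<in>sides M. f (opp M d) = opp N (f d) \<and> f (nxt M d) = nxt N (f d))"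

definition rep :: "'d pmap \<Rightarrow> nat pmap" where
  "rep M = (SOME N. planar_map N \<and> (\<exists>f. map_iso f M N))"

definition QH :: "nat pmap set" where
  "QH = {M. quad_with_holes M \<and> rep M = M}"

definition quads :: "nat \<Rightarrow> nat pmap set" where
  "quads l = {M \<in> QH. marks M = {} \<and> perimeter M = 2 * l}"


section \<open>Gluing and the order on maps with holes\<close>

text \<open>\<open>(nxt M ^^ i) (rt M)\<close> is the \<open>i\<close>-th phantom face of \<open>M\<close>; this is its index.\<close>

definition phantom_index :: "'d pmap \<Rightarrow> 'd \<Rightarrow> nat" where
  "phantom_index M d = funpow_dist (nxt M) (rt M) d"

text \<open>
  Following the orientation of the marked edge of the hole \<open>m\<close>, the hole stays on the left; its
  contour is therefore traversed against \<open>nxt\<close>. The \<open>i\<close>-th edge of the hole is represented by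
  its semi-edge outside the hole.
\<close>

definition hole_edge :: "'d pmap \<Rightarrow> 'd \<Rightarrow> nat \<Rightarrow> 'd" where
  "hole_edge q m i = opp q ((inv (nxt q) ^^ i) m)"

definition hole_of :: "'d pmap \<Rightarrow> 'd \<Rightarrow> 'd" where
  "hole_of q s = (THE m. m \<in> marks q \<and> s \<in> face_at q m)"

definition hole_index :: "'d pmap \<Rightarrow> 'd \<Rightarrow> nat" where
  "hole_index q s = funpow_dist (nxt q) s (hole_of q s)"

text \<open>
  The semi-edges of the glued map are those of \<open>q\<close> outside its holes and, for each hole \<open>m\<close>,
  those of \<open>u m\<close> outside its root face; the \<open>i\<close>-th exterior semi-edge of \<open>u m\<close> is
  identified with the \<open>i\<close>-th edge of the hole.
\<close>

definition glue_side :: "'d pmap \<Rightarrow> ('d \<Rightarrow> 'd pmap) \<Rightarrow> 'd \<Rightarrow> 'd \<Rightarrow> 'd + 'd \<times> 'd" where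
  "glue_side q u m d =
     (if d \<in> root_face (u m) then Inl (hole_edge q m (phantom_index (u m) d)) else Inr (m, d))"

definition raw_glue :: "'d pmap \<Rightarrow> ('d \<Rightarrow> 'd pmap) \<Rightarrow> ('d + 'd \<times> 'd) pmap" where
  "raw_glue q u =
     \<lparr> sides = Inl ` (sides q - hole_sides q)
         \<union> Inr ` (SIGMA m : marks q. sides (u m) - root_face (u m)),
       opp = (\<lambda>x. case x of
           Inl d \<Rightarrow>
             (if opp q d \<in> hole_sides q
              then let m = hole_of q (opp q d); i = hole_index q (opp q d)
                   in glue_side q u m (opp (u m) ((nxt (u m) ^^ i) (rt (u m))))
              else Inl (opp q d))
         | Inr (m, d) \<Rightarrow> glue_side q u m (opp (u m) d)),
       nxt = (\<lambda>x. case x of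
           Inl d \<Rightarrow> Inl (nxt q d)
         | Inr (m, d) \<Rightarrow> Inr (m, nxt (u m) d)),
       rt = Inl (rt q),
       marks = Inr ` (SIGMA m : marks q. marks (u m)) \<rparr>"

definition glue_map :: "nat pmap \<Rightarrow> (nat \<Rightarrow> nat pmap) \<Rightarrow> nat pmap" where
  "glue_map q u = rep (raw_glue q u)"

text \<open>
  \<open>None\<close> is the empty map (cemetery). It is treated as a single hole, named \<open>0\<close> and of
  unspecified degree: gluing \<open>p\<close> into it gives \<open>p\<close>.
\<close>

definition QHd :: "nat pmap option set" where
  "QHd = insert None (Some ` QH)"

primrec holes :: "nat pmap option \<Rightarrow> nat set" where
  "holes None = {0}"
| "holes (Some q) = marks q"

primrec fillings :: "nat pmap option \<Rightarrow> (nat \<Rightarrow> nat pmap) set" where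
  "fillings None = {0} \<rightarrow>\<^sub>E QH"
| "fillings (Some q) = (\<Pi>\<^sub>E m\<in>marks q. {v \<in> QH. perimeter v = hole_deg q m})"

primrec glue :: "nat pmap option \<Rightarrow> (nat \<Rightarrow> nat pmap) \<Rightarrow> nat pmap option" where
  "glue None u = Some (u 0)"
| "glue (Some q) u = Some (glue_map q u)"

definition submap :: "nat pmap option \<Rightarrow> nat pmap option \<Rightarrow> bool" where
  "submap q p \<longleftrightarrow> q = None \<or> (\<exists>u\<in>fillings q. p = glue q u)"

text \<open>For \<open>submap q (Some p)\<close>, the unique family of maps with \<open>Some p = glue q u\<close>.\<close>

definition hole_parts :: "nat pmap option \<Rightarrow> nat pmap \<Rightarrow> nat \<Rightarrow> nat pmap" where
  "hole_parts q p = (SOME u. u \<in> fillings q \<and> Some p = glue q u)"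


section \<open>Decorations\<close>

text \<open>An interior face is named by the least of its semi-edges.\<close>

datatype face = Inner nat | Phantom_Face nat

definition face_id :: "nat pmap \<Rightarrow> nat \<Rightarrow> nat" where
  "face_id M d = Min (face_at M d)"

definition inner_faces :: "nat pmap \<Rightarrow> nat set" where
  "inner_faces M = face_id M ` inner_sides M"

text \<open>The interior or phantom face on the side \<open>d\<close>, for \<open>d\<close> not on a hole.\<close>

definition seen_face :: "nat pmap \<Rightarrow> nat \<Rightarrow> face" where
  "seen_face M d = (if d \<in> root_face M then Phantom_Face (phantom_index M d) else Inner (face_id M d))"

definition decorate :: "nat pmap \<Rightarrow> (nat \<Rightarrow> real ^ 'n) \<Rightarrow> (nat \<Rightarrow> real ^ 'n) \<Rightarrow> face \<Rightarrow> real ^ 'n" where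
  "decorate M b \<sigma> F = (case F of
      Inner f \<Rightarrow> (if f \<in> inner_faces M then \<sigma> f else 0)
    | Phantom_Face i \<Rightarrow> (if i < perimeter M then b i else 0))"

text \<open>The factor \<open>1 / 2\<close> in front of the sum accounts for each edge having two semi-edges.\<close>

definition energy :: "real \<Rightarrow> nat pmap \<Rightarrow> (face \<Rightarrow> real ^ 'n) \<Rightarrow> real" where
  "energy \<beta> M \<phi> =
     \<beta> / 2 * (1 / 2 * (\<Sum>d\<in>sides M. (norm (\<phi> (seen_face M d) - \<phi> (seen_face M (opp M d))))\<^sup>2))"

primrec own_faces :: "nat pmap option \<Rightarrow> face set" where
  "own_faces None = {}"
| "own_faces (Some q) = Inner ` inner_faces q \<union> Phantom_Face ` {..<perimeter q}"

definition faces_inside :: "nat pmap option \<Rightarrow> nat pmap \<Rightarrow> nat \<Rightarrow> face set" where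
  "faces_inside q p h = (case q of
      None \<Rightarrow> own_faces (Some p)
    | Some q' \<Rightarrow> Inner ` inner_faces (hole_parts q p h))"

text \<open>
  For \<open>submap q (Some p)\<close>, \<open>base_face\<close> and \<open>hole_face\<close> are the inclusions of the faces of \<open>q\<close>
  and of the faces inside the hole \<open>h\<close> into the faces of \<open>p\<close>.
\<close>

definition glue_iso :: "nat pmap \<Rightarrow> (nat \<Rightarrow> nat pmap) \<Rightarrow> nat + nat \<times> nat \<Rightarrow> nat" where
  "glue_iso q u = (SOME f. map_iso f (raw_glue q u) (glue_map q u))"

definition base_face :: "nat pmap option \<Rightarrow> nat pmap \<Rightarrow> face \<Rightarrow> face" where
  "base_face q p F = (case (q, F) of
      (Some q', Inner f) \<Rightarrow> Inner (face_id p (glue_iso q' (hole_parts q p) (Inl f)))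
    | _ \<Rightarrow> F)"

definition hole_face :: "nat pmap option \<Rightarrow> nat pmap \<Rightarrow> nat \<Rightarrow> face \<Rightarrow> face" where
  "hole_face q p h F = (case (q, F) of
      (Some q', Inner f) \<Rightarrow> Inner (face_id p (glue_iso q' (hole_parts q p) (Inr (h, f))))
    | _ \<Rightarrow> F)"

text \<open>The restriction of \<open>\<phi>\<close> to the faces of \<open>q\<close>, as a function of the faces of \<open>q\<close>.\<close>

definition restr :: "nat pmap option \<Rightarrow> nat pmap \<Rightarrow> (face \<Rightarrow> real ^ 'n) \<Rightarrow> face \<Rightarrow> real ^ 'n" where
  "restr q p \<phi> F = (if F \<in> own_faces q then \<phi> (base_face q p F) else 0)"

definition hole_bc :: "nat pmap \<Rightarrow> (face \<Rightarrow> real ^ 'n) \<Rightarrow> nat \<Rightarrow> nat \<Rightarrow> real ^ 'n" where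
  "hole_bc q \<sigma> h i = \<sigma> (seen_face q (hole_edge q h i))"

text \<open>
  The part of \<open>\<phi>\<close> inside the hole \<open>h\<close>, as a decoration of the map filling \<open>h\<close>: the faces of
  \<open>q\<close> adjacent to \<open>h\<close> are its phantom faces.
\<close>

definition part_dec ::
  "nat pmap option \<Rightarrow> nat pmap \<Rightarrow> (face \<Rightarrow> real ^ 'n) \<Rightarrow> nat \<Rightarrow> face \<Rightarrow> real ^ 'n" where
  "part_dec q p \<phi> h = (case q of
      None \<Rightarrow> \<phi>
    | Some q' \<Rightarrow> decorate (hole_parts q p h) (hole_bc q' (restr q p \<phi>) h)
                   (\<lambda>f. \<phi> (hole_face q p h (Inner f))))"

definition parts ::
  "nat pmap option \<Rightarrow> nat pmap \<Rightarrow> (face \<Rightarrow> real ^ 'n) \<Rightarrow> nat \<Rightarrow> nat pmap \<times> (face \<Rightarrow> real ^ 'n)" where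
  "parts q p \<phi> = (\<lambda>h\<in>holes q. (hole_parts q p h, part_dec q p \<phi> h))"

text \<open>Extension by \<open>0\<close> to functions on the faces of \<open>p\<close>.\<close>

definition extend_base ::
  "nat pmap option \<Rightarrow> nat pmap \<Rightarrow> (face \<Rightarrow> real ^ 'n) \<Rightarrow> face \<Rightarrow> real ^ 'n" where
  "extend_base q p \<sigma> F = (\<Sum>G\<in>{G \<in> own_faces q. base_face q p G = F}. \<sigma> G)"

definition extend_holes ::
  "nat pmap option \<Rightarrow> nat pmap \<Rightarrow> (nat \<Rightarrow> face \<Rightarrow> real ^ 'n) \<Rightarrow> face \<Rightarrow> real ^ 'n" where
  "extend_holes q p \<tau> F =
     (\<Sum>h\<in>holes q. \<Sum>G\<in>{G \<in> faces_inside q p h. hole_face q p h G = F}. \<tau> h G)"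


section \<open>Boltzmann decorated maps\<close>

definition supp :: "'a::topological_space measure \<Rightarrow> 'a set" where
  "supp \<mu> = {x. \<forall>U. open U \<and> x \<in> U \<longrightarrow> 0 < emeasure \<mu> U}"

definition dec_space :: "(face \<Rightarrow> real ^ 'n) measure" where
  "dec_space = PiM UNIV (\<lambda>_. borel)"

definition dmap_space :: "(nat pmap \<times> (face \<Rightarrow> real ^ 'n)) measure" where
  "dmap_space = count_space QH \<Otimes>\<^sub>M dec_space"

definition boltz_weight :: "real \<Rightarrow> real \<Rightarrow> nat pmap \<Rightarrow> (face \<Rightarrow> real ^ 'n) \<Rightarrow> real" where
  "boltz_weight \<beta> w M \<phi> = w ^ card (inner_faces M) * exp (- energy \<beta> M \<phi>)"

definition partition_function ::
  "real \<Rightarrow> (real ^ 'n) measure \<Rightarrow> real \<Rightarrow> nat \<Rightarrow> (nat \<Rightarrow> real ^ 'n) \<Rightarrow> ennreal" where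
  "partition_function \<beta> \<mu> w l b =
     (\<integral>\<^sup>+ M. (\<integral>\<^sup>+ \<sigma>. ennreal (boltz_weight \<beta> w M (decorate M b \<sigma>)) \<partial>PiM (inner_faces M) (\<lambda>_. \<mu>))
        \<partial>count_space (quads l))"

text \<open>If the partition function is infinite, this is the null measure.\<close>

definition boltzmann_law ::
  "real \<Rightarrow> (real ^ 'n) measure \<Rightarrow> real \<Rightarrow> nat \<Rightarrow> (nat \<Rightarrow> real ^ 'n)
     \<Rightarrow> (nat pmap \<times> (face \<Rightarrow> real ^ 'n)) measure" where
  "boltzmann_law \<beta> \<mu> w l b = measure_of (space dmap_space) (sets dmap_space)
     (\<lambda>A. (\<integral>\<^sup>+ M. (\<integral>\<^sup>+ \<sigma>. ennreal (boltz_weight \<beta> w M (decorate M b \<sigma>))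
                        * indicator A (M, decorate M b \<sigma>) \<partial>PiM (inner_faces M) (\<lambda>_. \<mu>))
             \<partial>count_space (quads l))
          / partition_function \<beta> \<mu> w l b)"

definition boltzmann_map ::
  "'w measure \<Rightarrow> real \<Rightarrow> (real ^ 'n) measure \<Rightarrow> real \<Rightarrow> nat \<Rightarrow> (nat \<Rightarrow> real ^ 'n)
     \<Rightarrow> ('w \<Rightarrow> nat pmap) \<Rightarrow> ('w \<Rightarrow> face \<Rightarrow> real ^ 'n) \<Rightarrow> bool" where
  "boltzmann_map P \<beta> \<mu> w l b \<QQ> \<phi> \<longleftrightarrow>
     (\<forall>i<2 * l. b i \<in> supp \<mu>) \<and> partition_function \<beta> \<mu> w l b < \<infinity> \<and>
     (\<lambda>\<omega>. (\<QQ> \<omega>, \<phi> \<omega>)) \<in> P \<rightarrow>\<^sub>M dmap_space \<and>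
     distr P dmap_space (\<lambda>\<omega>. (\<QQ> \<omega>, \<phi> \<omega>)) = boltzmann_law \<beta> \<mu> w l b"

text \<open>
  The law of a Boltzmann decorated map with boundary \<open>h\<close> and boundary condition read off from
  \<open>\<sigma>\<close> on the faces of \<open>q\<close> adjacent to \<open>h\<close>. The hole of the empty map has the boundary of the
  whole map, with semi-perimeter \<open>l\<close> and boundary condition \<open>b\<close>.
\<close>

definition hole_law ::
  "real \<Rightarrow> (real ^ 'n) measure \<Rightarrow> real \<Rightarrow> nat \<Rightarrow> (nat \<Rightarrow> real ^ 'n) \<Rightarrow> nat pmap option
     \<Rightarrow> (face \<Rightarrow> real ^ 'n) \<Rightarrow> nat \<Rightarrow> (nat pmap \<times> (face \<Rightarrow> real ^ 'n)) measure" where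
  "hole_law \<beta> \<mu> w l b q \<sigma> h = (case q of
      None \<Rightarrow> boltzmann_law \<beta> \<mu> w l b
    | Some q' \<Rightarrow> boltzmann_law \<beta> \<mu> w (hole_deg q' h div 2) (hole_bc q' \<sigma> h))"

text \<open>
  On the event \<open>E\<close>, conditionally on \<open>G\<close>, the family of decorated maps filling the holes of the
  random map \<open>R\<close> is distributed as a product of Boltzmann laws. The index set of the family
  depends on \<open>R\<close>, so a test event is a family \<open>A\<close> of events, one for each value of \<open>R\<close>.
\<close>

definition cond_boltzmann ::
  "'w measure \<Rightarrow> 'w measure \<Rightarrow> real \<Rightarrow> (real ^ 'n) measure \<Rightarrow> real \<Rightarrow> nat \<Rightarrow> (nat \<Rightarrow> real ^ 'n)
     \<Rightarrow> ('w \<Rightarrow> nat pmap) \<Rightarrow> ('w \<Rightarrow> face \<Rightarrow> real ^ 'n)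
     \<Rightarrow> 'w set \<Rightarrow> ('w \<Rightarrow> nat pmap option) \<Rightarrow> bool" where
  "cond_boltzmann P G \<beta> \<mu> w l b \<QQ> \<phi> E R \<longleftrightarrow>
     (\<forall>A. (\<forall>q\<in>QHd. A q \<in> sets (PiM (holes q) (\<lambda>_. dmap_space))) \<longrightarrow>
        (AE \<omega> in P. \<omega> \<in> E \<longrightarrow>
           real_cond_exp P G (indicator {\<omega> \<in> E. parts (R \<omega>) (\<QQ> \<omega>) (\<phi> \<omega>) \<in> A (R \<omega>)}) \<omega> =
           measure (PiM (holes (R \<omega>))
                     (hole_law \<beta> \<mu> w l b (R \<omega>) (restr (R \<omega>) (\<QQ> \<omega>) (\<phi> \<omega>))))
             (A (R \<omega>))))"


section \<open>Filtrations and stopping maps\<close>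

definition map_filtration :: "'w measure \<Rightarrow> (nat pmap option \<Rightarrow> 'w measure) \<Rightarrow> bool" where
  "map_filtration P \<F> \<longleftrightarrow>
     (\<forall>q\<in>QHd. subalgebra P (\<F> q) \<and> (\<forall>N\<in>null_sets P. \<forall>S\<subseteq>N. S \<in> sets (\<F> q))) \<and>
     (\<forall>q\<^sub>1\<in>QHd. \<forall>q\<^sub>2\<in>QHd. submap q\<^sub>1 q\<^sub>2 \<longrightarrow> sets (\<F> q\<^sub>1) \<subseteq> sets (\<F> q\<^sub>2))"

definition inside_event :: "'w measure \<Rightarrow> nat pmap option \<Rightarrow> ('w \<Rightarrow> nat pmap) \<Rightarrow> 'w set" where
  "inside_event P q \<QQ> = {\<omega> \<in> space P. submap q (Some (\<QQ> \<omega>))}"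

definition filtered_boltzmann_map ::
  "'w measure \<Rightarrow> (nat pmap option \<Rightarrow> 'w measure) \<Rightarrow> real \<Rightarrow> (real ^ 'n) measure \<Rightarrow> real \<Rightarrow> nat
     \<Rightarrow> (nat \<Rightarrow> real ^ 'n) \<Rightarrow> ('w \<Rightarrow> nat pmap) \<Rightarrow> ('w \<Rightarrow> face \<Rightarrow> real ^ 'n) \<Rightarrow> bool" where
  "filtered_boltzmann_map P \<F> \<beta> \<mu> w l b \<QQ> \<phi> \<longleftrightarrow>
     boltzmann_map P \<beta> \<mu> w l b \<QQ> \<phi> \<and>
     (\<forall>q\<in>QHd.
        inside_event P q \<QQ> \<in> sets (\<F> q) \<and>
        (\<lambda>\<omega>. if \<omega> \<in> inside_event P q \<QQ> then restr q (\<QQ> \<omega>) (\<phi> \<omega>) else (\<lambda>_. 0))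
          \<in> \<F> q \<rightarrow>\<^sub>M dec_space \<and>
        cond_boltzmann P (\<F> q) \<beta> \<mu> w l b \<QQ> \<phi> (inside_event P q \<QQ>) (\<lambda>_. q))"

definition stopping_map ::
  "'w measure \<Rightarrow> (nat pmap option \<Rightarrow> 'w measure) \<Rightarrow> ('w \<Rightarrow> nat pmap)
     \<Rightarrow> ('w \<Rightarrow> nat pmap option) \<Rightarrow> bool" where
  "stopping_map P \<F> \<QQ> R \<longleftrightarrow>
     R \<in> P \<rightarrow>\<^sub>M count_space QHd \<and>
     (AE \<omega> in P. submap (R \<omega>) (Some (\<QQ> \<omega>))) \<and>
     (\<forall>q\<in>QHd. {\<omega> \<in> space P. submap (R \<omega>) q} \<in> sets (\<F> q))"

definition stopped_events ::
  "'w measure \<Rightarrow> (nat pmap option \<Rightarrow> 'w measure) \<Rightarrow> ('w \<Rightarrow> nat pmap option) \<Rightarrow> 'w set set" where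
  "stopped_events P \<F> R =
     {\<Theta> \<in> sigma_sets (space P) (\<Union>q\<in>QHd. sets (\<F> q)).
        \<forall>q\<in>QHd. \<Theta> \<inter> {\<omega> \<in> space P. submap (R \<omega>) q} \<in> sets (\<F> q)}"

text \<open>The \<open>\<sigma>\<close>-algebra generated by the stopped \<open>\<sigma>\<close>-algebra and the decoration of \<open>R\<close>.\<close>

definition stopped_sigma ::
  "'w measure \<Rightarrow> (nat pmap option \<Rightarrow> 'w measure) \<Rightarrow> ('w \<Rightarrow> nat pmap option) \<Rightarrow> ('w \<Rightarrow> nat pmap)
     \<Rightarrow> ('w \<Rightarrow> face \<Rightarrow> real ^ 'n) \<Rightarrow> 'w measure" where
  "stopped_sigma P \<F> R \<QQ> \<phi> = sigma (space P)
     (stopped_events P \<F> R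
      \<union> {(\<lambda>\<omega>. restr (R \<omega>) (\<QQ> \<omega>) (\<phi> \<omega>)) -` B \<inter> space P | B. B \<in> sets dec_space})"

end

theory Submission
  imports Defs
begin

text \<open>
  Since maps with holes are countable, conditioning on the stopped \<open>\<sigma>\<close>-algebra can be localised to
  the events \<open>R = q\<close>. Such an event lies in \<open>\<F> q\<close> because it is the event that \<open>R\<close> is contained in
  \<open>q\<close> but in no smaller map; here the order must be reflexive and antisymmetric. On it the traces of
  the stopped \<open>\<sigma>\<close>-algebra and of \<open>\<F> q\<close> agree, so the conditional law is the one given by the
  Boltzmann property at the deterministic map \<open>q\<close>.

  The combinatorial input is that gluing planar maps yields a planar map: the gluing identifies at
  most one pair of vertices per side of a hole, which bounds the number of vertices from below, and
  the inequality \<open>V + F \<le> E + 2\<close> for connected maps bounds it from above.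
\<close>

section \<open>Counting classes of a generated equivalence\<close>

text \<open>The boundary of a filling may touch itself, so the vertices on the boundary of a hole
  can be merged in a pattern that depends on all fillings at once. Bounding the number of vertices
  from both sides avoids describing this pattern, because the two bounds coincide. Sphericity is
  needed even to work with \<open>glue_map\<close>: it picks a representative by choice, and only
  for a spherical raw map is that representative known to be isomorphic to it.

  Antisymmetry is the other obstacle, since gluing can leave all counts unchanged. Mutual inclusion
  forces every filling to be a cycle with a single hole; the clause on marked edges then makes the
  gluing trivial up to isomorphism, hence trivial for representatives. The same cycles, built
  explicitly, give reflexivity.

  On the probabilistic side, \<open>R\<close> is contained in the random map only almost surely;
  completeness of the sigma-algebras absorbs the exceptional set. The parts are chosen by
  \<open>SOME\<close>, but they cause no measurability problem because they are constant once
  \<open>q\<close> and the value of \<open>\<QQ>\<close> are fixed.\<close>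

definition eqcl :: "('a \<times> 'a) set \<Rightarrow> ('a \<times> 'a) set" where
  "eqcl r = (r \<union> r\<inverse>)\<^sup>*"

definition cls :: "('a \<times> 'a) set \<Rightarrow> 'a \<Rightarrow> 'a set" where
  "cls r x = eqcl r `` {x}"

text \<open>The equivalence lives on the whole type and \<open>S\<close> only selects which classes
  are counted. The classes of one relation can thus be compared on two different sets of
  representatives.\<close>

definition ncls :: "('a \<times> 'a) set \<Rightarrow> 'a set \<Rightarrow> nat" where
  "ncls r S = card (cls r ` S)"

lemma eqcl_equiv: "equiv UNIV (eqcl r)"
  unfolding eqcl_def
  by (intro equivI refl_rtrancl trans_rtrancl sym_rtrancl) (auto simp: sym_def refl_on_def)

lemma eqcl_refl [simp]: "(x, x) \<in> eqcl r"
  by (simp add: eqcl_def)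

lemma eqcl_sym: "(x, y) \<in> eqcl r \<Longrightarrow> (y, x) \<in> eqcl r"
  using eqcl_equiv[of r] by (auto simp: equiv_def sym_def)

lemma eqcl_trans: "(x, y) \<in> eqcl r \<Longrightarrow> (y, z) \<in> eqcl r \<Longrightarrow> (x, z) \<in> eqcl r"
  by (simp add: eqcl_def)

lemma eqcl_base: "(x, y) \<in> r \<Longrightarrow> (x, y) \<in> eqcl r"
  by (auto simp: eqcl_def)

lemma eqcl_least:
  assumes "r \<subseteq> eqcl s"
  shows "eqcl r \<subseteq> eqcl s"
proof -
  have "r \<union> r\<inverse> \<subseteq> eqcl s"
    using assms eqcl_sym by fastforce
  then show ?thesis
    unfolding eqcl_def by (metis rtrancl_subset_rtrancl)
qed

lemma cls_iff [simp]: "y \<in> cls r x \<longleftrightarrow> (x, y) \<in> eqcl r"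
  by (simp add: cls_def)

lemma cls_eq_iff: "cls r x = cls r y \<longleftrightarrow> (x, y) \<in> eqcl r"
  unfolding cls_def using eq_equiv_class_iff[OF eqcl_equiv, of x y r] by simp

lemma cls_cong:
  assumes "r \<subseteq> eqcl s" "s \<subseteq> eqcl r"
  shows "cls r = cls s"
  using eqcl_least[OF assms(1)] eqcl_least[OF assms(2)] by (auto simp: cls_def fun_eq_iff)

text \<open>The right-hand side contains \<open>x\<close> and is closed under every step of the
  enlarged relation, which gives one inclusion. For the other it is enough that the enlarged
  equivalence contains the old one and the pair \<open>(a, b)\<close>.\<close>

lemma cls_insert:
  "cls (insert (a, b) r) x =
     (if x \<in> cls r a \<union> cls r b then cls r a \<union> cls r b else cls r x)" (is "_ = ?T x")
proof (rule set_eqI)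
  fix y
  let ?s = "insert (a, b) r"
  have sub: "eqcl r \<subseteq> eqcl ?s"
    by (rule eqcl_least) (auto intro: eqcl_base)
  have ab: "(a, b) \<in> eqcl ?s"
    by (auto intro: eqcl_base)
  have closed: "z \<in> ?T x" if "y \<in> ?T x" "(y, z) \<in> ?s \<union> ?s\<inverse>" for y z
  proof -
    consider "(y, z) \<in> eqcl r" | "y = a" "z = b" | "y = b" "z = a"
      using \<open>(y, z) \<in> _\<close> eqcl_base eqcl_sym by fastforce
    then show ?thesis
      using that(1) by cases (auto split: if_splits intro: eqcl_trans eqcl_sym)
  qed
  show "y \<in> cls ?s x \<longleftrightarrow> y \<in> ?T x"
  proof
    assume "y \<in> cls ?s x"
    then have "(x, y) \<in> (?s \<union> ?s\<inverse>)\<^sup>*"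
      by (simp add: eqcl_def)
    then show "y \<in> ?T x"
    proof induction
      case base
      show ?case by auto
    next
      case (step y z)
      then show ?case using closed by blast
    qed
  next
    assume "y \<in> ?T x"
    then show "y \<in> cls ?s x"
      using sub ab by (auto split: if_splits) (meson subsetD eqcl_trans eqcl_sym)+
  qed
qed

lemma ncls_insert_related:
  assumes "(a, b) \<in> eqcl r"
  shows "ncls (insert (a, b) r) S = ncls r S"
proof -
  have "cls (insert (a, b) r) = cls r"
    using assms by (intro cls_cong) (auto intro: eqcl_base)
  then show ?thesis by (simp add: ncls_def)
qed

lemma ncls_insert_unrelated:
  assumes "finite S" "a \<in> S" "b \<in> S" "(a, b) \<notin> eqcl r"
  shows "Suc (ncls (insert (a, b) r) S) = ncls r S"
proof -
  let ?C = "cls r ` S - {cls r a, cls r b}"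
  have "cls (insert (a, b) r) ` S = insert (cls r a \<union> cls r b) ?C"
  proof (intro equalityI subsetI)
    fix X assume "X \<in> cls (insert (a, b) r) ` S"
    then show "X \<in> insert (cls r a \<union> cls r b) ?C"
      by (auto simp: cls_insert cls_eq_iff dest: eqcl_sym)
  next
    fix X assume "X \<in> insert (cls r a \<union> cls r b) ?C"
    then consider "X = cls r a \<union> cls r b" | x where "x \<in> S" "X = cls r x" "X \<noteq> cls r a" "X \<noteq> cls r b"
      by blast
    then show "X \<in> cls (insert (a, b) r) ` S"
    proof cases
      case 1
      then show ?thesis using assms(2) by (intro image_eqI[of _ _ a]) (auto simp: cls_insert)
    next
      case 2
      then have "X = cls (insert (a, b) r) x"
        by (auto simp: cls_insert cls_eq_iff dest: eqcl_sym)
      then show ?thesis using 2 by blast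
    qed
  qed
  \<comment> \<open>The merged class must be new for the count to drop by exactly one: an old class
    containing \<open>a\<close> is the class of \<open>a\<close>, which has been removed.\<close>
  moreover have "cls r a \<union> cls r b \<notin> ?C"
  proof
    assume "cls r a \<union> cls r b \<in> ?C"
    then obtain x where x: "cls r x = cls r a \<union> cls r b" "cls r x \<noteq> cls r a"
      by (metis DiffE imageE insertCI)
    then have "a \<in> cls r x" by simp
    then show False using x(2) by (simp add: cls_eq_iff)
  qed
  ultimately have "ncls (insert (a, b) r) S = Suc (card ?C)"
    using assms(1) by (simp add: ncls_def)
  moreover have "cls r a \<noteq> cls r b"
    using assms(4) by (simp add: cls_eq_iff)
  then have "card ?C + 2 = card (cls r ` S)"
    using assms card_Diff_subset[of "{cls r a, cls r b}" "cls r ` S"]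
      card_mono[of "cls r ` S" "{cls r a, cls r b}"] by auto
  ultimately show ?thesis by (simp add: ncls_def)
qed

lemma ncls_insert_ge:
  assumes "finite S" "a \<in> S" "b \<in> S"
  shows "ncls r S \<le> Suc (ncls (insert (a, b) r) S)"
  using ncls_insert_related[of a b r S] ncls_insert_unrelated[OF assms, of r] by fastforce

lemma ncls_insert_le:
  assumes "finite S" "a \<in> S" "b \<in> S"
  shows "ncls (insert (a, b) r) S \<le> ncls r S"
  using ncls_insert_related[of a b r S] ncls_insert_unrelated[OF assms, of r] by fastforce

text \<open>Every added pair merges at most two classes into one.\<close>

lemma ncls_union_ge:
  assumes "finite S" "finite r" "r \<subseteq> S \<times> S"
  shows "ncls s S \<le> ncls (r \<union> s) S + card r"
  using assms(2,3)
proof (induction r)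
  case (insert e r)
  obtain a b where e: "e = (a, b)" by force
  have "ncls s S \<le> ncls (r \<union> s) S + card r"
    using insert by auto
  also have "ncls (r \<union> s) S \<le> Suc (ncls (insert (a, b) (r \<union> s)) S)"
    using insert.prems assms(1) by (intro ncls_insert_ge) (auto simp: e)
  finally show ?case
    using insert.hyps by (simp add: e)
qed auto

section \<open>Cycles of a bijection of a finite set\<close>

definition arcs :: "('a \<Rightarrow> 'a) \<Rightarrow> 'a set \<Rightarrow> ('a \<times> 'a) set" where
  "arcs f S = (\<lambda>x. (x, f x)) ` S"

text \<open>Only the behaviour on \<open>S\<close> is prescribed, because the functions of a glued
  map are uncontrolled elsewhere. Facts on permutations are imported through
  \<open>perm_restrict\<close>.\<close>

locale finite_bij =
  fixes f :: "'a \<Rightarrow> 'a" and S :: "'a set"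
  assumes finite_S: "finite S" and bij: "bij_betw f S S"
begin

lemma in_S [simp]: "x \<in> S \<Longrightarrow> f x \<in> S"
  using bij by (rule bij_betw_apply)

lemma inj_S: "x \<in> S \<Longrightarrow> y \<in> S \<Longrightarrow> f x = f y \<longleftrightarrow> x = y"
  using bij by (auto simp: bij_betw_def inj_on_def)

lemma restrict_permutes: "perm_restrict f S permutes S"
  using bij by (intro bij_imp_permutes) (auto simp: perm_restrict_def cong: bij_betw_cong)

lemma restrict_permutation: "permutation (perm_restrict f S)"
  using restrict_permutes finite_S by (auto simp: permutation_permutes)

lemma orbit_restrict: "x \<in> S \<Longrightarrow> orbit f x = orbit (perm_restrict f S) x"
  by (rule orbit_cong0[of _ S]) (auto simp: perm_restrict_def)

lemma orbit_self: "x \<in> S \<Longrightarrow> x \<in> orbit f x"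
  using permutation_self_in_orbit[OF restrict_permutation] by (simp add: orbit_restrict)

lemma orbit_sub: "x \<in> S \<Longrightarrow> orbit f x \<subseteq> S"
  using permutes_orbit_subset[OF restrict_permutes] by (simp add: orbit_restrict)

lemma orbit_fin: "x \<in> S \<Longrightarrow> finite (orbit f x)"
  using orbit_sub finite_S finite_subset by blast

lemma orbit_eq: "x \<in> S \<Longrightarrow> y \<in> orbit f x \<Longrightarrow> orbit f y = orbit f x"
  by (meson orbit_self orbit_swap orbit_trans subsetI subset_antisym)

lemma orbit_step_eq [simp]: "x \<in> S \<Longrightarrow> orbit f (f x) = orbit f x"
  by (intro orbit_eq orbit.base)

lemma orbit_step_iff: "x \<in> S \<Longrightarrow> y \<in> S \<Longrightarrow> f y \<in> orbit f x \<longleftrightarrow> y \<in> orbit f x"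
  by (metis orbit.step orbit_eq orbit_self orbit_step_eq)

lemma orbit_closed: "x \<in> S \<Longrightarrow> y \<in> orbit f x \<Longrightarrow> y \<in> S"
  using orbit_sub by blast

text \<open>Finiteness makes forward orbits closed under predecessors, so a cycle is a whole class
  of the relation generated by its arcs. Cycles can then be counted by \<open>ncls\<close>, where
  the effect of adding a pair is known.\<close>

lemma orbit_eq_cls: "x \<in> S \<Longrightarrow> orbit f x = cls (arcs f S) x"
proof (intro equalityI subsetI)
  fix y assume x: "x \<in> S" and "y \<in> orbit f x"
  from this(2) show "y \<in> cls (arcs f S) x"
  proof induction
    case base
    show ?case using x by (auto simp: arcs_def intro: eqcl_base)
  next
    case (step y)
    then have "(y, f y) \<in> eqcl (arcs f S)"
      using orbit_closed[OF x] by (auto simp: arcs_def intro: eqcl_base)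
    then show ?case using step.IH by (auto intro: eqcl_trans)
  qed
next
  fix y assume x: "x \<in> S" and "y \<in> cls (arcs f S) x"
  then have "(x, y) \<in> (arcs f S \<union> (arcs f S)\<inverse>)\<^sup>*"
    by (simp add: eqcl_def)
  then show "y \<in> orbit f x"
  proof induction
    case base
    show ?case using x by (rule orbit_self)
  next
    case (step y z)
    then show ?case
      using orbit_step_iff[OF x] by (auto simp: arcs_def)
  qed
qed

lemma card_orbits: "card (orbit f ` S) = ncls (arcs f S) S"
  using orbit_eq_cls by (simp add: ncls_def cong: image_cong)

end

section \<open>Effect of a transposition on the number of cycles\<close>

lemma finite_bij_transpose:
  assumes "finite_bij f S" "a \<in> S" "b \<in> S"
  shows "finite_bij (f \<circ> Transposition.transpose a b) S"
proof
  interpret finite_bij f S by fact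
  show "finite S" by (rule finite_S)
  show "bij_betw (f \<circ> Transposition.transpose a b) S S"
    using assms(2,3) bij permutes_imp_bij[OF permutes_swap_id, of a S b] by (intro bij_betw_trans) auto
qed

text \<open>The composed bijection sends \<open>b\<close> to \<open>f a\<close>, thus enters the
  cycle of \<open>a\<close>, and then follows it undisturbed until it arrives at
  \<open>a\<close>.\<close>

lemma orbit_transpose_joins:
  assumes "finite_bij f S" "a \<in> S" "b \<in> S" "b \<notin> orbit f a"
  shows "a \<in> orbit (f \<circ> Transposition.transpose a b) b"
proof -
  interpret finite_bij f S by fact
  let ?g = "f \<circ> Transposition.transpose a b"
  \<comment> \<open>The length of the cycle of \<open>a\<close>. Before time \<open>n\<close> the
    path meets neither \<open>a\<close> nor \<open>b\<close>, the only points where the two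
    bijections differ.\<close>
  define n where "n = funpow_dist1 f a a"
  have *: "(?g ^^ Suc j) b = (f ^^ Suc j) a" if "j < n" for j
    using that
  proof (induction j)
    case 0
    show ?case by simp
  next
    case (Suc j)
    let ?y = "(f ^^ Suc j) a"
    have "?y \<in> orbit f a" unfolding orbit_altdef by blast
    then have "?y \<noteq> b" using assms(4) by blast
    moreover have "?y \<noteq> a"
      using funpow_dist1_least[of "Suc j" f a a] Suc.prems by (simp add: n_def)
    ultimately have "?g ?y = f ?y" by simp
    then show ?case using Suc by simp
  qed
  have "0 < n" "(f ^^ n) a = a"
    using funpow_dist1_prop[OF orbit_self[OF assms(2)]] by (auto simp: n_def)
  then have "(?g ^^ n) b = a"
    using *[of "n - 1"] by simp
  then show ?thesis
    using \<open>0 < n\<close> by (auto simp: orbit_altdef intro!: exI[of _ n])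
qed

text \<open>The two bijections differ only in which of \<open>a\<close> and \<open>b\<close> gets
  which image, and this is invisible once \<open>a\<close> and \<open>b\<close> are identified. One
  inclusion for arbitrary \<open>g\<close> suffices because transposing twice gives back
  \<open>f\<close>.\<close>

lemma cls_transpose:
  assumes "a \<in> S" "b \<in> S"
  shows "cls (insert (a, b) (arcs (f \<circ> Transposition.transpose a b) S)) = cls (insert (a, b) (arcs f S))"
proof (rule cls_cong)
  have *: "arcs (g \<circ> Transposition.transpose a b) S \<subseteq> eqcl (insert (a, b) (arcs g S))" for g :: "'a \<Rightarrow> 'a"
  proof
    fix e assume "e \<in> arcs (g \<circ> Transposition.transpose a b) S"
    then obtain x where x: "x \<in> S" "e = (x, g (Transposition.transpose a b x))"
      by (auto simp: arcs_def)
    let ?r = "insert (a, b) (arcs g S)"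
    have "(x, Transposition.transpose a b x) \<in> eqcl ?r"
      by (auto simp: Transposition.transpose_def intro: eqcl_base eqcl_sym)
    moreover have "(Transposition.transpose a b x, g (Transposition.transpose a b x)) \<in> eqcl ?r"
      using x assms by (auto simp: arcs_def Transposition.transpose_def intro!: eqcl_base)
    ultimately show "e \<in> eqcl ?r"
      using x by (auto intro: eqcl_trans)
  qed
  show "insert (a, b) (arcs (f \<circ> Transposition.transpose a b) S) \<subseteq> eqcl (insert (a, b) (arcs f S))"
    using *[of f] by (auto intro: eqcl_base)
  show "insert (a, b) (arcs f S) \<subseteq> eqcl (insert (a, b) (arcs (f \<circ> Transposition.transpose a b) S))"
    using *[of "f \<circ> Transposition.transpose a b"] by (auto simp: comp_assoc intro: eqcl_base)
qed

text \<open>Both bijections have the same quotient after \<open>a\<close> and \<open>b\<close> are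
  identified. Passing to it costs the composed bijection at most one class, and it has no more
  classes than \<open>f\<close> has cycles.\<close>

lemma card_orbits_transpose_le:
  assumes "finite_bij f S" "a \<in> S" "b \<in> S"
  shows "card (orbit (f \<circ> Transposition.transpose a b) ` S) \<le> Suc (card (orbit f ` S))"
proof -
  interpret finite_bij f S by fact
  interpret g: finite_bij "f \<circ> Transposition.transpose a b" S by (rule finite_bij_transpose[OF assms])
  have "ncls (arcs (f \<circ> Transposition.transpose a b) S) S \<le> Suc (ncls (insert (a, b) (arcs (f \<circ> Transposition.transpose a b) S)) S)"
    using assms finite_S by (intro ncls_insert_ge) auto
  also have "ncls (insert (a, b) (arcs (f \<circ> Transposition.transpose a b) S)) S = ncls (insert (a, b) (arcs f S)) S"
    by (simp add: ncls_def cls_transpose[OF assms(2,3)])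
  also have "\<dots> \<le> ncls (arcs f S) S"
    using assms finite_S by (intro ncls_insert_le) auto
  finally show ?thesis
    by (simp only: card_orbits g.card_orbits)
qed

text \<open>Identifying \<open>a\<close> and \<open>b\<close> changes nothing for the composition,
  where they already share a cycle, but merges two cycles of \<open>f\<close>.\<close>

lemma card_orbits_transpose_joins:
  assumes "finite_bij f S" "a \<in> S" "b \<in> S" "b \<notin> orbit f a"
  shows "Suc (card (orbit (f \<circ> Transposition.transpose a b) ` S)) = card (orbit f ` S)"
proof -
  interpret finite_bij f S by fact
  interpret g: finite_bij "f \<circ> Transposition.transpose a b" S by (rule finite_bij_transpose[OF assms(1-3)])
  have "(a, b) \<in> eqcl (arcs (f \<circ> Transposition.transpose a b) S)"
    using orbit_transpose_joins[OF assms] g.orbit_eq_cls[OF assms(3)] by (auto intro: eqcl_sym)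
  then have "ncls (arcs (f \<circ> Transposition.transpose a b) S) S = ncls (insert (a, b) (arcs f S)) S"
    using ncls_insert_related[of a b "arcs (f \<circ> Transposition.transpose a b) S" S]
    by (simp add: ncls_def cls_transpose[OF assms(2,3)])
  moreover have "Suc (ncls (insert (a, b) (arcs f S)) S) = ncls (arcs f S) S"
    using assms finite_S orbit_eq_cls[OF assms(2)] by (intro ncls_insert_unrelated) auto
  ultimately show ?thesis
    by (simp only: card_orbits g.card_orbits)
qed

text \<open>Edges are added one at a time. An edge with both ends at one vertex creates at most one new
  vertex; an edge with ends at two vertices merges them and lowers the number of connected
  components by at most one.\<close>

lemma genus_partial_edges:
  assumes f: "finite_bij f S"
    and inv: "\<And>x. x \<in> S \<Longrightarrow> g x \<in> S \<and> g x \<noteq> x \<and> g (g x) = x"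
    and T: "T \<subseteq> S" "g ` T \<subseteq> T"
  shows "2 * card (orbit (f \<circ> perm_restrict g T) ` S) + 2 * card (orbit f ` S)
           \<le> card T + 4 * ncls (arcs f S \<union> arcs g T) S \<and> finite_bij (f \<circ> perm_restrict g T) S"
  using T
proof (induction "card T" arbitrary: T rule: less_induct)
  case less
  interpret finite_bij f S by (rule f)
  have finT: "finite T" using less.prems finite_S finite_subset by blast
  show ?case
  proof (cases "T = {}")
    \<comment> \<open>Without edges, vertices, faces and components are all the cycles of
      \<open>f\<close>, and the bound is an equality; this fixes the factor 4.\<close>
    case True
    then have "f \<circ> perm_restrict g T = f" by (auto simp: perm_restrict_def fun_eq_iff)
    then show ?thesis using True f by (simp add: arcs_def[of g] card_orbits)
  next
    case False
    then obtain a where a: "a \<in> T" by blast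
    define b where "b = g a"
    define T' where "T' = T - {a, b}"
    have ab: "a \<in> S" "b \<in> S" "b \<in> T" "a \<noteq> b" "g b = a"
      using a less.prems inv[of a] by (auto simp: b_def)
    have T'S: "T' \<subseteq> S" using less.prems by (auto simp: T'_def)
    have T'g: "g ` T' \<subseteq> T'"
    proof
      fix y assume "y \<in> g ` T'"
      then obtain x where x: "x \<in> T" "x \<noteq> a" "x \<noteq> b" "y = g x" by (auto simp: T'_def)
      moreover have "g y = x" using x inv less.prems by auto
      ultimately show "y \<in> T'" using ab less.prems by (auto simp: T'_def b_def)
    qed
    have card: "card T = card T' + 2"
      using ab a finT card_Diff_subset[of "{a, b}" T] card_mono[of T "{a, b}"] by (auto simp: T'_def)
    let ?h = "f \<circ> perm_restrict g T'"
    have IH: "2 * card (orbit ?h ` S) + 2 * card (orbit f ` S)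
           \<le> card T' + 4 * ncls (arcs f S \<union> arcs g T') S" "finite_bij ?h S"
      using less.hyps[of T', OF _ T'S T'g] card by auto
    \<comment> \<open>\<open>perm_restrict g T'\<close> fixes both \<open>a\<close> and
      \<open>b\<close>, so including their edge means transposing them before
      \<open>?h\<close>.\<close>
    have comp: "f \<circ> perm_restrict g T = ?h \<circ> Transposition.transpose a b"
      using ab a by (auto simp: fun_eq_iff perm_restrict_def Transposition.transpose_def T'_def b_def)
    have fin: "finite_bij (f \<circ> perm_restrict g T) S"
      unfolding comp using IH(2) ab by (intro finite_bij_transpose)
    interpret h: finite_bij ?h S by (rule IH)
    have ins: "ncls (arcs f S \<union> arcs g T) S = ncls (insert (a, b) (arcs f S \<union> arcs g T')) S"
    proof -
      have "arcs g T = insert (a, b) (insert (b, a) (arcs g T'))"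
        using ab a by (auto simp: arcs_def T'_def b_def)
      then have "cls (arcs f S \<union> arcs g T) = cls (insert (a, b) (arcs f S \<union> arcs g T'))"
        by (intro cls_cong) (auto intro: eqcl_base eqcl_sym)
      then show ?thesis by (simp add: ncls_def)
    qed
    show ?thesis
    proof (cases "b \<in> orbit ?h a")
      case True
      have "arcs ?h S \<subseteq> eqcl (arcs f S \<union> arcs g T')"
      proof
        fix e assume "e \<in> arcs ?h S"
        then obtain x where x: "x \<in> S" "e = (x, f (perm_restrict g T' x))" by (auto simp: arcs_def)
        have "(x, perm_restrict g T' x) \<in> eqcl (arcs f S \<union> arcs g T')"
          by (auto simp: perm_restrict_def arcs_def intro: eqcl_base)
        moreover have "(perm_restrict g T' x, f (perm_restrict g T' x)) \<in> eqcl (arcs f S \<union> arcs g T')"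
          using x inv T'S by (auto simp: perm_restrict_def arcs_def intro!: eqcl_base)
        ultimately show "e \<in> eqcl (arcs f S \<union> arcs g T')"
          using x by (auto intro: eqcl_trans)
      qed
      moreover have "(a, b) \<in> eqcl (arcs ?h S)"
        using True h.orbit_eq_cls[OF ab(1)] by simp
      ultimately have "(a, b) \<in> eqcl (arcs f S \<union> arcs g T')"
        using eqcl_least by blast
      then have "ncls (arcs f S \<union> arcs g T) S = ncls (arcs f S \<union> arcs g T') S"
        by (simp add: ins ncls_insert_related)
      then show ?thesis
        using IH card fin card_orbits_transpose_le[OF IH(2) ab(1,2)] by (simp add: comp)
    next
      \<comment> \<open>The left side drops by 2. On the right \<open>card T\<close> gains 2 while
        losing a component costs at most 4, so the bound survives exactly.\<close>
      case False
      then have "Suc (card (orbit (f \<circ> perm_restrict g T) ` S)) = card (orbit ?h ` S)"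
        unfolding comp using IH(2) ab by (intro card_orbits_transpose_joins)
      moreover have "ncls (arcs f S \<union> arcs g T') S \<le> Suc (ncls (arcs f S \<union> arcs g T) S)"
        unfolding ins using finite_S ab by (intro ncls_insert_ge)
      ultimately show ?thesis using IH card fin by linarith
    qed
  qed
qed

text \<open>The previous bound with all edges present and one component: \<open>card S\<close> is
  twice the number of edges, so this is \<open>V + F \<le> E + 2\<close> doubled.\<close>

lemma genus_nonneg:
  assumes f: "finite_bij f S"
    and inv: "\<And>x. x \<in> S \<Longrightarrow> g x \<in> S \<and> g x \<noteq> x \<and> g (g x) = x"
    and conn: "\<And>x y. x \<in> S \<Longrightarrow> y \<in> S \<Longrightarrow> (x, y) \<in> eqcl (arcs f S \<union> arcs g S)"
  shows "2 * card (orbit (f \<circ> g) ` S) + 2 * card (orbit f ` S) \<le> card S + 4"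
proof -
  interpret finite_bij f S by fact
  have "orbit (f \<circ> g) x = orbit (f \<circ> perm_restrict g S) x" if "x \<in> S" for x
    using that inv by (intro orbit_cong0[of _ S]) (auto simp: perm_restrict_def)
  then have "orbit (f \<circ> g) ` S = orbit (f \<circ> perm_restrict g S) ` S"
    by auto
  moreover have "ncls (arcs f S \<union> arcs g S) S \<le> 1"
  proof -
    have "card (cls (arcs f S \<union> arcs g S) ` S) \<le> Suc 0"
      using conn finite_S by (subst card_le_Suc0_iff_eq) (auto simp: cls_eq_iff)
    then show ?thesis by (simp add: ncls_def)
  qed
  ultimately show ?thesis
    using genus_partial_edges[OF f inv, of S] inv by fastforce
qed

section \<open>Maps up to isomorphism\<close>

text \<open>Unlike \<^const>\<open>planar_map\<close>, this does not constrain \<^const>\<open>opp\<close> and \<^const>\<open>nxt\<close> outside the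
  sides, so that it is invariant under \<^const>\<open>map_iso\<close> and can hold for \<^const>\<open>raw_glue\<close>.\<close>

locale spherical =
  fixes M :: "'d pmap"
  assumes finite_sides: "finite (sides M)"
    and rt_in: "rt M \<in> sides M"
    and nxt_bij: "bij_betw (nxt M) (sides M) (sides M)"
    and opp_inv: "d \<in> sides M \<Longrightarrow> opp M d \<in> sides M \<and> opp M d \<noteq> d \<and> opp M (opp M d) = d"
    and joined_sides: "joined M (sides M)"
    and euler: "card (orbit (nxt M \<circ> opp M) ` sides M) + card (face_at M ` sides M) = card (sides M) div 2 + 2"
begin

lemma opp_in [simp]: "d \<in> sides M \<Longrightarrow> opp M d \<in> sides M"
  and opp_neq [simp]: "d \<in> sides M \<Longrightarrow> opp M d \<noteq> d"
  and opp_opp [simp]: "d \<in> sides M \<Longrightarrow> opp M (opp M d) = d"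
  using opp_inv by blast+

lemma opp_bij: "bij_betw (opp M) (sides M) (sides M)"
  by (rule bij_betwI[of _ _ _ "opp M"]) auto

sublocale nxt: finite_bij "nxt M" "sides M"
  by unfold_locales (rule finite_sides nxt_bij)+

sublocale vtx: finite_bij "nxt M \<circ> opp M" "sides M"
  by unfold_locales (rule finite_sides bij_betw_trans[OF opp_bij nxt_bij])+

lemma face_self: "d \<in> sides M \<Longrightarrow> d \<in> face_at M d"
  by (simp add: face_at_def nxt.orbit_self)

lemma face_sub: "d \<in> sides M \<Longrightarrow> face_at M d \<subseteq> sides M"
  by (simp add: face_at_def nxt.orbit_sub)

lemma face_eq: "d \<in> sides M \<Longrightarrow> e \<in> face_at M d \<Longrightarrow> face_at M e = face_at M d"
  by (simp add: face_at_def nxt.orbit_eq)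

lemma face_nxt [simp]: "d \<in> sides M \<Longrightarrow> face_at M (nxt M d) = face_at M d"
  by (simp add: face_at_def)

lemma nxt_face_iff: "d \<in> sides M \<Longrightarrow> e \<in> sides M \<Longrightarrow> nxt M e \<in> face_at M d \<longleftrightarrow> e \<in> face_at M d"
  by (simp add: face_at_def nxt.orbit_step_iff)

lemma finite_face: "d \<in> sides M \<Longrightarrow> finite (face_at M d)"
  using face_sub finite_sides finite_subset by blast

lemma root_sub: "root_face M \<subseteq> sides M"
  by (simp add: root_face_def face_sub rt_in)

lemma rt_root: "rt M \<in> root_face M"
  by (simp add: root_face_def face_self rt_in)

lemma nxt_root_iff: "d \<in> sides M \<Longrightarrow> nxt M d \<in> root_face M \<longleftrightarrow> d \<in> root_face M"
  by (simp add: root_face_def nxt_face_iff rt_in)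

lemma face_disjoint:
  "d \<in> sides M \<Longrightarrow> e \<in> sides M \<Longrightarrow> face_at M d \<noteq> face_at M e \<Longrightarrow> face_at M d \<inter> face_at M e = {}"
  using face_eq by blast

text \<open>Euler's formula is stated with \<open>div\<close>; evenness allows it to be doubled
  without loss. The edges partition the sides into pairs.\<close>

lemma even_card_sides: "even (card (sides M))"
proof -
  define \<E> where "\<E> = (\<lambda>d. {d, opp M d}) ` sides M"
  have edge: "A = {z, opp M z}" if "z \<in> A" "A \<in> \<E>" for z A
    using that opp_opp by (auto simp: \<E>_def)
  have "card A = 2" if "A \<in> \<E>" for A
    using that unfolding \<E>_def using opp_neq by (elim imageE) (metis card_2_iff)
  moreover have "card (\<Union>\<E>) = sum card \<E>"
  proof (rule card_Union_disjoint)
    show "pairwise disjnt \<E>"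
      unfolding pairwise_def disjnt_iff using edge by metis
  qed (auto simp: \<E>_def)
  moreover have "\<Union>\<E> = sides M"
    using opp_in by (auto simp: \<E>_def)
  ultimately have "card (sides M) = card \<E> * 2"
    by (metis (no_types, lifting) sum.cong sum_constant of_nat_id)
  then show ?thesis by simp
qed

end

text \<open>The clauses of \<open>quad_with_holes\<close> beyond planarity. As in
  \<open>spherical\<close>, nothing is required off the sides, so that the notion passes along
  isomorphisms.\<close>

locale holed = spherical +
  assumes marks_sub: "marks M \<subseteq> sides M - root_face M"
    and marks_inj: "inj_on (face_at M) (marks M)"
    and inner_deg: "d \<in> inner_sides M \<Longrightarrow> card (face_at M d) = 4"
    and hole_opp: "d \<in> hole_sides M \<Longrightarrow> opp M d \<notin> hole_sides M"
    and joined_unholed: "joined M (sides M - hole_sides M)"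
    and hole_rt: "m \<in> marks M \<Longrightarrow> opp M ` face_at M m = root_face M \<Longrightarrow> opp M m = rt M"

context holed
begin

lemma marks_in: "m \<in> marks M \<Longrightarrow> m \<in> sides M"
  using marks_sub by blast

lemma hole_sides_sub: "hole_sides M \<subseteq> sides M"
  using marks_in face_sub by (auto simp: hole_sides_def)

end

lemma planar_map_iff:
  "planar_map M \<longleftrightarrow> spherical M \<and> (\<forall>d. d \<notin> sides M \<longrightarrow> opp M d = d \<and> nxt M d = d)"
proof
  assume *: "planar_map M"
  then show "spherical M \<and> (\<forall>d. d \<notin> sides M \<longrightarrow> opp M d = d \<and> nxt M d = d)"
    by (auto simp: planar_map_def spherical_def permutes_imp_bij permutes_in_image permutes_not_in)
next
  assume *: "spherical M \<and> (\<forall>d. d \<notin> sides M \<longrightarrow> opp M d = d \<and> nxt M d = d)"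
  then interpret spherical M by blast
  have "opp M permutes sides M" "nxt M permutes sides M"
    using * by (auto intro!: bij_imp_permutes opp_bij nxt_bij)
  then show "planar_map M"
    unfolding planar_map_def using finite_sides rt_in joined_sides euler by auto
qed

lemma quad_with_holes_iff: "quad_with_holes M \<longleftrightarrow> planar_map M \<and> holed M"
  unfolding quad_with_holes_def planar_map_iff holed_def holed_axioms_def by blast

subsection \<open>Isomorphisms\<close>

lemma map_iso_comp:
  assumes "spherical M" "map_iso f M N" "map_iso g N L"
  shows "map_iso (g \<circ> f) M L"
proof -
  interpret spherical M by fact
  show ?thesis
    using assms(2,3) unfolding map_iso_def
    by (simp add: bij_betw_apply[of f "sides M" "sides N"] bij_betw_trans[of f _ "sides N"] flip: image_image)
qed

text \<open>Sphericity is assumed of the source and derived for the target, since the target may be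
  a relabelled copy about which nothing else is known.\<close>

locale map_isomorphism = spherical M for M :: "'d pmap" +
  fixes f :: "'d \<Rightarrow> 'e" and N :: "'e pmap"
  assumes iso: "map_iso f M N"
begin

lemma f_bij: "bij_betw f (sides M) (sides N)"
  and f_rt: "f (rt M) = rt N"
  and f_marks: "f ` marks M = marks N"
  and f_opp: "d \<in> sides M \<Longrightarrow> f (opp M d) = opp N (f d)"
  and f_nxt: "d \<in> sides M \<Longrightarrow> f (nxt M d) = nxt N (f d)"
  using iso unfolding map_iso_def by blast+

lemma f_image: "f ` sides M = sides N"
  using f_bij by (simp add: bij_betw_def)

lemma f_inj: "inj_on f (sides M)"
  using f_bij by (simp add: bij_betw_def)

lemma f_in: "d \<in> sides M \<Longrightarrow> f d \<in> sides N"
  using f_image by blast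

lemma f_face: "d \<in> sides M \<Longrightarrow> face_at N (f d) = f ` face_at M d"
  unfolding face_at_def
  by (rule orbit_inverse[symmetric]) (auto simp: nxt.orbit_self f_nxt dest: nxt.orbit_closed)

lemma f_vertex:
  assumes "d \<in> sides M"
  shows "orbit (nxt N \<circ> opp N) (f d) = f ` orbit (nxt M \<circ> opp M) d"
proof (rule orbit_inverse[symmetric])
  show "d \<in> orbit (nxt M \<circ> opp M) d"
    using assms by (rule vtx.orbit_self)
  show "(nxt N \<circ> opp N) (f x) = f ((nxt M \<circ> opp M) x)" if "x \<in> orbit (nxt M \<circ> opp M) d" for x
    using vtx.orbit_closed[OF assms that] by (simp add: f_nxt f_opp)
qed

lemma inj_image: "inj_on ((`) f) (Pow (sides M))"
  using f_inj by (rule inj_on_image_Pow)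

lemma f_root: "root_face N = f ` root_face M"
  by (simp add: root_face_def rt_in f_face flip: f_rt)

lemma f_perimeter: "perimeter N = perimeter M"
  unfolding perimeter_def f_root using f_inj root_sub
  by (meson card_image inj_on_subset)

lemma f_joined:
  assumes "joined M S" "S \<subseteq> sides M"
  shows "joined N (f ` S)"
  unfolding joined_def
proof
  fix e assume "e \<in> f ` S"
  then obtain d where d: "d \<in> S" "e = f d" by blast
  let ?R = "\<lambda>M S. {(x, y). x \<in> S \<and> y \<in> S \<and> (y = nxt M x \<or> y = opp M x)}"
  have "(rt M, d) \<in> (?R M S)\<^sup>*"
    using assms(1) d(1) unfolding joined_def by blast
  then have "(f (rt M), f d) \<in> (?R N (f ` S))\<^sup>*"
  proof induction
    case (step y z)
    then have "(f y, f z) \<in> ?R N (f ` S)"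
      using assms(2) f_nxt f_opp by auto
    then show ?case using step.IH by (rule rtrancl_into_rtrancl[rotated])
  qed simp
  then show "(rt N, e) \<in> (?R N (f ` S))\<^sup>*"
    by (simp add: d f_rt)
qed

lemma spherical_image: "spherical N"
proof
  show "finite (sides N)" using finite_sides by (simp flip: f_image)
  show "rt N \<in> sides N" using f_in[OF rt_in] by (simp add: f_rt)
  have "inj_on (nxt N) (f ` sides M)"
    by (rule inj_onI) (auto simp: inj_on_eq_iff[OF f_inj] nxt.inj_S simp flip: f_nxt)
  moreover have "nxt N ` f ` sides M = f ` sides M"
  proof -
    have "nxt N ` f ` sides M = f ` nxt M ` sides M"
      unfolding image_image by (intro image_cong) (auto simp: f_nxt)
    then show ?thesis using nxt_bij by (simp add: bij_betw_def)
  qed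
  ultimately show "bij_betw (nxt N) (sides N) (sides N)"
    by (simp add: bij_betw_def f_image)
  show "opp N e \<in> sides N \<and> opp N e \<noteq> e \<and> opp N (opp N e) = e" if "e \<in> sides N" for e
    using that by (auto simp: inj_on_eq_iff[OF f_inj] simp flip: f_opp f_image)
  show "joined N (sides N)"
    using f_joined[OF joined_sides] by (simp add: f_image)
  have "orbit (nxt N \<circ> opp N) ` sides N = (`) f ` orbit (nxt M \<circ> opp M) ` sides M"
    unfolding f_image[symmetric] image_image by (intro image_cong) (auto simp: f_vertex)
  then have "card (orbit (nxt N \<circ> opp N) ` sides N) = card (orbit (nxt M \<circ> opp M) ` sides M)"
    using vtx.orbit_sub by (simp add: card_image inj_on_subset[OF inj_image] image_subset_iff)
  moreover have "face_at N ` sides N = (`) f ` face_at M ` sides M"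
    unfolding f_image[symmetric] image_image by (intro image_cong) (auto simp: f_face)
  then have "card (face_at N ` sides N) = card (face_at M ` sides M)"
    using face_sub by (simp add: card_image inj_on_subset[OF inj_image] image_subset_iff)
  ultimately show "card (orbit (nxt N \<circ> opp N) ` sides N) + card (face_at N ` sides N) = card (sides N) div 2 + 2"
    using euler bij_betw_same_card[OF f_bij] by simp
qed

lemma inverse_iso:
  assumes "marks M \<subseteq> sides M"
  shows "map_iso (inv_into (sides M) f) N M"
  unfolding map_iso_def
proof (intro conjI ballI)
  let ?g = "inv_into (sides M) f"
  have g: "?g (f x) = x" if "x \<in> sides M" for x
    using that f_inj by simp
  show "bij_betw ?g (sides N) (sides M)"
    using f_bij by (rule bij_betw_inv_into)
  show "?g (rt N) = rt M"
    using g[OF rt_in] by (simp add: f_rt)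
  show "?g ` marks N = marks M"
    using assms g unfolding f_marks[symmetric] by force
  show "?g (opp N d) = opp M (?g d)" "?g (nxt N d) = nxt M (?g d)" if "d \<in> sides N" for d
    using that by (auto simp: g simp flip: f_image f_opp f_nxt)
qed

end

locale holed_isomorphism = map_isomorphism + holed M
begin

lemma f_hole_sides: "hole_sides N = f ` hole_sides M"
proof -
  have "face_at N (f m) = f ` face_at M m" if "m \<in> marks M" for m
    using that marks_sub by (intro f_face) auto
  then show ?thesis by (simp add: hole_sides_def image_UN flip: f_marks)
qed

lemma f_diff: "A \<subseteq> sides M \<Longrightarrow> B \<subseteq> sides M \<Longrightarrow> f ` (A - B) = f ` A - f ` B"
  by (rule inj_on_image_set_diff[OF f_inj]) auto

lemma f_inner_sides: "inner_sides N = f ` inner_sides M"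
  unfolding inner_sides_def f_hole_sides f_root f_image[symmetric]
  using root_sub hole_sides_sub by (simp add: f_diff Diff_subset subset_trans)

lemma f_mem: "A \<subseteq> sides M \<Longrightarrow> d \<in> sides M \<Longrightarrow> f d \<in> f ` A \<longleftrightarrow> d \<in> A"
  using f_inj by (auto simp: inj_on_def)

lemma card_f: "A \<subseteq> sides M \<Longrightarrow> card (f ` A) = card A"
  using f_inj by (meson card_image inj_on_subset)

lemma holed_image: "holed N"
proof -
  interpret N: spherical N by (rule spherical_image)
  show ?thesis
  proof
    show "marks N \<subseteq> sides N - root_face N"
      using marks_sub root_sub unfolding f_marks[symmetric] f_root f_image[symmetric]
      by (simp flip: f_diff) blast
    show "inj_on (face_at N) (marks N)"
    proof (rule inj_onI)
      fix x y assume "x \<in> marks N" "y \<in> marks N" "face_at N x = face_at N y"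
      then obtain m n where m: "x = f m" "y = f n" "m \<in> marks M" "n \<in> marks M"
        "f ` face_at M m = f ` face_at M n"
        using marks_sub f_face by (auto simp: f_marks[symmetric] subset_iff)
      then have "face_at M m = face_at M n"
        using m(3,4) marks_sub face_sub by (intro inj_onD[OF inj_image]) auto
      then show "x = y" using m marks_inj by (auto simp: inj_on_def)
    qed
    show "card (face_at N d) = 4" if d: "d \<in> inner_sides N" for d
    proof -
      obtain e where e: "d = f e" "e \<in> inner_sides M" using d unfolding f_inner_sides by blast
      then have "e \<in> sides M" by (simp add: inner_sides_def)
      then show ?thesis using e inner_deg f_face face_sub by (simp add: card_f)
    qed
    show "opp N d \<notin> hole_sides N" if d: "d \<in> hole_sides N" for d
    proof -
      obtain e where e: "d = f e" "e \<in> hole_sides M" using d unfolding f_hole_sides by blast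
      then have "e \<in> sides M" using hole_sides_sub by blast
      then show ?thesis
        using e hole_opp f_mem[OF hole_sides_sub, of "opp M e"] by (simp add: f_hole_sides flip: f_opp)
    qed
    show "joined N (sides N - hole_sides N)"
      using f_joined[OF joined_unholed] hole_sides_sub
      unfolding f_hole_sides f_image[symmetric] by (simp add: f_diff Diff_subset)
    show "opp N d = rt N" if d: "d \<in> marks N" "opp N ` face_at N d = root_face N" for d
    proof -
      obtain m where m: "d = f m" "m \<in> marks M" using d(1) f_marks by auto
      then have ms: "m \<in> sides M" using marks_sub by auto
      have "opp N ` f ` face_at M m = f ` opp M ` face_at M m"
        unfolding image_image using face_sub[OF ms] by (intro image_cong) (auto simp: f_opp)
      then have "f ` opp M ` face_at M m = f ` root_face M"
        using d(2) m ms by (simp add: f_face f_root)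
      then have "opp M ` face_at M m = root_face M"
        using face_sub[OF ms] root_sub by (intro inj_onD[OF inj_image]) auto
      then show ?thesis using hole_rt[OF m(2)] m(1) ms f_rt by (simp flip: f_opp)
    qed
  qed
qed

end

subsection \<open>Representatives\<close>

text \<open>The \<open>SOME\<close> in \<open>rep\<close> is meaningful only if a candidate exists.
  Extending the transported functions by the identity turns them into the permutations that
  \<open>planar_map\<close> demands.\<close>

lemma exists_planar_copy:
  assumes "spherical M"
  shows "\<exists>N :: nat pmap. planar_map N \<and> (\<exists>f. map_iso f M N)"
proof -
  interpret spherical M by fact
  obtain f :: "'a \<Rightarrow> nat" where f: "inj_on f (sides M)"
    using finite_imp_inj_to_nat_seg[OF finite_sides] by blast
  let ?g = "inv_into (sides M) f"
  define N where "N = \<lparr>sides = f ` sides M,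
     opp = (\<lambda>x. if x \<in> f ` sides M then f (opp M (?g x)) else x),
     nxt = (\<lambda>x. if x \<in> f ` sides M then f (nxt M (?g x)) else x),
     rt = f (rt M), marks = f ` marks M\<rparr>"
  have iso: "map_iso f M N"
    using f by (auto simp: map_iso_def N_def bij_betw_def)
  interpret map_isomorphism M f N
    by unfold_locales (rule iso)
  have "planar_map N"
    unfolding planar_map_iff using spherical_image by (auto simp: N_def)
  then show ?thesis using iso by blast
qed

lemma rep_planar: "spherical M \<Longrightarrow> planar_map (rep M)"
  and rep_iso: "spherical M \<Longrightarrow> \<exists>f. map_iso f M (rep M)"
  unfolding rep_def using someI_ex[OF exists_planar_copy] by blast+

text \<open>Both maps are isomorphic to the same maps, so \<open>rep\<close> chooses from the same
  candidates. This yields equality of representatives, not just isomorphism.\<close>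

lemma rep_cong:
  assumes "spherical M" "marks M \<subseteq> sides M" "map_iso f M N"
  shows "rep M = rep N"
proof -
  interpret map_isomorphism M f N
    by (intro map_isomorphism.intro map_isomorphism_axioms.intro assms)
  have "(\<exists>g. map_iso g M L) \<longleftrightarrow> (\<exists>g. map_iso g N L)" for L :: "nat pmap"
    using map_iso_comp[OF assms(1,3)] map_iso_comp[OF spherical_image inverse_iso[OF assms(2)]]
    by blast
  then show ?thesis by (simp add: rep_def)
qed

lemma rep_in_QH:
  assumes "holed M"
  shows "rep M \<in> QH"
proof -
  interpret holed M by fact
  obtain f where f: "map_iso f M (rep M)" using rep_iso spherical_axioms by blast
  interpret holed_isomorphism M f "rep M"
    by unfold_locales (rule f)
  have "rep M = rep (rep M)"
    using marks_sub f by (intro rep_cong[OF spherical_axioms]) auto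
  then show ?thesis
    using holed_image rep_planar[OF spherical_axioms] by (auto simp: QH_def quad_with_holes_iff)
qed

section \<open>Cycles as powers\<close>

context finite_bij
begin

lemma orbit_powers:
  assumes "x \<in> S"
  shows "orbit f x = (\<lambda>n. (f ^^ n) x) ` {..<card (orbit f x)}"
    and "inj_on (\<lambda>n. (f ^^ n) x) {..<card (orbit f x)}"
    and "(f ^^ card (orbit f x)) x = x"
    and "card (orbit f x) = funpow_dist1 f x x"
proof -
  have self: "x \<in> orbit f x" using assms by (rule orbit_self)
  have eq: "orbit f x = (\<lambda>n. (f ^^ n) x) ` {0..<funpow_dist1 f x x}"
    using self by (rule orbit_conv_funpow_dist1)
  have inj: "inj_on (\<lambda>n. (f ^^ n) x) {0..<funpow_dist1 f x x}"
    using self by (rule inj_on_funpow_dist1)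
  show card: "card (orbit f x) = funpow_dist1 f x x"
    using card_image[OF inj] by (simp flip: eq)
  show "orbit f x = (\<lambda>n. (f ^^ n) x) ` {..<card (orbit f x)}"
    unfolding card using eq by (simp add: lessThan_atLeast0)
  show "inj_on (\<lambda>n. (f ^^ n) x) {..<card (orbit f x)}"
    unfolding card using inj by (simp add: lessThan_atLeast0)
  show "(f ^^ card (orbit f x)) x = x"
    unfolding card using self by (rule funpow_dist1_prop)
qed

text \<open>Powers below the cycle length are distinct, so \<open>funpow_dist\<close> recovers the
  exponent. Both \<open>phantom_index\<close> and \<open>hole_index\<close> are such
  distances.\<close>

lemma funpow_dist_power:
  assumes "x \<in> S" "i < card (orbit f x)"
  shows "funpow_dist f x ((f ^^ i) x) = i"
proof -
  let ?j = "funpow_dist f x ((f ^^ i) x)"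
  have "?j \<le> i"
    unfolding funpow_dist_def by (rule Least_le) simp
  moreover have "(f ^^ ?j) x = (f ^^ i) x"
    unfolding funpow_dist_def by (rule LeastI[of _ i]) simp
  ultimately show ?thesis
    using inj_onD[OF orbit_powers(2)[OF assms(1)], of ?j i] assms(2) by simp
qed

lemma funpow_dist_orbit:
  assumes "x \<in> S" "y \<in> orbit f x"
  shows "(f ^^ funpow_dist f x y) x = y" "funpow_dist f x y < card (orbit f x)"
proof -
  show "(f ^^ funpow_dist f x y) x = y"
    using assms(2) by (rule funpow_dist_prop)
  obtain i where "y = (f ^^ i) x" "i < card (orbit f x)"
    using assms(2) orbit_powers(1)[OF assms(1)] by blast
  then show "funpow_dist f x y < card (orbit f x)"
    using funpow_dist_power[OF assms(1)] by simp
qed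

end

section \<open>Disjoint unions of bijections\<close>

text \<open>Serves for two bijections: the contour map of \<open>raw_glue\<close>, and the rotation
  around vertices on the disjoint union of \<open>q\<close> and its fillings before gluing.\<close>

definition sum_fun :: "('a \<Rightarrow> 'a) \<Rightarrow> ('m \<Rightarrow> 'b \<Rightarrow> 'b) \<Rightarrow> 'a + 'm \<times> 'b \<Rightarrow> 'a + 'm \<times> 'b" where
  "sum_fun f g = (\<lambda>x. case x of Inl a \<Rightarrow> Inl (f a) | Inr (m, b) \<Rightarrow> Inr (m, g m b))"

lemma sum_fun_simps [simp]: "sum_fun f g (Inl a) = Inl (f a)" "sum_fun f g (Inr (m, b)) = Inr (m, g m b)"
  by (auto simp: sum_fun_def)

locale sum_bij =
  fixes f :: "'a \<Rightarrow> 'a" and A :: "'a set" and g :: "'m \<Rightarrow> 'b \<Rightarrow> 'b" and I :: "'m set" and B :: "'m \<Rightarrow> 'b set"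
  assumes base: "finite_bij f A" and finite_I: "finite I" and fibre: "m \<in> I \<Longrightarrow> finite_bij (g m) (B m)"
begin

lemma sum_bij: "finite_bij (sum_fun f g) (Inl ` A \<union> Inr ` Sigma I B)"
proof
  interpret base: finite_bij f A by (rule base)
  have fin: "finite (B m)" if "m \<in> I" for m
    using fibre[OF that] by (simp add: finite_bij_def)
  then show "finite (Inl ` A \<union> Inr ` Sigma I B)"
    using base.finite_S finite_I by auto
  have gB: "g m ` B m = B m" "inj_on (g m) (B m)" if "m \<in> I" for m
    using fibre[OF that] by (auto simp: finite_bij_def bij_betw_def)
  have "inj_on (sum_fun f g) (Inl ` A \<union> Inr ` Sigma I B)"
    by (rule inj_onI) (auto simp: base.inj_S dest: inj_onD[OF gB(2)])
  moreover have "sum_fun f g ` (Inl ` A \<union> Inr ` Sigma I B) = Inl ` f ` A \<union> Inr ` (SIGMA m:I. g m ` B m)"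
    by (force simp: image_Un image_image image_iff)
  then have "sum_fun f g ` (Inl ` A \<union> Inr ` Sigma I B) = Inl ` A \<union> Inr ` Sigma I B"
    using base.bij gB by (simp add: bij_betw_def cong: Sigma_cong)
  ultimately show "bij_betw (sum_fun f g) (Inl ` A \<union> Inr ` Sigma I B) (Inl ` A \<union> Inr ` Sigma I B)"
    by (simp add: bij_betw_def)
qed

lemma orbit_Inl: "a \<in> A \<Longrightarrow> orbit (sum_fun f g) (Inl a) = Inl ` orbit f a"
  by (rule orbit_inverse[symmetric]) (auto intro: finite_bij.orbit_self[OF base])

lemma orbit_Inr: "m \<in> I \<Longrightarrow> b \<in> B m \<Longrightarrow> orbit (sum_fun f g) (Inr (m, b)) = (\<lambda>b. Inr (m, b)) ` orbit (g m) b"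
  by (rule orbit_inverse[symmetric]) (auto intro: finite_bij.orbit_self[OF fibre])

lemma card_orbits_sum:
  "card (orbit (sum_fun f g) ` (Inl ` A \<union> Inr ` Sigma I B))
     = card (orbit f ` A) + (\<Sum>m\<in>I. card (orbit (g m) ` B m))"
proof -
  let ?L = "(`) Inl ` orbit f ` A :: ('a + 'm \<times> 'b) set set"
  let ?R = "\<lambda>m. (`) (\<lambda>b. Inr (m, b)) ` orbit (g m) ` B m :: ('a + 'm \<times> 'b) set set"
  have inj_image': "inj_on ((`) h) X" if "inj h" for h :: "'x \<Rightarrow> 'a + 'm \<times> 'b" and X
    using inj_on_image_Pow[OF that] by (rule inj_on_subset) simp
  have "orbit (sum_fun f g) ` (Inl ` A \<union> Inr ` Sigma I B) = ?L \<union> (\<Union>m\<in>I. ?R m)"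
    by (force simp: image_Un image_image orbit_Inl orbit_Inr image_iff)
  moreover have "finite ?L"
    using base by (simp add: finite_bij_def)
  moreover have finR: "finite (?R m)" if "m \<in> I" for m
    using fibre[OF that] by (simp add: finite_bij_def)
  moreover have "?L \<inter> (\<Union>m\<in>I. ?R m) = {}"
    using orbit_nonempty by fastforce
  ultimately have "card (orbit (sum_fun f g) ` (Inl ` A \<union> Inr ` Sigma I B)) = card ?L + card (\<Union>m\<in>I. ?R m)"
    using finite_I by (simp add: card_Un_disjoint)
  moreover have "?R m \<inter> ?R n = {}" if "m \<noteq> n" for m n
    using that orbit_nonempty by fastforce
  then have "card (\<Union>m\<in>I. ?R m) = (\<Sum>m\<in>I. card (?R m))"
    using finR finite_I by (intro card_UN_disjoint) auto
  moreover have "card (?R m) = card (orbit (g m) ` B m)" for m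
    by (intro card_image inj_image') (auto simp: inj_on_def)
  moreover have "card ?L = card (orbit f ` A)"
    by (intro card_image inj_image') simp
  ultimately show ?thesis by simp
qed

end

text \<open>Sending a finer class to the union of the coarser classes of its members maps the
  classes of \<open>s\<close> onto those of \<open>r\<close>.\<close>

lemma ncls_antimono:
  assumes "s \<subseteq> eqcl r" "finite S"
  shows "ncls r S \<le> ncls s S"
proof -
  have "cls r x = \<Union>(cls r ` cls s x)" for x
  proof (rule set_eqI)
    fix z
    have "(x, y) \<in> eqcl r" if "(x, y) \<in> eqcl s" for y
      using that eqcl_least[OF assms(1)] by (rule rev_subsetD)
    then show "z \<in> cls r x \<longleftrightarrow> z \<in> \<Union>(cls r ` cls s x)"
      by (metis UN_iff cls_iff eqcl_refl eqcl_trans)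
  qed
  then have "cls r ` S = (\<lambda>C. \<Union>(cls r ` C)) ` cls s ` S"
    unfolding image_image by (rule image_cong[OF refl])
  moreover have "card ((\<lambda>C. \<Union>(cls r ` C)) ` cls s ` S) \<le> card (cls s ` S)"
    using assms(2) by (intro card_image_le finite_imageI)
  ultimately show ?thesis
    by (simp only: ncls_def)
qed

section \<open>Gluing\<close>

context holed
begin

lemma finite_marks: "finite (marks M)"
  using marks_sub finite_sides finite_subset by blast

lemma face_hole_sub: "m \<in> marks M \<Longrightarrow> face_at M m \<subseteq> hole_sides M"
  by (auto simp: hole_sides_def)

lemma root_not_hole: "root_face M \<inter> hole_sides M = {}"
proof -
  have "face_at M (rt M) \<inter> face_at M m = {}" if "m \<in> marks M" for m
    using that marks_sub face_disjoint[OF rt_in, of m] face_self[of m] by (auto simp: root_face_def)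
  then show ?thesis by (auto simp: hole_sides_def root_face_def)
qed

lemma rt_not_hole: "rt M \<notin> hole_sides M"
  using root_not_hole rt_root by blast

lemma nxt_hole_iff: "d \<in> sides M \<Longrightarrow> nxt M d \<in> hole_sides M \<longleftrightarrow> d \<in> hole_sides M"
  using marks_in by (auto simp: hole_sides_def nxt_face_iff)

lemma mark_unique: "m \<in> marks M \<Longrightarrow> n \<in> marks M \<Longrightarrow> s \<in> face_at M m \<Longrightarrow> s \<in> face_at M n \<Longrightarrow> m = n"
  using face_eq[of m s] face_eq[of n s] marks_in marks_inj by (auto simp: inj_on_def)

lemma hole_of_eq: "m \<in> marks M \<Longrightarrow> s \<in> face_at M m \<Longrightarrow> hole_of M s = m"
  unfolding hole_of_def using mark_unique by (intro the_equality) auto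

lemma card_hole_sides: "card (hole_sides M) = (\<Sum>m\<in>marks M. hole_deg M m)"
  unfolding hole_sides_def hole_deg_def
  using finite_marks finite_face marks_in mark_unique by (intro card_UN_disjoint) auto

lemma face_at_hole_sides: "face_at M ` hole_sides M = face_at M ` marks M"
proof -
  have "face_at M ` face_at M m = {face_at M m}" if "m \<in> marks M" for m
  proof -
    have "face_at M ` face_at M m = (\<lambda>_. face_at M m) ` face_at M m"
      by (rule image_cong[OF refl face_eq[OF marks_in[OF that]]])
    then show ?thesis
      using image_constant[OF face_self[OF marks_in[OF that]]] by simp
  qed
  then show ?thesis by (simp add: hole_sides_def image_UN UNION_singleton_eq_range)
qed

end


lemma planar_map_permutes: "planar_map M \<Longrightarrow> nxt M permutes sides M"
  by (simp add: planar_map_def)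

text \<open>The permutation property is asked of \<open>nxt q\<close> because
  \<open>hole_edge\<close> uses the global inverse \<open>inv (nxt q)\<close>.\<close>

locale gluing = holed q for q :: "'d pmap" +
  fixes u :: "'d \<Rightarrow> 'd pmap"
  assumes nxt_permutes: "nxt q permutes sides q"
    and filled: "m \<in> marks q \<Longrightarrow> holed (u m)"
    and perimeter_filled: "m \<in> marks q \<Longrightarrow> perimeter (u m) = hole_deg q m"
begin

text \<open>The root side of \<open>u m\<close> that is glued to the edge of the side \<open>s\<close> of the hole \<open>m\<close>.\<close>

definition root_of :: "'d \<Rightarrow> 'd \<Rightarrow> 'd" where
  "root_of m s = (nxt (u m) ^^ hole_index q s) (rt (u m))"

text \<open>Inverse of \<open>root_of m\<close>, between the root face of \<open>u m\<close> and the
  contour of the hole \<open>m\<close>.\<close>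

definition side_of :: "'d \<Rightarrow> 'd \<Rightarrow> 'd" where
  "side_of m r = (inv (nxt q) ^^ phantom_index (u m) r) m"

abbreviation "outer \<equiv> sides q - hole_sides q"
abbreviation "core m \<equiv> sides (u m) - root_face (u m)"

lemma funpow_inv: "(nxt q ^^ i) ((inv (nxt q) ^^ i) m) = m" "(inv (nxt q) ^^ i) ((nxt q ^^ i) m) = m"
proof -
  have bij: "bij (nxt q)"
    using nxt_permutes by (rule permutes_bij)
  have bij_pow: "bij (nxt q ^^ i)"
    using bij by (rule bij_fn)
  show "(nxt q ^^ i) ((inv (nxt q) ^^ i) m) = m" "(inv (nxt q) ^^ i) ((nxt q ^^ i) m) = m"
    unfolding inv_fn[OF bij, symmetric]
    using bij_pow by (simp_all add: bij_is_surj surj_f_inv_f bij_is_inj)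
qed

lemma inv_power_in_face:
  assumes "m \<in> sides q"
  shows "(inv (nxt q) ^^ i) m \<in> face_at q m"
proof -
  have "permutation (nxt q)"
    using nxt_permutes finite_sides by (auto simp: permutation_permutes)
  then have "(inv (nxt q) ^^ i) m \<in> orbit (inv (nxt q)) m"
    by (intro funpow_in_orbit permutation_self_in_orbit permutation_inverse)
  then show ?thesis
    by (simp add: face_at_def orbit_inv_eq[OF \<open>permutation (nxt q)\<close>])
qed

context
  fixes m
  assumes m: "m \<in> marks q"
begin

interpretation um: holed "u m" by (rule filled[OF m])

lemma m_in: "m \<in> sides q"
  using m marks_in by blast

lemma hole_deg_eq: "hole_deg q m = card (root_face (u m))"
  using perimeter_filled[OF m] by (simp add: perimeter_def)

lemma mark_in_orbit: "s \<in> face_at q m \<Longrightarrow> m \<in> orbit (nxt q) s"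
  using face_eq[OF m_in, of s] face_self[OF m_in] unfolding face_at_def by simp

lemma hole_index_facts:
  assumes "s \<in> face_at q m"
  shows "hole_index q s = funpow_dist (nxt q) s m"
    and "(nxt q ^^ hole_index q s) s = m"
    and "hole_index q s < hole_deg q m"
proof -
  have s: "s \<in> sides q" using assms face_sub m_in by blast
  show eq: "hole_index q s = funpow_dist (nxt q) s m"
    using hole_of_eq[OF m assms] by (simp add: hole_index_def)
  show "(nxt q ^^ hole_index q s) s = m"
    unfolding eq using nxt.funpow_dist_orbit(1)[OF s mark_in_orbit[OF assms]] .
  show "hole_index q s < hole_deg q m"
    unfolding eq hole_deg_def
    using nxt.funpow_dist_orbit(2)[OF s mark_in_orbit[OF assms]] face_eq[OF m_in assms]
    by (simp add: face_at_def)
qed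

lemma phantom_index_facts:
  assumes "r \<in> root_face (u m)"
  shows "(nxt (u m) ^^ phantom_index (u m) r) (rt (u m)) = r"
    and "phantom_index (u m) r < hole_deg q m"
  using assms um.nxt.funpow_dist_orbit[OF um.rt_in, of r]
  by (auto simp: phantom_index_def root_face_def face_at_def hole_deg_eq)

lemma hole_index_inv_power:
  assumes "i < hole_deg q m"
  shows "hole_index q ((inv (nxt q) ^^ i) m) = i"
proof -
  let ?s = "(inv (nxt q) ^^ i) m"
  have s: "?s \<in> face_at q m" by (rule inv_power_in_face[OF m_in])
  then have "i < card (orbit (nxt q) ?s)"
    using assms face_eq[OF m_in s] by (simp add: hole_deg_def face_at_def)
  moreover have "?s \<in> sides q" using s face_sub m_in by blast
  ultimately have "funpow_dist (nxt q) ?s ((nxt q ^^ i) ?s) = i"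
    by (intro nxt.funpow_dist_power)
  then show ?thesis
    by (simp add: hole_index_facts(1)[OF s] funpow_inv)
qed

lemma phantom_index_power:
  assumes "i < hole_deg q m"
  shows "phantom_index (u m) ((nxt (u m) ^^ i) (rt (u m))) = i"
  using um.nxt.funpow_dist_power[OF um.rt_in, of i] assms
  by (simp add: phantom_index_def hole_deg_eq root_face_def face_at_def)

lemma root_power_in: "(nxt (u m) ^^ i) (rt (u m)) \<in> root_face (u m)"
  unfolding root_face_def face_at_def using um.rt_in
  by (intro funpow_in_orbit um.nxt.orbit_self)

lemma root_of_in: "root_of m s \<in> root_face (u m)"
  unfolding root_of_def by (rule root_power_in)

lemma side_of_in: "side_of m r \<in> face_at q m"
  unfolding side_of_def by (rule inv_power_in_face[OF m_in])

lemma side_of_root_of: "s \<in> face_at q m \<Longrightarrow> side_of m (root_of m s) = s"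
  unfolding side_of_def root_of_def
  using hole_index_facts(2,3)[of s] funpow_inv(2)[of "hole_index q s" s] by (simp add: phantom_index_power)

lemma root_of_side_of: "r \<in> root_face (u m) \<Longrightarrow> root_of m (side_of m r) = r"
  unfolding side_of_def root_of_def
  using phantom_index_facts[of r] by (simp add: hole_index_inv_power)

text \<open>The hole and the root face of its filling traverse the common boundary in opposite
  directions: a step along the hole is a step back along the root face.\<close>

lemma nxt_root_of:
  assumes s: "s \<in> face_at q m"
  shows "nxt (u m) (root_of m (nxt q s)) = root_of m s"
proof -
  have sq: "s \<in> sides q" using s face_sub m_in by blast
  then have ns: "nxt q s \<in> face_at q m" using s by (simp add: nxt_face_iff m_in)
  show ?thesis
  proof (cases "s = m")
    case False
    then have "hole_index q s = Suc (hole_index q (nxt q s))"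
      using funpow_dist_step[OF _ mark_in_orbit[OF s]]
      by (simp add: hole_index_facts(1)[OF s] hole_index_facts(1)[OF ns])
    then show ?thesis by (simp add: root_of_def)
  next
    \<comment> \<open>The wrap-around: the mark has index 0, its successor has index one less than
      the degree, and one more step closes the root contour.\<close>
    case True
    then have "hole_index q s = 0"
      using hole_index_facts(1)[OF s] by (simp add: funpow_dist_0)
    moreover have "Suc (hole_index q (nxt q s)) = hole_deg q m"
      using nxt.orbit_powers(4)[OF m_in] hole_index_facts(1)[OF ns] True
      by (simp add: hole_deg_def face_at_def)
    then have "nxt (u m) (root_of m (nxt q s)) = (nxt (u m) ^^ hole_deg q m) (rt (u m))"
      unfolding root_of_def by (metis comp_apply funpow.simps(2))
    then have "nxt (u m) (root_of m (nxt q s)) = rt (u m)"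
      using um.nxt.orbit_powers(3)[OF um.rt_in] by (simp add: hole_deg_eq root_face_def face_at_def)
    ultimately show ?thesis by (simp add: root_of_def)
  qed
qed

lemma root_of_mark: "root_of m m = rt (u m)"
  using hole_index_facts(1)[OF face_self[OF m_in]] by (simp add: root_of_def funpow_dist_0)

lemma glue_side_root: "r \<in> root_face (u m) \<Longrightarrow> glue_side q u m r = Inl (opp q (side_of m r))"
  by (simp add: glue_side_def hole_edge_def side_of_def)

lemma glue_side_core: "r \<notin> root_face (u m) \<Longrightarrow> glue_side q u m r = Inr (m, r)"
  by (simp add: glue_side_def)

lemma opp_raw_hole:
  assumes "opp q d \<in> face_at q m"
  shows "opp (raw_glue q u) (Inl d) = glue_side q u m (opp (u m) (root_of m (opp q d)))"
proof -
  have "opp q d \<in> hole_sides q" using assms m face_hole_sub by blast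
  then show ?thesis
    using hole_of_eq[OF m assms] by (simp add: raw_glue_def root_of_def Let_def)
qed

lemma opp_side_of: "opp q (side_of m r) \<in> outer" "opp q (opp q (side_of m r)) = side_of m r"
  using side_of_in[of r] face_hole_sub[OF m] hole_opp hole_sides_sub by (auto simp: subset_iff)

end

lemma raw_simps:
  "rt (raw_glue q u) = Inl (rt q)"
  "sides (raw_glue q u) = Inl ` outer \<union> Inr ` Sigma (marks q) core"
  "marks (raw_glue q u) = Inr ` (SIGMA m : marks q. marks (u m))"
  "nxt (raw_glue q u) (Inl d) = Inl (nxt q d)"
  "nxt (raw_glue q u) (Inr (m, d)) = Inr (m, nxt (u m) d)"
  "opp (raw_glue q u) (Inr (m, d)) = glue_side q u m (opp (u m) d)"
  "opp q d \<notin> hole_sides q \<Longrightarrow> opp (raw_glue q u) (Inl d) = Inl (opp q d)"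
  by (auto simp: raw_glue_def)

lemma nxt_raw: "nxt (raw_glue q u) = sum_fun (nxt q) (\<lambda>m. nxt (u m))"
  by (auto simp: raw_glue_def sum_fun_def fun_eq_iff)

lemma outer_bij: "finite_bij (nxt q) outer"
proof
  show "finite outer" using finite_sides by simp
  then show "bij_betw (nxt q) outer outer"
    using nxt.inj_S nxt_hole_iff by (intro bij_betw_imageI endo_inj_surj inj_onI) auto
qed

lemma core_bij: "m \<in> marks q \<Longrightarrow> finite_bij (nxt (u m)) (core m)"
proof
  assume m: "m \<in> marks q"
  interpret um: holed "u m" by (rule filled[OF m])
  show fin: "finite (core m)" using um.finite_sides by simp
  have "inj_on (nxt (u m)) (core m)"
    by (rule inj_onI) (simp add: um.nxt.inj_S)
  moreover have "nxt (u m) ` core m \<subseteq> core m"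
    by (auto simp: um.nxt_root_iff)
  ultimately show "bij_betw (nxt (u m)) (core m) (core m)"
    using fin by (intro bij_betw_imageI endo_inj_surj) auto
qed

sublocale faces: sum_bij "nxt q" outer "\<lambda>m. nxt (u m)" "marks q" core
  by (intro sum_bij.intro outer_bij finite_marks core_bij)

lemma glue_side_in:
  assumes "m \<in> marks q" "x \<in> sides (u m)"
  shows "glue_side q u m x \<in> sides (raw_glue q u)"
proof (cases "x \<in> root_face (u m)")
  case True
  then show ?thesis
    using opp_side_of[OF assms(1)] by (simp add: glue_side_root[OF assms(1)] raw_simps)
next
  case False
  then show ?thesis
    using assms by (simp add: glue_side_core[OF assms(1)] raw_simps)
qed

text \<open>Makes \<open>glue_side q u m\<close> respect \<open>opp\<close> on all of
  \<open>u m\<close>, including edges with both sides on the root face, which glue two sides of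
  \<open>q\<close> to each other. It does not respect \<open>nxt\<close> along the root
  face.\<close>

lemma opp_glue_side:
  assumes m: "m \<in> marks q" and x: "x \<in> sides (u m)"
  shows "opp (raw_glue q u) (glue_side q u m x) = glue_side q u m (opp (u m) x)"
proof (cases "x \<in> root_face (u m)")
  case True
  let ?d = "opp q (side_of m x)"
  have d: "opp q ?d = side_of m x" "opp q ?d \<in> face_at q m"
    using opp_side_of[OF m] side_of_in[OF m] by auto
  show ?thesis
    using opp_raw_hole[OF m d(2)] True by (simp add: glue_side_root m d root_of_side_of)
next
  case False
  then show ?thesis by (simp add: glue_side_core[OF m] raw_simps)
qed

lemma glue_side_inj:
  assumes m: "m \<in> marks q" and x: "x \<in> sides (u m)" and y: "y \<in> sides (u m)"
    and eq: "glue_side q u m x = glue_side q u m y"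
  shows "x = y"
proof -
  consider "x \<in> root_face (u m)" "y \<in> root_face (u m)" | "x \<notin> root_face (u m)" "y \<notin> root_face (u m)"
    using eq by (auto simp: glue_side_def split: if_splits)
  then show ?thesis
  proof cases
    case 1
    then have "opp q (side_of m x) = opp q (side_of m y)"
      using eq by (simp add: glue_side_root m)
    then have "side_of m x = side_of m y"
      using opp_side_of(2)[OF m] by metis
    then show ?thesis
      using root_of_side_of[OF m] 1 by metis
  next
    case 2
    then show ?thesis using eq by (simp add: glue_side_core[OF m])
  qed
qed

text \<open>The split is by edges, not by the origin of a side: a side of \<open>q\<close> along a
  hole is treated as a root side of the filling, so \<open>opp\<close> never leaves a case.\<close>

lemma raw_side_cases:
  assumes "x \<in> sides (raw_glue q u)"
  obtains (Outer) d where "x = Inl d" "d \<in> outer" "opp q d \<in> outer"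
    | (Filled) m e where "m \<in> marks q" "e \<in> sides (u m)" "x = glue_side q u m e"
proof -
  consider d where "x = Inl d" "d \<in> outer" | m e where "m \<in> marks q" "e \<in> core m" "x = Inr (m, e)"
    using assms by (auto simp: raw_simps)
  then show ?thesis
  proof cases
    case (1 d)
    show ?thesis
    proof (cases "opp q d \<in> hole_sides q")
      case True
      then obtain m where m: "m \<in> marks q" "opp q d \<in> face_at q m"
        by (auto simp: hole_sides_def)
      interpret um: holed "u m" by (rule filled[OF m(1)])
      have "x = glue_side q u m (root_of m (opp q d))"
        using 1 m by (simp add: glue_side_root root_of_in side_of_root_of)
      then show ?thesis
        using that(2)[OF m(1)] root_of_in[OF m(1)] um.root_sub by blast
    qed (use 1 that(1) in auto)
  next
    case (2 m e)
    then show ?thesis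
      using that(2)[of m e] by (simp add: glue_side_core[OF 2(1)])
  qed
qed

lemma opp_raw_inv:
  assumes "x \<in> sides (raw_glue q u)"
  shows "opp (raw_glue q u) x \<in> sides (raw_glue q u) \<and> opp (raw_glue q u) x \<noteq> x
    \<and> opp (raw_glue q u) (opp (raw_glue q u) x) = x"
  using assms
proof (cases rule: raw_side_cases)
  case (Outer d)
  then show ?thesis by (auto simp: raw_simps)
next
  case (Filled m e)
  interpret um: holed "u m" by (rule filled[OF Filled(1)])
  show ?thesis
    using Filled um.opp_neq[of e, THEN not_sym] glue_side_inj[of m e "opp (u m) e"] by (auto simp: opp_glue_side glue_side_in)
qed

end

section \<open>Connectivity and genus bound of the glued map\<close>

context gluing
begin

abbreviation "raw \<equiv> raw_glue q u"
abbreviation "steps \<equiv> {(x, y). x \<in> sides raw \<and> y \<in> sides raw \<and> (y = nxt raw x \<or> y = opp raw x)}"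

text \<open>A path of \<open>q\<close> that avoids the holes is untouched by gluing; such paths
  exist because \<open>q\<close> is connected without its holes.\<close>

lemma reach_outer:
  assumes "d \<in> outer"
  shows "(rt raw, Inl d) \<in> steps\<^sup>*"
proof -
  have "(rt q, d) \<in> {(x, y). x \<in> outer \<and> y \<in> outer \<and> (y = nxt q x \<or> y = opp q x)}\<^sup>*"
    using joined_unholed assms by (simp add: joined_def)
  then show ?thesis
  proof induction
    case base
    show ?case by (simp add: raw_simps)
  next
    case (step y z)
    then have "(Inl y, Inl z) \<in> steps"
      by (auto simp: raw_simps)
    with step.IH show ?case by (rule rtrancl_into_rtrancl)
  qed
qed

lemma reach_filled:
  assumes m: "m \<in> marks q" and x: "x \<in> sides (u m)"
  shows "(rt raw, glue_side q u m x) \<in> steps\<^sup>*"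
proof -
  interpret um: holed "u m" by (rule filled[OF m])
  \<comment> \<open>Root sides are reached through \<open>q\<close>. This replaces the steps along
    the root face of \<open>u m\<close>, which \<open>nxt raw\<close> does not follow.\<close>
  have root: "(rt raw, glue_side q u m r) \<in> steps\<^sup>*" if "r \<in> root_face (u m)" for r
    using that reach_outer opp_side_of(1)[OF m] by (simp add: glue_side_root m)
  have "(rt (u m), x) \<in> {(x, y). x \<in> sides (u m) \<and> y \<in> sides (u m) \<and> (y = nxt (u m) x \<or> y = opp (u m) x)}\<^sup>*"
    using um.joined_sides x by (simp add: joined_def)
  then show ?thesis
  proof induction
    case base
    show ?case using root um.rt_root by blast
  next
    case (step y z)
    then have yz: "y \<in> sides (u m)" "z \<in> sides (u m)" "z = nxt (u m) y \<or> z = opp (u m) y"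
      by auto
    show ?case
    proof (cases "z \<in> root_face (u m)")
      case False
      have "(glue_side q u m y, glue_side q u m z) \<in> steps"
      proof (cases "z = opp (u m) y")
        case True
        then show ?thesis
          using yz m by (simp add: glue_side_in opp_glue_side)
      next
        case neq: False
        then have z: "z = nxt (u m) y" using yz by blast
        then have "y \<notin> root_face (u m)" using False yz um.nxt_root_iff by blast
        then have "nxt raw (glue_side q u m y) = glue_side q u m z"
          using False z m by (simp add: glue_side_core raw_simps)
        then show ?thesis
          using yz m by (simp add: glue_side_in)
      qed
      with step.IH show ?thesis by (rule rtrancl_into_rtrancl)
    qed (rule root)
  qed
qed

lemma raw_joined: "joined raw (sides raw)"
  unfolding joined_def
proof
  fix x assume "x \<in> sides raw"
  then show "(rt raw, x) \<in> steps\<^sup>*"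
    by (cases rule: raw_side_cases) (auto intro: reach_outer reach_filled)
qed

lemma raw_finite_bij: "finite_bij (nxt raw) (sides raw)"
  using faces.sum_bij by (simp add: nxt_raw raw_simps)

lemma raw_connected:
  assumes "x \<in> sides raw" "y \<in> sides raw"
  shows "(x, y) \<in> eqcl (arcs (nxt raw) (sides raw) \<union> arcs (opp raw) (sides raw))"
proof -
  let ?E = "eqcl (arcs (nxt raw) (sides raw) \<union> arcs (opp raw) (sides raw))"
  have "steps \<subseteq> ?E"
    by (auto simp: arcs_def intro: eqcl_base)
  then have "steps\<^sup>* \<subseteq> ?E"
    unfolding eqcl_def by (rule rtrancl_subset_rtrancl)
  moreover have "(rt raw, x) \<in> steps\<^sup>*" "(rt raw, y) \<in> steps\<^sup>*"
    using raw_joined assms unfolding joined_def by blast+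
  ultimately have "(rt raw, x) \<in> ?E" "(rt raw, y) \<in> ?E"
    by blast+
  then show ?thesis
    using eqcl_sym eqcl_trans by fast
qed

lemma raw_genus:
  "2 * card (orbit (nxt raw \<circ> opp raw) ` sides raw) + 2 * card (orbit (nxt raw) ` sides raw) \<le> card (sides raw) + 4"
  using opp_raw_inv raw_connected by (intro genus_nonneg raw_finite_bij) auto

subsection \<open>Vertices of the glued map\<close>

text \<open>Identify the vertices of \<open>q\<close> and of all \<open>u m\<close> that meet at a corner of a hole. The vertices of the
  glued map refine the resulting classes and every class contains one, so the glued map has at least
  as many vertices as there are classes.\<close>

abbreviation "all_sides \<equiv> Inl ` sides q \<union> Inr ` Sigma (marks q) (\<lambda>m. sides (u m))"
abbreviation "turn \<equiv> sum_fun (nxt q \<circ> opp q) (\<lambda>m. nxt (u m) \<circ> opp (u m))"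

text \<open>A vertex orbit consists of the sides that start at the vertex. The root side
  \<open>root_of m s\<close> is glued to \<open>opp q s\<close>, hence ends where \<open>s\<close>
  starts, and its successor is the side of \<open>u m\<close> starting there.\<close>

definition corners :: "(('d + 'd \<times> 'd) \<times> ('d + 'd \<times> 'd)) set" where
  "corners = (\<Union>m\<in>marks q. (\<lambda>s. (Inl s, Inr (m, nxt (u m) (root_of m s)))) ` face_at q m)"

abbreviation "corner_eq \<equiv> eqcl (corners \<union> arcs turn all_sides)"

sublocale vertices: sum_bij "nxt q \<circ> opp q" "sides q" "\<lambda>m. nxt (u m) \<circ> opp (u m)" "marks q" "\<lambda>m. sides (u m)"
proof (intro sum_bij.intro finite_marks)
  show "finite_bij (nxt q \<circ> opp q) (sides q)"
    by (rule vtx.finite_bij_axioms)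
  fix m assume "m \<in> marks q"
  then interpret um: holed "u m" by (rule filled)
  show "finite_bij (nxt (u m) \<circ> opp (u m)) (sides (u m))"
    by (rule um.vtx.finite_bij_axioms)
qed

lemma all_sides_bij: "finite_bij turn all_sides"
  by (rule vertices.sum_bij)

lemma corners_sub: "corners \<subseteq> all_sides \<times> all_sides"
proof -
  have "(Inl s, Inr (m, nxt (u m) (root_of m s))) \<in> all_sides \<times> all_sides"
    if m: "m \<in> marks q" and s: "s \<in> face_at q m" for m s
  proof -
    interpret um: holed "u m" by (rule filled[OF m])
    have "root_of m s \<in> sides (u m)" using root_of_in[OF m] um.root_sub by blast
    moreover have "s \<in> sides q" using s m marks_in face_sub by blast
    ultimately show ?thesis using m by auto
  qed
  then show ?thesis by (auto simp: corners_def)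
qed

lemma finite_corners: "finite corners"
  unfolding corners_def using finite_marks finite_face marks_in by blast

lemma card_corners: "card corners \<le> card (hole_sides q)"
proof -
  have "corners = (\<lambda>s. (Inl s, Inr (hole_of q s, nxt (u (hole_of q s)) (root_of (hole_of q s) s)))) ` hole_sides q"
    unfolding corners_def hole_sides_def image_UN by (intro SUP_cong refl image_cong) (simp_all add: hole_of_eq)
  then show ?thesis
    using finite_subset[OF hole_sides_sub finite_sides] by (simp add: card_image_le)
qed

lemma turn_Inl: "d \<in> sides q \<Longrightarrow> (Inl d, Inl (nxt q (opp q d))) \<in> corner_eq"
  by (rule eqcl_base) (force simp: arcs_def)

lemma turn_Inr: "m \<in> marks q \<Longrightarrow> x \<in> sides (u m) \<Longrightarrow> (Inr (m, x), Inr (m, nxt (u m) (opp (u m) x))) \<in> corner_eq"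
  by (rule eqcl_base) (force simp: arcs_def)

lemma corner_step:
  "m \<in> marks q \<Longrightarrow> s \<in> face_at q m \<Longrightarrow> (Inl s, Inr (m, nxt (u m) (root_of m s))) \<in> corner_eq"
  by (rule eqcl_base) (auto simp: corners_def)

text \<open>Modulo corners, the end point of \<open>x\<close> is the same vertex in
  \<open>u m\<close> and in the glued map. For a root side, cross the corner at
  \<open>side_of m x\<close>; one turn in \<open>q\<close> then leads to the successor of its
  image.\<close>

lemma corner_glue_side:
  assumes m: "m \<in> marks q" and x: "x \<in> sides (u m)"
  shows "(Inr (m, nxt (u m) x), nxt raw (glue_side q u m x)) \<in> corner_eq"
proof (cases "x \<in> root_face (u m)")
  case True
  let ?s = "side_of m x"
  have s: "?s \<in> face_at q m" by (rule side_of_in[OF m])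
  have "?s \<in> sides q" using s face_sub m marks_in by blast
  then have 1: "(Inl ?s, nxt raw (glue_side q u m x)) \<in> corner_eq"
    using turn_Inl[of ?s] True by (simp add: glue_side_root m raw_simps)
  have 2: "(Inl ?s, Inr (m, nxt (u m) x)) \<in> corner_eq"
    using corner_step[OF m s] True by (simp add: root_of_side_of m)
  show ?thesis
    by (rule eqcl_trans[OF eqcl_sym[OF 2] 1])
next
  case False
  then show ?thesis by (simp add: glue_side_core m raw_simps)
qed

lemma corner_turn:
  assumes x: "x \<in> sides raw"
  shows "(x, nxt raw (opp raw x)) \<in> corner_eq"
proof -
  consider d where "x = Inl d" "d \<in> outer" "opp q d \<in> hole_sides q"
    | d where "x = Inl d" "d \<in> outer" "opp q d \<notin> hole_sides q"
    | m e where "m \<in> marks q" "e \<in> core m" "x = Inr (m, e)"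
    using x unfolding raw_simps by blast
  then show ?thesis
  proof cases
    case (1 d)
    let ?s = "opp q d"
    obtain m where m: "m \<in> marks q" "?s \<in> face_at q m"
      using 1 by (auto simp: hole_sides_def)
    interpret um: holed "u m" by (rule filled[OF m(1)])
    have root: "root_of m ?s \<in> sides (u m)"
      using root_of_in[OF m(1)] um.root_sub by blast
    have d: "d \<in> sides q" "?s \<in> sides q" using 1 by auto
    have ns: "nxt q ?s \<in> face_at q m"
      using m d marks_in by (simp add: nxt_face_iff)
    \<comment> \<open>A turn at a vertex on the boundary of a hole: turn in \<open>q\<close> to the
      hole, cross the corner into the filling, turn there across the root side, and come back by
      \<open>corner_glue_side\<close>.\<close>
    have 1: "(Inl d, Inl (nxt q ?s)) \<in> corner_eq"
      by (rule turn_Inl[OF d(1)])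
    have 2: "(Inl (nxt q ?s), Inr (m, root_of m ?s)) \<in> corner_eq"
      using corner_step[OF m(1) ns] nxt_root_of[OF m] by simp
    have 3: "(Inr (m, root_of m ?s), Inr (m, nxt (u m) (opp (u m) (root_of m ?s)))) \<in> corner_eq"
      by (rule turn_Inr[OF m(1) root])
    have 4: "(Inr (m, nxt (u m) (opp (u m) (root_of m ?s))), nxt raw (glue_side q u m (opp (u m) (root_of m ?s)))) \<in> corner_eq"
      using root by (intro corner_glue_side m) simp
    have "(Inl d, nxt raw (opp raw (Inl d))) \<in> corner_eq"
      unfolding opp_raw_hole[OF m] by (rule eqcl_trans[OF eqcl_trans[OF eqcl_trans[OF 1 2] 3] 4])
    then show ?thesis by (simp only: \<open>x = Inl d\<close>)
  next
    case (2 d)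
    then show ?thesis using turn_Inl[of d] by (simp add: raw_simps)
  next
    case (3 m e)
    interpret um: holed "u m" by (rule filled[OF 3(1)])
    have a: "(Inr (m, e), Inr (m, nxt (u m) (opp (u m) e))) \<in> corner_eq"
      using 3 by (intro turn_Inr) auto
    have b: "(Inr (m, nxt (u m) (opp (u m) e)), nxt raw (glue_side q u m (opp (u m) e))) \<in> corner_eq"
      using 3 by (intro corner_glue_side) auto
    show ?thesis
      using eqcl_trans[OF a b] 3 by (simp add: raw_simps)
  qed
qed

text \<open>Gluing removes only hole sides and root sides of fillings. One turn leads from a hole
  side out of the hole, since no two hole sides are opposite; a root side is tied to a hole side by
  a corner.\<close>

lemma all_sides_related:
  assumes "x \<in> all_sides"
  obtains y where "y \<in> sides raw" "(x, y) \<in> corner_eq"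
proof -
  have hole: "\<exists>y\<in>sides raw. (Inl s, y) \<in> corner_eq" if s: "s \<in> hole_sides q" for s
  proof -
    have sq: "s \<in> sides q" using s hole_sides_sub by blast
    then have "nxt q (opp q s) \<in> outer"
      using hole_opp[OF s] by (simp add: nxt_hole_iff)
    then show ?thesis
      using turn_Inl[OF sq] by (auto simp: raw_simps)
  qed
  have root: "\<exists>y\<in>sides raw. (Inr (m, r), y) \<in> corner_eq" if m: "m \<in> marks q" and r: "r \<in> root_face (u m)" for m r
  proof -
    let ?s = "side_of m r"
    have s: "?s \<in> face_at q m" "?s \<in> sides q"
      using side_of_in[OF m, of r] face_sub[OF marks_in[OF m]] by auto
    then have ns: "nxt q ?s \<in> face_at q m"
      using m marks_in by (simp add: nxt_face_iff)
    have 1: "(Inl (nxt q ?s), Inr (m, r)) \<in> corner_eq"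
      using corner_step[OF m ns] nxt_root_of[OF m s(1)] root_of_side_of[OF m r] by simp
    obtain y where y: "y \<in> sides raw" "(Inl (nxt q ?s), y) \<in> corner_eq"
      using hole[of "nxt q ?s"] ns face_hole_sub[OF m] by blast
    show ?thesis
      using eqcl_trans[OF eqcl_sym[OF 1] y(2)] y(1) by blast
  qed
  have "\<exists>y\<in>sides raw. (x, y) \<in> corner_eq"
  proof -
    have raw: ?thesis if "x \<in> sides raw"
      using that by (intro bexI[of _ x]) auto
    consider s where "x = Inl s" "s \<in> sides q"
      | m r where "x = Inr (m, r)" "m \<in> marks q" "r \<in> sides (u m)"
      using assms by blast
    then show ?thesis
    proof cases
      case (1 s)
      then show ?thesis
        using hole[of s] raw by (cases "s \<in> hole_sides q") (simp_all add: raw_simps)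
    next
      case (2 m r)
      then show ?thesis
        using root[of m r] raw by (cases "r \<in> root_face (u m)") (simp_all add: raw_simps image_iff)
    qed
  qed
  then show ?thesis using that by blast
qed

lemma raw_vertices:
  "card (orbit (nxt q \<circ> opp q) ` sides q) + (\<Sum>m\<in>marks q. card (orbit (nxt (u m) \<circ> opp (u m)) ` sides (u m)))
     \<le> card (orbit (nxt raw \<circ> opp raw) ` sides raw) + card (hole_sides q)"
proof -
  interpret all: finite_bij turn all_sides by (rule all_sides_bij)
  interpret fb: finite_bij "nxt raw" "sides raw" by (rule raw_finite_bij)
  have "bij_betw (opp raw) (sides raw) (sides raw)"
    using opp_raw_inv by (intro bij_betwI[of _ _ _ "opp raw"]) auto
  then interpret raw_vtx: finite_bij "nxt raw \<circ> opp raw" "sides raw"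
    by (intro finite_bij.intro fb.finite_S bij_betw_trans[OF _ fb.bij])
  let ?r = "corners \<union> arcs turn all_sides"
  have 1: "card (orbit turn ` all_sides) \<le> ncls ?r all_sides + card corners"
    unfolding all.card_orbits using corners_sub finite_corners all.finite_S by (intro ncls_union_ge)
  have "cls ?r ` all_sides \<subseteq> cls ?r ` sides raw"
  proof
    fix C assume "C \<in> cls ?r ` all_sides"
    then obtain x where x: "x \<in> all_sides" "C = cls ?r x" by blast
    obtain y where "y \<in> sides raw" "(x, y) \<in> corner_eq"
      using all_sides_related[OF x(1)] .
    then show "C \<in> cls ?r ` sides raw"
      using x(2) cls_eq_iff[of ?r x y] by (intro image_eqI[of _ _ y]) simp_all
  qed
  then have 2: "ncls ?r all_sides \<le> ncls ?r (sides raw)"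
    unfolding ncls_def by (rule card_mono[OF finite_imageI[OF fb.finite_S]])
  have 3: "ncls ?r (sides raw) \<le> card (orbit (nxt raw \<circ> opp raw) ` sides raw)"
    unfolding raw_vtx.card_orbits
  proof (rule ncls_antimono[OF _ fb.finite_S])
    show "arcs (nxt raw \<circ> opp raw) (sides raw) \<subseteq> corner_eq"
      using corner_turn by (auto simp: arcs_def)
  qed
  have "card (orbit turn ` all_sides) \<le> card (orbit (nxt raw \<circ> opp raw) ` sides raw) + card (hole_sides q)"
    using 1 2 3 card_corners by linarith
  then show ?thesis
    by (simp only: vertices.card_orbits_sum)
qed

section \<open>Counting faces and sides; Euler's formula for the glued map\<close>

lemma outer_faces: "card (orbit (nxt q) ` outer) + card (marks q) = card (face_at q ` sides q)"
proof -
  have "face_at q ` outer \<inter> face_at q ` hole_sides q = {}"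
  proof (rule ccontr)
    assume "\<not> ?thesis"
    then obtain d s where d: "d \<in> outer" "s \<in> hole_sides q" "face_at q d = face_at q s"
      by fastforce
    then obtain m where m: "m \<in> marks q" "s \<in> face_at q m"
      by (auto simp: hole_sides_def)
    then have "d \<in> face_at q m"
      using d face_self[of d] face_eq[OF marks_in[OF m(1)] m(2)] by auto
    then show False using d face_hole_sub[OF m(1)] by blast
  qed
  moreover have "face_at q ` sides q = face_at q ` outer \<union> face_at q ` hole_sides q"
    using hole_sides_sub by blast
  moreover have "card (face_at q ` hole_sides q) = card (marks q)"
    unfolding face_at_hole_sides using marks_inj by (rule card_image)
  ultimately have "card (face_at q ` sides q) = card (face_at q ` outer) + card (marks q)"
    using finite_sides finite_subset[OF hole_sides_sub] by (simp add: card_Un_disjoint)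
  then show ?thesis by (simp add: face_at_def[abs_def])
qed

lemma core_faces:
  assumes "m \<in> marks q"
  shows "Suc (card (orbit (nxt (u m)) ` core m)) = card (face_at (u m) ` sides (u m))"
proof -
  interpret um: holed "u m" by (rule filled[OF assms])
  have "face_at (u m) ` sides (u m) = insert (root_face (u m)) (face_at (u m) ` core m)"
  proof -
    have "face_at (u m) d = root_face (u m)" if "d \<in> root_face (u m)" for d
      using that um.face_eq[OF um.rt_in] by (simp add: root_face_def)
    moreover have "root_face (u m) \<in> face_at (u m) ` sides (u m)"
      using um.rt_in by (auto simp: root_face_def)
    ultimately show ?thesis by fast
  qed
  moreover have "root_face (u m) \<notin> face_at (u m) ` core m"
    using um.face_self by blast
  ultimately show ?thesis
    using um.finite_sides by (simp add: face_at_def[abs_def])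
qed

text \<open>Each hole side accounts for two lost sides, itself and the root side glued to its
  edge.\<close>

lemma card_raw:
  "card (sides raw) + 2 * card (hole_sides q) = card (sides q) + (\<Sum>m\<in>marks q. card (sides (u m)))"
proof -
  have core: "card (core m) + hole_deg q m = card (sides (u m))" if m: "m \<in> marks q" for m
  proof -
    interpret um: holed "u m" by (rule filled[OF m])
    show ?thesis
      unfolding hole_deg_eq[OF m] using um.root_sub um.finite_sides
      by (simp add: card_Diff_subset finite_subset card_mono)
  qed
  have fin: "finite (core m)" if "m \<in> marks q" for m
    using core_bij[OF that] by (simp add: finite_bij_def)
  have "card (sides raw) = card outer + (\<Sum>m\<in>marks q. card (core m))"
    unfolding raw_simps using finite_sides finite_marks fin
    by (subst card_Un_disjoint) (auto simp: card_image)
  moreover have "card outer + card (hole_sides q) = card (sides q)"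
    using hole_sides_sub finite_sides by (simp add: card_Diff_subset finite_subset card_mono)
  moreover have "(\<Sum>m\<in>marks q. card (core m)) + card (hole_sides q) = (\<Sum>m\<in>marks q. card (sides (u m)))"
    unfolding card_hole_sides sum.distrib[symmetric] using core by (intro sum.cong) auto
  ultimately show ?thesis by linarith
qed

text \<open>Each hole accounts for two lost faces, itself and the root face of its filling.\<close>

lemma raw_faces:
  "card (orbit (nxt raw) ` sides raw) + 2 * card (marks q)
     = card (face_at q ` sides q) + (\<Sum>m\<in>marks q. card (face_at (u m) ` sides (u m)))"
proof -
  have "(\<Sum>m\<in>marks q. card (orbit (nxt (u m)) ` core m)) + card (marks q)
     = (\<Sum>m\<in>marks q. card (face_at (u m) ` sides (u m)))"
    unfolding sum_Suc[symmetric] by (intro sum.cong refl core_faces)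
  moreover have "card (orbit (nxt raw) ` sides raw)
     = card (orbit (nxt q) ` outer) + (\<Sum>m\<in>marks q. card (orbit (nxt (u m)) ` core m))"
    unfolding nxt_raw raw_simps by (rule faces.card_orbits_sum)
  ultimately show ?thesis using outer_faces by linarith
qed

lemma raw_spherical: "spherical raw"
proof
  interpret fb: finite_bij "nxt raw" "sides raw" by (rule raw_finite_bij)
  show "finite (sides raw)" "bij_betw (nxt raw) (sides raw) (sides raw)"
    by (rule fb.finite_S fb.bij)+
  show "rt raw \<in> sides raw"
    using rt_in rt_not_hole by (simp add: raw_simps)
  show "opp raw x \<in> sides raw \<and> opp raw x \<noteq> x \<and> opp raw (opp raw x) = x" if "x \<in> sides raw" for x
    using that by (rule opp_raw_inv)
  show "joined raw (sides raw)"
    by (rule raw_joined)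
  let ?V = "\<lambda>M. card (orbit (nxt M \<circ> opp M) ` sides M)"
  let ?F = "\<lambda>M. card (face_at M ` sides M)"
  have double: "2 * ?V M + 2 * ?F M = card (sides M) + 4" if "spherical M" for M :: "'d pmap"
    using spherical.euler[OF that] spherical.even_card_sides[OF that] by presburger
  have "2 * ?V (u m) + 2 * ?F (u m) = card (sides (u m)) + 4" if "m \<in> marks q" for m
    using filled[OF that] by (intro double) (simp add: holed_def)
  then have "(\<Sum>m\<in>marks q. 2 * ?V (u m) + 2 * ?F (u m)) = (\<Sum>m\<in>marks q. card (sides (u m)) + 4)"
    by (intro sum.cong) auto
  then have "2 * (\<Sum>m\<in>marks q. ?V (u m)) + 2 * (\<Sum>m\<in>marks q. ?F (u m)) = (\<Sum>m\<in>marks q. card (sides (u m))) + 4 * card (marks q)"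
    by (simp add: sum.distrib sum_distrib_left)
  \<comment> \<open>With \<open>h\<close> holes and \<open>k\<close> hole sides, the doubled
    formulas of \<open>q\<close> and the fillings add up to the constant \<open>4 + 4 * h\<close>.
    The \<open>2 * h\<close> lost faces cancel \<open>4 * h\<close>, and the at most
    \<open>k\<close> lost vertices are balanced by the \<open>2 * k\<close> lost sides. What remains
    is the reverse of \<open>raw_genus\<close>.\<close>
  then have "2 * ?V raw + 2 * ?F raw = card (sides raw) + 4"
    using double[OF spherical_axioms] raw_vertices raw_faces card_raw raw_genus
    by (simp add: face_at_def[abs_def])
  then show "?V raw + ?F raw = card (sides raw) div 2 + 2"
    by presburger
qed

end

section \<open>Faces of the glued map\<close>

context holed
begin

lemma inner_sub: "inner_sides M \<subseteq> sides M"
  by (auto simp: inner_sides_def)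

lemma inner_face_sub:
  assumes "d \<in> inner_sides M"
  shows "face_at M d \<subseteq> inner_sides M"
proof
  fix e assume e: "e \<in> face_at M d"
  have d: "d \<in> sides M" using assms inner_sub by blast
  then have es: "e \<in> sides M" and eq: "face_at M e = face_at M d"
    using e face_sub face_eq by blast+
  have "d \<in> face_at M e" using eq face_self[OF d] by simp
  then have "e \<notin> root_face M" "e \<notin> hole_sides M"
    using assms face_eq[OF rt_in, of e] face_eq[of _ e] marks_in
    by (auto simp: inner_sides_def root_face_def hole_sides_def)
  then show "e \<in> inner_sides M"
    using es by (simp add: inner_sides_def)
qed

end

lemma face_id_in:
  fixes M :: "nat pmap"
  assumes "spherical M" "d \<in> sides M"
  shows "face_id M d \<in> face_at M d"
  unfolding face_id_def
  using spherical.finite_face[OF assms] spherical.face_self[OF assms] by (intro Min_in) auto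

context gluing
begin

lemma face_raw_Inl: "d \<in> outer \<Longrightarrow> face_at raw (Inl d) = Inl ` face_at q d"
  unfolding face_at_def nxt_raw by (rule faces.orbit_Inl)

lemma face_raw_Inr: "m \<in> marks q \<Longrightarrow> d \<in> core m \<Longrightarrow> face_at raw (Inr (m, d)) = (\<lambda>b. Inr (m, b)) ` face_at (u m) d"
  unfolding face_at_def nxt_raw by (rule faces.orbit_Inr)

lemma root_face_raw: "root_face raw = Inl ` root_face q"
  unfolding root_face_def using face_raw_Inl[of "rt q"] rt_in rt_not_hole by (simp add: raw_simps)

lemma perimeter_raw: "perimeter raw = perimeter q"
  by (simp add: perimeter_def root_face_raw card_image)

lemma hole_sides_raw: "hole_sides raw = Inr ` Sigma (marks q) (\<lambda>m. hole_sides (u m))"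
proof -
  have "face_at raw (Inr (m, n)) = (\<lambda>b. Inr (m, b)) ` face_at (u m) n" if "m \<in> marks q" "n \<in> marks (u m)" for m n
  proof -
    interpret um: holed "u m" by (rule filled[OF that(1)])
    show ?thesis using that um.marks_sub by (intro face_raw_Inr) auto
  qed
  then show ?thesis
    by (fastforce simp: hole_sides_def raw_simps)
qed

lemma inner_sides_raw:
  "inner_sides raw = Inl ` inner_sides q \<union> Inr ` Sigma (marks q) (\<lambda>m. inner_sides (u m))"
  unfolding inner_sides_def hole_sides_raw root_face_raw raw_simps by auto

lemma marks_raw_sub: "marks raw \<subseteq> sides raw"
  unfolding raw_simps using filled[THEN holed.marks_sub] by blast

end

lemma gluingI:
  assumes "q \<in> QH" "u \<in> fillings (Some q)"
  shows "gluing q u"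
proof -
  interpret holed q using assms(1) by (simp add: QH_def quad_with_holes_iff)
  show ?thesis
  proof (intro gluing.intro gluing_axioms.intro holed_axioms)
    show "nxt q permutes sides q"
      using assms(1) by (intro planar_map_permutes) (simp add: QH_def quad_with_holes_iff)
    show "holed (u m)" "perimeter (u m) = hole_deg q m" if "m \<in> marks q" for m
      using assms(2) that by (auto simp: QH_def quad_with_holes_iff Pi_iff)
  qed
qed

locale filled_map = gluing q u for q :: "nat pmap" and u +
  fixes p
  assumes glued: "p = glue_map q u" and glued_in: "p \<in> QH"
begin

abbreviation "emb \<equiv> glue_iso q u"

lemma emb_iso: "map_iso emb raw p"
  unfolding glue_iso_def glued glue_map_def
  using rep_iso[OF raw_spherical] by (rule someI_ex)

sublocale emb: map_isomorphism raw emb p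
  by (intro map_isomorphism.intro map_isomorphism_axioms.intro raw_spherical emb_iso)

sublocale p: holed p
  using glued_in by (simp add: QH_def quad_with_holes_iff)

text \<open>The conditions on holes are not checked on the raw map but pulled back from
  \<open>p\<close>, which lies in \<open>QH\<close> by assumption.\<close>

lemma raw_holed: "holed raw"
proof -
  interpret inverse: holed_isomorphism p "inv_into (sides raw) emb" raw
    by unfold_locales (rule emb.inverse_iso[OF marks_raw_sub])
  show ?thesis by (rule inverse.holed_image)
qed

sublocale emb: holed_isomorphism raw emb p
  by (intro holed_isomorphism.intro emb.map_isomorphism_axioms raw_holed)

lemma perimeter_p: "perimeter p = perimeter q"
  by (simp add: emb.f_perimeter perimeter_raw)

lemma emb_face_eq_iff:
  assumes "x \<in> sides raw" "y \<in> sides raw"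
  shows "face_id p (emb x) = face_id p (emb y) \<longleftrightarrow> face_at raw x = face_at raw y"
proof -
  have in_p: "emb x \<in> sides p" "emb y \<in> sides p"
    using assms emb.f_in by blast+
  have "face_id p (emb x) = face_id p (emb y) \<longleftrightarrow> face_at p (emb x) = face_at p (emb y)"
  proof
    assume *: "face_id p (emb x) = face_id p (emb y)"
    have "face_id p (emb x) \<in> face_at p (emb x)" "face_id p (emb x) \<in> face_at p (emb y)"
      using face_id_in[OF p.spherical_axioms in_p(1)] face_id_in[OF p.spherical_axioms in_p(2)]
      by (simp_all add: *)
    then show "face_at p (emb x) = face_at p (emb y)"
      using p.face_eq in_p by metis
  qed (simp add: face_id_def)
  also have "\<dots> \<longleftrightarrow> emb ` face_at raw x = emb ` face_at raw y"
    using assms by (simp add: emb.f_face)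
  also have "\<dots> \<longleftrightarrow> face_at raw x = face_at raw y"
    using emb.face_sub assms by (intro inj_on_eq_iff[OF emb.inj_image]) auto
  finally show ?thesis .
qed

text \<open>A face name is itself a side of the face. This is why \<open>base_face\<close> and
  \<open>hole_face\<close> may apply the isomorphism to names.\<close>

lemma inner_face_fixed:
  fixes M :: "nat pmap"
  assumes "holed M" "f \<in> inner_faces M"
  shows "f \<in> inner_sides M" "face_id M f = f"
proof -
  interpret M: holed M by fact
  obtain d where d: "d \<in> inner_sides M" "f = face_id M d"
    using assms(2) by (auto simp: inner_faces_def)
  then have ds: "d \<in> sides M" using M.inner_sub by blast
  have f: "f \<in> face_at M d" using d(2) face_id_in[OF M.spherical_axioms ds] by simp
  then show "f \<in> inner_sides M" using M.inner_face_sub[OF d(1)] by blast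
  show "face_id M f = f" using M.face_eq[OF ds f] d(2) by (simp add: face_id_def)
qed

abbreviation "base_id f \<equiv> face_id p (emb (Inl f))"
abbreviation "hole_id m f \<equiv> face_id p (emb (Inr (m, f)))"

lemma inner_outer: "f \<in> inner_sides q \<Longrightarrow> f \<in> outer"
  by (simp add: inner_sides_def)

lemma inner_core: "f \<in> inner_sides (u m) \<Longrightarrow> f \<in> core m"
  by (simp add: inner_sides_def)

lemma base_id_inj:
  assumes "f \<in> inner_faces q" "g \<in> inner_faces q" "base_id f = base_id g"
  shows "f = g"
proof -
  have f: "f \<in> outer" "g \<in> outer"
    using assms inner_face_fixed(1)[OF holed_axioms] inner_outer by blast+
  then have "face_at raw (Inl f) = face_at raw (Inl g)"
    using assms(3) by (subst (asm) emb_face_eq_iff) (auto simp: raw_simps)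
  then have "Inl ` face_at q f = (Inl ` face_at q g :: (nat + nat \<times> nat) set)"
    using f by (simp add: face_raw_Inl)
  then have "face_at q f = face_at q g"
    by (simp add: inj_image_eq_iff)
  then show ?thesis
    using inner_face_fixed(2)[OF holed_axioms assms(1)] inner_face_fixed(2)[OF holed_axioms assms(2)]
    by (simp add: face_id_def)
qed

lemma base_hole_distinct:
  assumes "f \<in> inner_faces q" "m \<in> marks q" "g \<in> inner_faces (u m)"
  shows "base_id f \<noteq> hole_id m g"
proof
  assume eq: "base_id f = hole_id m g"
  have f: "f \<in> outer" "g \<in> core m"
    using assms inner_face_fixed(1)[OF holed_axioms] inner_face_fixed(1)[OF filled] inner_outer inner_core
    by blast+
  then have "face_at raw (Inl f) = face_at raw (Inr (m, g))"
    using eq assms(2) by (subst (asm) emb_face_eq_iff) (auto simp: raw_simps)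
  then have "Inl ` face_at q f = (\<lambda>b. Inr (m, b)) ` face_at (u m) g"
    using f assms(2) by (simp add: face_raw_Inl face_raw_Inr)
  moreover have "f \<in> face_at q f" using f by (intro face_self) simp
  ultimately show False by blast
qed

lemma hole_id_inj:
  assumes "m \<in> marks q" "f \<in> inner_faces (u m)" "n \<in> marks q" "g \<in> inner_faces (u n)" "hole_id m f = hole_id n g"
  shows "m = n \<and> f = g"
proof -
  interpret um: holed "u m" by (rule filled[OF assms(1)])
  have f: "f \<in> core m" "g \<in> core n"
    using assms inner_face_fixed(1)[OF filled] inner_core by blast+
  then have "face_at raw (Inr (m, f)) = face_at raw (Inr (n, g))"
    using assms(1,3,5) by (subst (asm) emb_face_eq_iff) (auto simp: raw_simps)
  then have eq: "(\<lambda>b. Inr (m, b)) ` face_at (u m) f = ((\<lambda>b. Inr (n, b)) ` face_at (u n) g :: (nat + nat \<times> nat) set)"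
    using f assms(1,3) by (simp add: face_raw_Inr)
  have "f \<in> face_at (u m) f" using f by (intro um.face_self) simp
  then have mn: "m = n" using eq by blast
  have "face_at (u m) f = face_at (u m) g"
    using eq unfolding mn by (subst (asm) inj_image_eq_iff) (auto simp: inj_on_def)
  then show ?thesis
    using mn inner_face_fixed(2)[OF filled[OF assms(1)]] assms(2,4) by (metis face_id_def)
qed

text \<open>Together with the injectivity and disjointness just shown, this identifies the interior
  faces of \<open>p\<close> with the disjoint union of those of \<open>q\<close> and of the
  fillings.\<close>

lemma inner_faces_p:
  assumes "F \<in> inner_faces p"
  shows "(\<exists>f\<in>inner_faces q. F = base_id f) \<or> (\<exists>m\<in>marks q. \<exists>f\<in>inner_faces (u m). F = hole_id m f)"
proof -
  obtain x where x: "x \<in> inner_sides raw" "F = face_id p (emb x)"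
    using assms unfolding inner_faces_def emb.f_inner_sides by blast
  consider d where "d \<in> inner_sides q" "x = Inl d" | m d where "m \<in> marks q" "d \<in> inner_sides (u m)" "x = Inr (m, d)"
    using x(1) unfolding inner_sides_raw by blast
  then show ?thesis
  proof cases
    case (1 d)
    let ?f = "face_id q d"
    have ds: "d \<in> sides q" using 1 inner_sub by blast
    have f: "?f \<in> face_at q d" by (rule face_id_in[OF spherical_axioms ds])
    then have "?f \<in> inner_sides q" using inner_face_sub[OF 1(1)] by blast
    then have outer: "?f \<in> outer" "d \<in> outer" using 1 inner_outer by blast+
    have "F = base_id ?f"
      unfolding x(2) 1(2) using outer face_eq[OF ds f]
      by (subst emb_face_eq_iff) (auto simp: raw_simps face_raw_Inl)
    then show ?thesis using 1 by (auto simp: inner_faces_def)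
  next
    case (2 m d)
    interpret um: holed "u m" by (rule filled[OF 2(1)])
    let ?f = "face_id (u m) d"
    have ds: "d \<in> sides (u m)" using 2 um.inner_sub by blast
    have f: "?f \<in> face_at (u m) d" by (rule face_id_in[OF um.spherical_axioms ds])
    then have "?f \<in> inner_sides (u m)" using um.inner_face_sub[OF 2(2)] by blast
    then have core: "?f \<in> core m" "d \<in> core m" using 2 inner_core by blast+
    have "F = hole_id m ?f"
      unfolding x(2) 2(3) using core um.face_eq[OF ds f] 2(1)
      by (subst emb_face_eq_iff) (auto simp: raw_simps face_raw_Inr)
    then show ?thesis using 2 by (auto simp: inner_faces_def)
  qed
qed

end

section \<open>Decomposition of decorations\<close>

text \<open>The empty map is contained in every map by decree, so there a filling has to be
  exhibited: \<open>p\<close> itself in the hole \<open>0\<close>.\<close>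

lemma submap_parts:
  assumes "submap q (Some p)" "p \<in> QH"
  shows "hole_parts q p \<in> fillings q" "Some p = glue q (hole_parts q p)"
proof -
  have "\<exists>v. v \<in> fillings q \<and> Some p = glue q v"
  proof (cases q)
    case None
    then show ?thesis using assms(2) by (intro exI[of _ "\<lambda>_\<in>{0}. p"]) auto
  next
    case (Some q')
    then show ?thesis using assms(1) by (auto simp: submap_def)
  qed
  then have "hole_parts q p \<in> fillings q \<and> Some p = glue q (hole_parts q p)"
    unfolding hole_parts_def by (rule someI_ex)
  then show "hole_parts q p \<in> fillings q" "Some p = glue q (hole_parts q p)" by auto
qed

lemma filled_mapI:
  assumes "q \<in> QH" "p \<in> QH" "submap (Some q) (Some p)"
  shows "filled_map q (hole_parts (Some q) p) p"
  using submap_parts[OF assms(3,2)] assms(1,2) gluingI[OF assms(1)]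
  by (simp add: filled_map_def filled_map_axioms_def)

lemma sum_same_value:
  assumes "\<And>G. G \<in> A \<Longrightarrow> f G = c"
  shows "sum f A = of_nat (card A) *\<^sub>R (c :: 'a :: real_vector)"
  using assms by (simp add: sum_constant_scaleR)

text \<open>All terms of both sums equal \<open>\<phi> F\<close>, so the claim is that exactly one
  face of \<open>q\<close> or of the fillings lies over \<open>F\<close>. Off the faces of
  \<open>p\<close> everything vanishes by \<open>zero\<close>.\<close>

lemma decoration_decomposition:
  fixes \<phi> :: "face \<Rightarrow> real ^ 'n"
  assumes q: "q \<in> QHd" and p: "p \<in> QH" and sub: "submap q (Some p)"
    and zero: "\<And>F. F \<notin> own_faces (Some p) \<Longrightarrow> \<phi> F = 0"
  shows "\<phi> F = extend_base q p (restr q p \<phi>) F + extend_holes q p (part_dec q p \<phi>) F"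
proof (cases q)
  case None
  have "{G \<in> own_faces (Some p). G = F} = (if F \<in> own_faces (Some p) then {F} else {})"
    by auto
  then show ?thesis
    using zero[of F] unfolding None extend_base_def extend_holes_def
    by (simp add: faces_inside_def hole_face_def part_dec_def del: own_faces.simps(2))
next
  case (Some q')
  let ?u = "hole_parts (Some q') p"
  have q': "q' \<in> QH" using q Some by (auto simp: QHd_def)
  interpret filled_map q' ?u p
    using filled_mapI[OF q' p] sub Some by blast
  define B where "B = {G \<in> own_faces (Some q'). base_face (Some q') p G = F}"
  define H where "H = (\<lambda>h. {G \<in> faces_inside (Some q') p h. hole_face (Some q') p h G = F})"
  have base: "extend_base (Some q') p (restr (Some q') p \<phi>) F = of_nat (card B) *\<^sub>R \<phi> F"
    unfolding extend_base_def B_def[symmetric]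
    by (rule sum_same_value) (auto simp: restr_def B_def)
  have "(\<Sum>G\<in>H h. part_dec (Some q') p \<phi> h G) = of_nat (card (H h)) *\<^sub>R \<phi> F" for h
    by (rule sum_same_value) (auto simp: part_dec_def decorate_def H_def faces_inside_def)
  then have holes: "extend_holes (Some q') p (part_dec (Some q') p \<phi>) F = (\<Sum>h\<in>marks q'. of_nat (card (H h)) *\<^sub>R \<phi> F)"
    by (simp add: extend_holes_def H_def)
  have B_iff: "G \<in> B \<longleftrightarrow> (\<exists>f\<in>inner_faces q'. G = Inner f \<and> F = Inner (base_id f))
      \<or> (\<exists>i<perimeter q'. G = Phantom_Face i \<and> F = Phantom_Face i)" for G
    by (auto simp: B_def base_face_def)
  have H_iff: "G \<in> H h \<longleftrightarrow> (\<exists>f\<in>inner_faces (?u h). G = Inner f \<and> F = Inner (hole_id h f))" for G h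
    by (auto simp: H_def hole_face_def faces_inside_def)
  show ?thesis
  proof (cases "F \<in> own_faces (Some p)")
    case False
    then show ?thesis using zero[OF False] by (simp add: Some base holes)
  next
    case True
    then consider i where "F = Phantom_Face i" "i < perimeter q'"
      | f where "f \<in> inner_faces q'" "F = Inner (base_id f)"
      | m f where "m \<in> marks q'" "f \<in> inner_faces (?u m)" "F = Inner (hole_id m f)"
      using inner_faces_p by (auto simp: perimeter_p) blast
    then show ?thesis
    proof cases
      \<comment> \<open>The phantom faces of the fillings are not among \<open>faces_inside\<close>,
        so a phantom face of \<open>p\<close> comes from \<open>q\<close> alone.\<close>
      case (1 i)
      then have "B = {Phantom_Face i}" "H h = {}" for h
        using B_iff H_iff by auto
      then show ?thesis by (simp add: Some base holes)
    next
      case (2 f)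
      then have "B = {Inner f}"
        using B_iff base_id_inj by blast
      moreover have "H h = {}" if "h \<in> marks q'" for h
        using H_iff that 2 base_hole_distinct by blast
      ultimately show ?thesis by (simp add: Some base holes)
    next
      case (3 m f)
      have "G \<notin> B" for G
        unfolding B_iff using 3(3) base_hole_distinct[OF _ 3(1,2), THEN not_sym] by auto
      then have "B = {}" by blast
      moreover have "H h = (if h = m then {Inner f} else {})" if "h \<in> marks q'" for h
      proof (rule set_eqI)
        fix G
        have "m = h \<and> f = g" if "g \<in> inner_faces (?u h)" "F = Inner (hole_id h g)" for g
          using that 3 \<open>h \<in> marks q'\<close> by (intro hole_id_inj) auto
        then show "G \<in> H h \<longleftrightarrow> G \<in> (if h = m then {Inner f} else {})"
          unfolding H_iff using 3 by auto
      qed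
      then have "(\<Sum>h\<in>marks q'. of_nat (card (H h)) *\<^sub>R \<phi> F) = (\<Sum>h\<in>marks q'. if h = m then \<phi> F else 0)"
        by (intro sum.cong) auto
      ultimately show ?thesis
        unfolding Some base holes using 3(1) finite_marks by simp
    qed
  qed
qed

section \<open>Reflexivity and antisymmetry of the order\<close>

text \<open>A cap is a cycle bounding the root face on one side and a single hole, whose marked edge is
  the root edge, on the other. Gluing caps into all holes changes nothing.\<close>

locale cap = holed +
  assumes no_inner: "inner_sides M = {}"
    and card_hole_root: "card (hole_sides M) = card (root_face M)"
    and card_marks: "card (marks M) = 1"
begin

lemma sides_eq: "sides M = root_face M \<union> hole_sides M"
  using no_inner root_sub hole_sides_sub by (auto simp: inner_sides_def)

lemma finite_parts: "finite (root_face M)" "finite (hole_sides M)"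
  using finite_sides root_sub hole_sides_sub finite_subset by blast+

lemma opp_hole: "d \<in> hole_sides M \<Longrightarrow> opp M d \<in> root_face M"
  using hole_opp[of d] hole_sides_sub sides_eq opp_in by blast

lemma opp_image: "opp M ` hole_sides M = root_face M"
proof (rule card_subset_eq)
  show "finite (root_face M)" by (rule finite_parts)
  show "opp M ` hole_sides M \<subseteq> root_face M" using opp_hole by blast
  have "inj_on (opp M) (hole_sides M)"
    using hole_sides_sub by (intro inj_onI) (metis opp_opp subsetD)
  then show "card (opp M ` hole_sides M) = card (root_face M)"
    by (simp add: card_image card_hole_root)
qed

lemma opp_root: "d \<in> root_face M \<Longrightarrow> opp M d \<in> hole_sides M"
  using opp_image hole_sides_sub opp_opp by (metis imageE subsetD)

lemma single_hole:
  obtains h where "marks M = {h}" "hole_sides M = face_at M h" "opp M h = rt M"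
proof -
  obtain h where h: "marks M = {h}"
    using card_marks by (auto simp: card_1_singleton_iff)
  then have hole: "hole_sides M = face_at M h" by (simp add: hole_sides_def)
  moreover have "opp M h = rt M"
    using opp_image h by (intro hole_rt) (simp_all add: hole)
  ultimately show ?thesis using h that by blast
qed

text \<open>Two faces, and as many edges as sides of the root face: Euler's formula leaves that many
  vertices.\<close>

lemma card_vertices: "card (orbit (nxt M \<circ> opp M) ` sides M) = card (root_face M)"
proof -
  obtain h where h: "marks M = {h}" "hole_sides M = face_at M h" by (rule single_hole)
  have "face_at M ` sides M = {root_face M, face_at M h}"
  proof -
    have "face_at M ` root_face M = {root_face M}"
    proof -
      have "face_at M ` root_face M = (\<lambda>_. root_face M) ` root_face M"
        unfolding root_face_def by (rule image_cong[OF refl face_eq[OF rt_in]])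
      then show ?thesis using image_constant[OF rt_root] by simp
    qed
    moreover have "face_at M ` hole_sides M = {face_at M h}"
      by (simp add: face_at_hole_sides h(1))
    ultimately show ?thesis by (simp add: sides_eq image_Un insert_commute)
  qed
  moreover have "root_face M \<noteq> face_at M h"
    using root_not_hole rt_root h(2) by blast
  ultimately have "card (face_at M ` sides M) = 2" by simp
  moreover have "card (sides M) = 2 * card (root_face M)"
    using card_Un_disjoint[OF finite_parts root_not_hole] card_hole_root by (simp add: sides_eq)
  ultimately show ?thesis using euler by simp
qed

text \<open>A turn exchanges root side and hole side, so every vertex has at least two sides. There
  are twice as many sides as vertices, hence every vertex has exactly two.\<close>

lemma vertex_involution:
  assumes x: "x \<in> sides M"
  shows "nxt M (opp M (nxt M (opp M x))) = x"
proof -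
  let ?v = "nxt M \<circ> opp M"
  have neq: "?v y \<noteq> y" if "y \<in> sides M" for y
  proof (cases "y \<in> root_face M")
    case True
    then have "?v y \<in> hole_sides M"
      using opp_root[OF True] that by (simp add: nxt_hole_iff)
    then show ?thesis using True root_not_hole by (metis IntI emptyE)
  next
    case False
    then have "y \<in> hole_sides M" using that sides_eq by blast
    then have "?v y \<in> root_face M"
      using opp_hole[of y] that by (simp add: nxt_root_iff)
    then show ?thesis using False by metis
  qed
  have ge2: "2 \<le> card A" if A: "A \<in> orbit ?v ` sides M" for A
  proof -
    obtain y where y: "y \<in> sides M" "A = orbit ?v y" using A by blast
    have "{y, ?v y} \<subseteq> A"
      using y vtx.orbit_self[OF y(1)] orbit.base[of ?v y] by simp
    moreover have "finite A" using y vtx.orbit_fin by simp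
    moreover have "card {y, ?v y} = 2"
      using neq[OF y(1)] by (metis card_2_iff)
    ultimately show ?thesis by (metis card_mono)
  qed
  have fin: "finite (orbit ?v ` sides M)" using finite_sides by simp
  have "card (\<Union>(orbit ?v ` sides M)) = (\<Sum>A\<in>orbit ?v ` sides M. card A)"
  proof (rule card_Union_disjoint)
    show "pairwise disjnt (orbit ?v ` sides M)"
    proof (rule pairwiseI)
      fix A B assume "A \<in> orbit ?v ` sides M" "B \<in> orbit ?v ` sides M" "A \<noteq> B"
      then obtain y z where *: "y \<in> sides M" "z \<in> sides M" "A = orbit ?v y" "B = orbit ?v z" "A \<noteq> B"
        by blast
      have "w \<notin> B" if "w \<in> A" for w
        using vtx.orbit_eq[OF *(1), of w] vtx.orbit_eq[OF *(2), of w] that * by metis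
      then show "disjnt A B" by (auto simp: disjnt_iff)
    qed
    show "finite A" if "A \<in> orbit ?v ` sides M" for A
      using that vtx.orbit_fin by (elim imageE) simp
  qed
  moreover have "\<Union>(orbit ?v ` sides M) = sides M"
    using vtx.orbit_self vtx.orbit_sub by blast
  moreover have "card (sides M) = 2 * card (root_face M)"
    using card_Un_disjoint[OF finite_parts root_not_hole] card_hole_root by (simp add: sides_eq)
  ultimately have "(\<Sum>A\<in>orbit ?v ` sides M. card A) = (\<Sum>A\<in>orbit ?v ` sides M. 2)"
    by (simp add: card_vertices)
  then have "card A = 2" if "A \<in> orbit ?v ` sides M" for A
    using sum_mono_inv[of "\<lambda>_. 2" _ card A] ge2 that fin by metis
  then have "card (orbit ?v x) = 2" using x by blast
  then show ?thesis
    using vtx.orbit_powers(3)[OF x] by (simp add: numeral_2_eq_2)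
qed

end

subsection \<open>Gluing caps\<close>

context gluing
begin

text \<open>A hole side of \<open>q\<close> survives as the side of the cap's own hole opposite to
  the root side it is matched with.\<close>

definition cap_map :: "'d \<Rightarrow> 'd + 'd \<times> 'd" where
  "cap_map d = (if d \<in> hole_sides q then Inr (hole_of q d, opp (u (hole_of q d)) (root_of (hole_of q d) d)) else Inl d)"

lemma cap_map_hole:
  "m \<in> marks q \<Longrightarrow> s \<in> face_at q m \<Longrightarrow> cap_map s = Inr (m, opp (u m) (root_of m s))"
  using face_hole_sub[of m] by (auto simp: cap_map_def hole_of_eq)

lemma cap_map_outer: "d \<notin> hole_sides q \<Longrightarrow> cap_map d = Inl d"
  by (simp add: cap_map_def)

lemma cap_map_iso:
  assumes caps: "\<And>m. m \<in> marks q \<Longrightarrow> cap (u m)"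
  shows "map_iso cap_map q raw"
proof -
  have core: "opp (u m) r \<in> core m" if m: "m \<in> marks q" and r: "r \<in> root_face (u m)" for m r
  proof -
    interpret um: cap "u m" by (rule caps[OF m])
    show ?thesis
      using um.opp_root[OF r] um.hole_sides_sub um.root_not_hole by blast
  qed
  have cases: thesis if "d \<in> sides q" "d \<notin> hole_sides q \<Longrightarrow> thesis"
    "\<And>m. m \<in> marks q \<Longrightarrow> d \<in> face_at q m \<Longrightarrow> thesis" for d thesis
    using that by (auto simp: hole_sides_def)
  have "bij_betw cap_map (sides q) (sides raw)"
  proof (rule bij_betw_imageI)
    show "inj_on cap_map (sides q)"
    proof (rule inj_onI)
      fix x y assume xy: "x \<in> sides q" "y \<in> sides q" and eq: "cap_map x = cap_map y"
      consider "x \<notin> hole_sides q" "y \<notin> hole_sides q"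
        | m where "m \<in> marks q" "x \<in> face_at q m" "y \<in> face_at q m"
        | "x = y"
      proof (cases "x \<in> hole_sides q")
        case True
        then have "y \<in> hole_sides q" using eq by (auto simp: cap_map_def split: if_splits)
        then obtain m n where m: "m \<in> marks q" "x \<in> face_at q m" "n \<in> marks q" "y \<in> face_at q n"
          using True by (auto simp: hole_sides_def)
        then have "m = n" using eq by (simp add: cap_map_hole)
        then show ?thesis using m that(2) by blast
      next
        case False
        then have "y \<notin> hole_sides q" using eq by (auto simp: cap_map_def split: if_splits)
        then show ?thesis using False that(1) by blast
      qed
      then show "x = y"
      proof cases
        case 1
        then show ?thesis using eq by (simp add: cap_map_outer)
      next
        case (2 m)
        interpret um: cap "u m" by (rule caps[OF 2(1)])
        have "opp (u m) (root_of m x) = opp (u m) (root_of m y)"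
          using eq 2 by (simp add: cap_map_hole)
        then have "root_of m x = root_of m y"
          using root_of_in[OF 2(1)] um.root_sub by (metis subsetD um.opp_opp)
        then show ?thesis using side_of_root_of 2 by metis
      qed
    qed
    show "cap_map ` sides q = sides raw"
    proof (intro equalityI subsetI)
      fix y assume "y \<in> cap_map ` sides q"
      then obtain d where d: "d \<in> sides q" "y = cap_map d" by blast
      from d(1) show "y \<in> sides raw"
        by (rule cases) (use d core root_of_in in \<open>auto simp: cap_map_outer cap_map_hole raw_simps\<close>)
    next
      fix y assume "y \<in> sides raw"
      then consider d where "y = Inl d" "d \<in> outer" | m e where "m \<in> marks q" "e \<in> core m" "y = Inr (m, e)"
        unfolding raw_simps by blast
      then show "y \<in> cap_map ` sides q"
      proof cases
        case (1 d)
        then show ?thesis by (intro image_eqI[of _ _ d]) (auto simp: cap_map_outer)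
      next
        case (2 m e)
        interpret um: cap "u m" by (rule caps[OF 2(1)])
        let ?r = "opp (u m) e"
        have r: "?r \<in> root_face (u m)"
          using 2 um.sides_eq um.opp_hole by blast
        have s: "side_of m ?r \<in> face_at q m" by (rule side_of_in[OF 2(1)])
        have "cap_map (side_of m ?r) = y"
          using 2 r by (simp add: cap_map_hole[OF 2(1) s] root_of_side_of)
        then show ?thesis
          using s face_sub[OF marks_in[OF 2(1)]] by blast
      qed
    qed
  qed
  moreover have "cap_map (rt q) = rt raw"
    using rt_not_hole by (simp add: cap_map_outer raw_simps)
  \<comment> \<open>The clause on unfilled holes enters here: the mark of a cap lies opposite to its
    root, and the root is glued to the marked edge of \<open>q\<close>.\<close>
  moreover have "cap_map ` marks q = marks raw"
  proof -
    have "cap_map m = Inr (m, opp (u m) (rt (u m))) \<and> marks (u m) = {opp (u m) (rt (u m))}" if m: "m \<in> marks q" for m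
    proof -
      interpret um: cap "u m" by (rule caps[OF m])
      obtain h where h: "marks (u m) = {h}" "opp (u m) h = rt (u m)" by (rule um.single_hole)
      then have "h \<in> sides (u m)" using um.marks_in by blast
      then have "opp (u m) (rt (u m)) = h" by (simp flip: h(2))
      then show ?thesis
        using h(1) cap_map_hole[OF m face_self[OF marks_in[OF m]]] root_of_mark[OF m] by simp
    qed
    then show ?thesis unfolding raw_simps by force
  qed
  moreover have "cap_map (opp q d) = opp raw (cap_map d) \<and> cap_map (nxt q d) = nxt raw (cap_map d)"
    if d: "d \<in> sides q" for d
    using d
  proof (rule cases)
    assume out: "d \<notin> hole_sides q"
    have "cap_map (opp q d) = opp raw (Inl d)"
    proof (cases "opp q d \<in> hole_sides q")
      case True
      then obtain m where m: "m \<in> marks q" "opp q d \<in> face_at q m"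
        by (auto simp: hole_sides_def)
      then show ?thesis
        using core[OF m(1) root_of_in[OF m(1)]] by (simp add: opp_raw_hole cap_map_hole glue_side_core)
    next
      case False
      then show ?thesis by (simp add: cap_map_outer raw_simps)
    qed
    then show ?thesis
      using out d by (simp add: cap_map_outer nxt_hole_iff raw_simps)
  next
    fix m assume m: "m \<in> marks q" "d \<in> face_at q m"
    interpret um: cap "u m" by (rule caps[OF m(1)])
    have root: "root_of m d \<in> root_face (u m)" "root_of m d \<in> sides (u m)"
      using root_of_in[OF m(1)] um.root_sub by blast+
    have "opp q d \<notin> hole_sides q"
      using m face_hole_sub hole_opp by blast
    then have "cap_map (opp q d) = opp raw (cap_map d)"
      using m root by (simp add: cap_map_hole cap_map_outer raw_simps glue_side_root side_of_root_of)
    moreover have nd: "nxt q d \<in> face_at q m"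
      using m d marks_in by (simp add: nxt_face_iff)
    let ?r = "root_of m (nxt q d)"
    have r: "?r \<in> sides (u m)" using root_of_in[OF m(1)] um.root_sub by blast
    \<comment> \<open>In a cap \<open>opp\<close> turns \<open>nxt\<close> into its inverse. This
      second reversal of direction undoes the one in \<open>nxt_root_of\<close>.\<close>
    have "nxt (u m) (opp (u m) (nxt (u m) ?r)) = opp (u m) ?r"
      using um.vertex_involution[of "opp (u m) ?r"] r by simp
    then have "cap_map (nxt q d) = nxt raw (cap_map d)"
      using nxt_root_of[OF m] by (simp add: cap_map_hole[OF m] cap_map_hole[OF m(1) nd] raw_simps)
    ultimately show ?thesis by blast
  qed
  ultimately show ?thesis by (simp add: map_iso_def)
qed

end

text \<open>An isomorphism becomes an equality because \<open>q\<close> is its own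
  representative.\<close>

lemma glue_caps:
  assumes "q \<in> QH" "gluing q u" "\<And>m. m \<in> marks q \<Longrightarrow> cap (u m)"
  shows "glue_map q u = q"
proof -
  interpret gluing q u by fact
  have "rep q = rep raw"
    using cap_map_iso[OF assms(3)] marks_sub by (intro rep_cong spherical_axioms) auto
  then show ?thesis
    using assms(1) by (simp add: glue_map_def QH_def)
qed

subsection \<open>Antisymmetry\<close>

context filled_map
begin

text \<open>Gluing never lowers the number of sides outside holes; on a tie it never raises the
  number of hole sides; on a further tie it never lowers the number of holes. Mutual inclusion
  therefore forces ties in all three, and then every filling is a cap.\<close>

lemma card_outer_p: "card (sides p - hole_sides p) = card outer + (\<Sum>m\<in>marks q. card (inner_sides (u m)))"
proof -
  have "sides raw - hole_sides raw = Inl ` outer \<union> Inr ` Sigma (marks q) (\<lambda>m. inner_sides (u m))"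
    unfolding hole_sides_raw raw_simps inner_sides_def by auto
  moreover have "sides p - hole_sides p = emb ` (sides raw - hole_sides raw)"
    using emb.hole_sides_sub by (simp add: emb.f_hole_sides emb.f_diff flip: emb.f_image)
  moreover have fin: "finite (inner_sides (u m))" if "m \<in> marks q" for m
    using holed.inner_sub[OF filled[OF that]] spherical.finite_sides[of "u m"] filled[OF that]
    by (auto simp: holed_def intro: finite_subset)
  have "card (Inl ` outer \<union> Inr ` Sigma (marks q) (\<lambda>m. inner_sides (u m)))
      = card outer + (\<Sum>m\<in>marks q. card (inner_sides (u m)))"
    using finite_sides finite_marks fin by (subst card_Un_disjoint) (auto simp: card_image)
  ultimately show ?thesis
    using emb.card_f[OF Diff_subset[of "sides raw" "hole_sides raw"]] by simp
qed

lemma card_hole_sides_p: "card (hole_sides p) = (\<Sum>m\<in>marks q. card (hole_sides (u m)))"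
proof -
  have fin: "finite (hole_sides (u m))" if "m \<in> marks q" for m
    using holed.hole_sides_sub[OF filled[OF that]] spherical.finite_sides[of "u m"] filled[OF that]
    by (auto simp: holed_def intro: finite_subset)
  have "card (hole_sides p) = card (hole_sides raw)"
    unfolding emb.f_hole_sides by (rule emb.card_f[OF emb.hole_sides_sub])
  then show ?thesis
    using finite_marks fin by (simp add: hole_sides_raw card_image)
qed

lemma card_marks_p: "card (marks p) = (\<Sum>m\<in>marks q. card (marks (u m)))"
proof -
  have fin: "finite (marks (u m))" if "m \<in> marks q" for m
    using holed.finite_marks[OF filled[OF that]] .
  have "card (marks p) = card (marks raw)"
    unfolding emb.f_marks[symmetric] by (rule emb.card_f[OF marks_raw_sub])
  then show ?thesis
    using finite_marks fin by (simp add: raw_simps card_image)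
qed

lemma card_outer_le: "card outer \<le> card (sides p - hole_sides p)"
  by (simp add: card_outer_p)

context
  assumes outer_eq: "card (sides p - hole_sides p) = card outer"
begin

lemma inner_empty:
  assumes "m \<in> marks q"
  shows "inner_sides (u m) = {}"
proof -
  interpret um: holed "u m" by (rule filled[OF assms])
  have "card (inner_sides (u m)) = 0"
    using outer_eq card_outer_p assms finite_marks by simp
  then show ?thesis
    using um.inner_sub um.finite_sides by (metis card_0_eq finite_subset)
qed

text \<open>Without inner sides, the opposite of a hole side can only be a root side.\<close>

lemma card_hole_le_root:
  assumes "m \<in> marks q"
  shows "card (hole_sides (u m)) \<le> card (root_face (u m))"
proof -
  interpret um: holed "u m" by (rule filled[OF assms])
  have "opp (u m) ` hole_sides (u m) \<subseteq> root_face (u m)"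
    using inner_empty[OF assms] um.hole_opp um.hole_sides_sub um.opp_in unfolding inner_sides_def by blast
  moreover have "inj_on (opp (u m)) (hole_sides (u m))"
    using um.hole_sides_sub by (intro inj_onI) (metis um.opp_opp subsetD)
  moreover have "finite (root_face (u m))"
    using um.root_sub um.finite_sides finite_subset by blast
  ultimately show ?thesis by (metis card_image card_mono)
qed

lemma card_hole_sides_q: "card (hole_sides q) = (\<Sum>m\<in>marks q. card (root_face (u m)))"
  unfolding card_hole_sides by (intro sum.cong refl hole_deg_eq)

lemma card_hole_sides_le: "card (hole_sides p) \<le> card (hole_sides q)"
  unfolding card_hole_sides_p card_hole_sides_q by (intro sum_mono card_hole_le_root)

context
  assumes holes_eq: "card (hole_sides p) = card (hole_sides q)"
begin

lemma hole_eq_root: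
  assumes "m \<in> marks q"
  shows "card (hole_sides (u m)) = card (root_face (u m))"
proof -
  have "(\<Sum>n\<in>marks q. card (hole_sides (u n))) = (\<Sum>n\<in>marks q. card (root_face (u n)))"
    using holes_eq by (simp only: card_hole_sides_p card_hole_sides_q)
  then show ?thesis
    using card_hole_le_root assms finite_marks by (rule sum_mono_inv)
qed

lemma card_marks_ge_1:
  assumes "m \<in> marks q"
  shows "1 \<le> card (marks (u m))"
proof -
  interpret um: holed "u m" by (rule filled[OF assms])
  have "finite (root_face (u m))"
    using um.root_sub um.finite_sides finite_subset by blast
  then have "card (root_face (u m)) \<noteq> 0"
    using um.rt_root by auto
  then have "hole_sides (u m) \<noteq> {}" using hole_eq_root[OF assms] by auto
  then have "marks (u m) \<noteq> {}" by (auto simp: hole_sides_def)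
  then show ?thesis using um.finite_marks by (simp add: Suc_le_eq card_gt_0_iff)
qed

lemma card_marks_le: "card (marks q) \<le> card (marks p)"
  unfolding card_marks_p using sum_mono[of "marks q" "\<lambda>_. 1" "\<lambda>m. card (marks (u m))"] card_marks_ge_1 by simp

lemma cap_if_marks_eq:
  assumes "card (marks p) = card (marks q)" "m \<in> marks q"
  shows "cap (u m)"
proof -
  interpret um: holed "u m" by (rule filled[OF assms(2)])
  have "(\<Sum>n\<in>marks q. 1) = (\<Sum>n\<in>marks q. card (marks (u n)))"
    using assms(1) by (simp add: card_marks_p)
  then have "1 = card (marks (u m))"
    using card_marks_ge_1 assms(2) finite_marks by (rule sum_mono_inv)
  then show ?thesis
    using inner_empty[OF assms(2)] hole_eq_root[OF assms(2)] by unfold_locales auto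
qed

end
end
end

lemma submap_antisym:
  assumes "q \<in> QHd" "q' \<in> QHd" "submap q q'" "submap q' q"
  shows "q = q'"
proof (cases "q = None \<or> q' = None")
  case True
  then show ?thesis using assms(3,4) by (cases q; cases q') (auto simp: submap_def)
next
  case False
  then obtain r r' where r: "q = Some r" "r \<in> QH" "q' = Some r'" "r' \<in> QH"
    using assms(1,2) by (auto simp: QHd_def)
  define v where "v = hole_parts (Some r) r'"
  interpret there: filled_map r v r'
    unfolding v_def using assms(3) r by (intro filled_mapI) auto
  interpret inverse: filled_map r' "hole_parts (Some r') r" r
    using assms(4) r by (intro filled_mapI) auto
  have outer: "card (sides r' - hole_sides r') = card (sides r - hole_sides r)"
    using there.card_outer_le inverse.card_outer_le by simp
  have holes: "card (hole_sides r') = card (hole_sides r)"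
    using there.card_hole_sides_le[OF outer] inverse.card_hole_sides_le[OF outer[symmetric]] by simp
  have marks: "card (marks r') = card (marks r)"
    using there.card_marks_le[OF outer holes] inverse.card_marks_le[OF outer[symmetric] holes[symmetric]] by simp
  \<comment> \<open>With all counts tied every part in \<open>v\<close> is a cap, so gluing
    \<open>v\<close> returns \<open>r\<close>, while by construction it returns
    \<open>r'\<close>.\<close>
  have "glue_map r v = r"
    using there.cap_if_marks_eq[OF outer holes marks] by (intro glue_caps r(2) there.gluing_axioms)
  then show ?thesis
    using there.glued r by simp
qed

subsection \<open>Caps exist\<close>

text \<open>Two copies of the contour of the hole, \<open>True\<close> for the new hole and
  \<open>False\<close> for the root face, the latter traversed backwards. The perimeter is then
  right by construction.\<close>

definition cap_of :: "'d pmap \<Rightarrow> 'd \<Rightarrow> ('d \<times> bool) pmap" where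
  "cap_of q m = \<lparr> sides = face_at q m \<times> UNIV, opp = (\<lambda>(x, b). (x, \<not> b)),
     nxt = (\<lambda>(x, b). (if b then nxt q x else inv (nxt q) x, b)), rt = (m, False), marks = {(m, True)} \<rparr>"

lemma cap_of_simps [simp]:
  "sides (cap_of q m) = face_at q m \<times> UNIV"
  "opp (cap_of q m) (x, b) = (x, \<not> b)"
  "nxt (cap_of q m) (x, True) = (nxt q x, True)"
  "nxt (cap_of q m) (x, False) = (inv (nxt q) x, False)"
  "rt (cap_of q m) = (m, False)"
  "marks (cap_of q m) = {(m, True)}"
  by (simp_all add: cap_of_def)

context
  fixes q :: "'d pmap" and m
  assumes holed_q: "holed q" and perm: "nxt q permutes sides q" and m: "m \<in> marks q"
begin

interpretation holed q by (rule holed_q)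

lemma perm_nxt: "permutation (nxt q)"
  using perm finite_sides by (auto simp: permutation_permutes)

lemma inv_nxt [simp]: "nxt q (inv (nxt q) x) = x" "inv (nxt q) (nxt q x) = x"
  using permutes_inverses[OF perm] by auto

lemma m_side: "m \<in> sides q"
  using m marks_in by blast

lemma in_C [simp]: "x \<in> face_at q m \<Longrightarrow> nxt q x \<in> face_at q m" "x \<in> face_at q m \<Longrightarrow> inv (nxt q) x \<in> face_at q m"
proof -
  assume x: "x \<in> face_at q m"
  show "nxt q x \<in> face_at q m" using x by (auto simp: face_at_def intro: orbit.step)
  have "inv (nxt q) x \<in> sides q"
    using x face_sub[OF m_side] permutes_in_image[OF permutes_inv[OF perm]] by blast
  then show "inv (nxt q) x \<in> face_at q m"
    using x nxt_face_iff[OF m_side, of "inv (nxt q) x"] by simp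
qed

lemma face_cap:
  assumes "x \<in> face_at q m"
  shows "face_at (cap_of q m) (x, b) = face_at q m \<times> {b}"
proof -
  let ?f = "if b then nxt q else inv (nxt q)"
  have "(\<lambda>y. (y, b)) ` orbit ?f x = orbit (nxt (cap_of q m)) (x, b)"
    using permutation_self_in_orbit[OF perm_nxt] permutation_self_in_orbit[OF permutation_inverse[OF perm_nxt]]
    by (intro orbit_inverse) (auto simp: cap_of_def)
  moreover have "orbit ?f x = face_at q m"
    using face_eq[OF m_side assms] orbit_inv_eq[OF perm_nxt] by (simp add: face_at_def)
  ultimately show ?thesis by (auto simp: face_at_def)
qed

lemma m_C: "m \<in> face_at q m"
  by (rule face_self[OF m_side])

lemma cap_root: "root_face (cap_of q m) = face_at q m \<times> {False}"
  by (simp add: root_face_def face_cap m_C)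

lemma cap_holes: "hole_sides (cap_of q m) = face_at q m \<times> {True}"
  by (simp add: hole_sides_def face_cap m_C)

lemma cap_reach_root:
  assumes "x \<in> face_at q m"
  shows "((m, False), (x, False)) \<in>
    {(x, y). x \<in> face_at q m \<times> {False} \<and> y \<in> face_at q m \<times> {False}
       \<and> (y = nxt (cap_of q m) x \<or> y = opp (cap_of q m) x)}\<^sup>*" (is "_ \<in> ?R\<^sup>*")
proof -
  have x: "x \<in> orbit (inv (nxt q)) m"
    using assms orbit_inv_eq[OF perm_nxt] by (simp add: face_at_def)
  then have "x \<in> face_at q m \<and> ((m, False), (x, False)) \<in> ?R\<^sup>*"
  proof induction
    case base
    then show ?case using m_C by (intro conjI r_into_rtrancl) auto
  next
    case (step y)
    then have "((y, False), (inv (nxt q) y, False)) \<in> ?R" by auto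
    then show ?case using step.IH by (auto intro: rtrancl_into_rtrancl)
  qed
  then show ?thesis by blast
qed

lemma cap_joined: "joined (cap_of q m) (face_at q m \<times> UNIV)" "joined (cap_of q m) (face_at q m \<times> {False})"
proof -
  let ?R = "\<lambda>S. {(x, y). x \<in> S \<and> y \<in> S \<and> (y = nxt (cap_of q m) x \<or> y = opp (cap_of q m) x)}"
  show "joined (cap_of q m) (face_at q m \<times> {False})"
    unfolding joined_def using cap_reach_root by auto
  have mono: "(?R (face_at q m \<times> {False}))\<^sup>* \<subseteq> (?R (face_at q m \<times> UNIV))\<^sup>*"
    by (rule rtrancl_mono) auto
  have "((m, False), (x, b)) \<in> (?R (face_at q m \<times> UNIV))\<^sup>*" if x: "x \<in> face_at q m" for x b
  proof -
    have root: "((m, False), (x, False)) \<in> (?R (face_at q m \<times> UNIV))\<^sup>*"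
      using cap_reach_root[OF x] mono by blast
    moreover have "((x, False), (x, True)) \<in> ?R (face_at q m \<times> UNIV)"
      using x by auto
    ultimately show ?thesis
      by (cases b) (auto intro: rtrancl_into_rtrancl)
  qed
  then show "joined (cap_of q m) (face_at q m \<times> UNIV)"
    unfolding joined_def by auto
qed

lemma cap_vertex:
  assumes "x \<in> face_at q m"
  shows "orbit (nxt (cap_of q m) \<circ> opp (cap_of q m)) (x, True) = {(x, True), (inv (nxt q) x, False)}"
    and "orbit (nxt (cap_of q m) \<circ> opp (cap_of q m)) (x, False) = {(nxt q x, True), (x, False)}"
proof -
  have orb: "orbit f s = {s, f s}" if "f (f s) = s" for f :: "'d \<times> bool \<Rightarrow> 'd \<times> bool" and s
  proof (intro equalityI subsetI)
    fix y assume "y \<in> orbit f s"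
    then show "y \<in> {s, f s}" by induction (auto simp: that)
  next
    fix y assume "y \<in> {s, f s}"
    then show "y \<in> orbit f s"
      using orbit.base[of f s] orbit.step[OF orbit.base[of f s]] that by auto
  qed
  show "orbit (nxt (cap_of q m) \<circ> opp (cap_of q m)) (x, True) = {(x, True), (inv (nxt q) x, False)}"
    "orbit (nxt (cap_of q m) \<circ> opp (cap_of q m)) (x, False) = {(nxt q x, True), (x, False)}"
    by (subst orb; auto)+
qed

lemma cap_spherical: "spherical (cap_of q m)"
proof
  have fin: "finite (face_at q m)" by (rule finite_face[OF m_side])
  show "finite (sides (cap_of q m))" using fin by simp
  show "rt (cap_of q m) \<in> sides (cap_of q m)" using m_C by simp
  show "bij_betw (nxt (cap_of q m)) (sides (cap_of q m)) (sides (cap_of q m))"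
    by (rule bij_betwI[of _ _ _ "\<lambda>(x, b). (if b then inv (nxt q) x else nxt q x, b)"]) (auto simp: cap_of_def)
  show "opp (cap_of q m) d \<in> sides (cap_of q m) \<and> opp (cap_of q m) d \<noteq> d \<and> opp (cap_of q m) (opp (cap_of q m) d) = d"
    if "d \<in> sides (cap_of q m)" for d
    using that by (cases d) auto
  show "joined (cap_of q m) (sides (cap_of q m))"
    using cap_joined(1) by simp
  let ?v = "nxt (cap_of q m) \<circ> opp (cap_of q m)"
  have "orbit ?v ` sides (cap_of q m) = (\<lambda>x. {(x, True), (inv (nxt q) x, False)}) ` face_at q m"
  proof (intro equalityI subsetI)
    fix A assume "A \<in> orbit ?v ` sides (cap_of q m)"
    then obtain x b where x: "x \<in> face_at q m" "A = orbit ?v (x, b)" by auto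
    show "A \<in> (\<lambda>x. {(x, True), (inv (nxt q) x, False)}) ` face_at q m"
    proof (cases b)
      case True
      then show ?thesis using x cap_vertex(1)[OF x(1)] by auto
    next
      case False
      then show ?thesis
        using x cap_vertex(2)[OF x(1)] by (intro image_eqI[of _ _ "nxt q x"]) auto
    qed
  next
    fix A assume "A \<in> (\<lambda>x. {(x, True), (inv (nxt q) x, False)}) ` face_at q m"
    then obtain x where x: "x \<in> face_at q m" "A = {(x, True), (inv (nxt q) x, False)}" by blast
    then show "A \<in> orbit ?v ` sides (cap_of q m)"
      using cap_vertex(1)[OF x(1)] by (intro image_eqI[of _ _ "(x, True)"]) auto
  qed
  moreover have "inj_on (\<lambda>x. {(x, True), (inv (nxt q) x, False)}) (face_at q m)"
    by (auto simp: inj_on_def doubleton_eq_iff)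
  ultimately have "card (orbit ?v ` sides (cap_of q m)) = card (face_at q m)"
    by (simp add: card_image)
  moreover have "face_at (cap_of q m) ` sides (cap_of q m) = {face_at q m \<times> {True}, face_at q m \<times> {False}}"
  proof -
    have "face_at (cap_of q m) ` sides (cap_of q m) = (\<lambda>b. face_at q m \<times> {b}) ` (UNIV :: bool set)"
    proof (intro equalityI subsetI)
      fix A assume "A \<in> face_at (cap_of q m) ` sides (cap_of q m)"
      then show "A \<in> (\<lambda>b. face_at q m \<times> {b}) ` (UNIV :: bool set)"
        using face_cap by fastforce
    next
      fix A assume "A \<in> (\<lambda>b. face_at q m \<times> {b}) ` (UNIV :: bool set)"
      then obtain b where "A = face_at q m \<times> {b}" by blast
      then show "A \<in> face_at (cap_of q m) ` sides (cap_of q m)"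
        using face_cap[OF m_C, of b] m_C by (intro image_eqI[of _ _ "(m, b)"]) auto
    qed
    then show ?thesis by (auto simp: UNIV_bool)
  qed
  moreover have "face_at q m \<times> {True} \<noteq> face_at q m \<times> {False}"
    using m_C by auto
  ultimately show "card (orbit ?v ` sides (cap_of q m)) + card (face_at (cap_of q m) ` sides (cap_of q m))
      = card (sides (cap_of q m)) div 2 + 2"
    using fin by (simp add: card_cartesian_product UNIV_bool)
qed

lemma cap_cap_of: "cap (cap_of q m)"
proof -
  interpret C: spherical "cap_of q m" by (rule cap_spherical)
  have inner: "inner_sides (cap_of q m) = {}"
    by (auto simp: inner_sides_def cap_root cap_holes)
  have "sides (cap_of q m) - hole_sides (cap_of q m) = face_at q m \<times> {False}"
    by (auto simp: cap_holes)
  then have joined: "joined (cap_of q m) (sides (cap_of q m) - hole_sides (cap_of q m))"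
    using cap_joined(2) by simp
  show ?thesis
  proof unfold_locales
    show "marks (cap_of q m) \<subseteq> sides (cap_of q m) - root_face (cap_of q m)"
      using m_C by (simp add: cap_root)
    show "inj_on (face_at (cap_of q m)) (marks (cap_of q m))" "card (marks (cap_of q m)) = 1"
      by simp_all
    show "card (face_at (cap_of q m) d) = 4" if "d \<in> inner_sides (cap_of q m)" for d
      using that inner by simp
    show "opp (cap_of q m) d \<notin> hole_sides (cap_of q m)" if "d \<in> hole_sides (cap_of q m)" for d
      using that by (cases d) (simp add: cap_holes)
    show "joined (cap_of q m) (sides (cap_of q m) - hole_sides (cap_of q m))"
      by (rule joined)
    show "opp (cap_of q m) n = rt (cap_of q m)" if "n \<in> marks (cap_of q m)" for n
      using that by simp
    show "inner_sides (cap_of q m) = {}"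
      by (rule inner)
    show "card (hole_sides (cap_of q m)) = card (root_face (cap_of q m))"
      by (simp add: cap_root cap_holes card_cartesian_product)
  qed
qed

end

lemma cap_rep:
  assumes "cap M"
  shows "cap (rep M)" "perimeter (rep M) = perimeter M"
proof -
  interpret cap M by fact
  obtain f where f: "map_iso f M (rep M)" using rep_iso spherical_axioms by blast
  interpret holed_isomorphism M f "rep M"
    by unfold_locales (rule f)
  interpret N: holed "rep M" by (rule holed_image)
  have "card (marks (rep M)) = 1"
    using card_f[of "marks M"] marks_sub card_marks unfolding f_marks by auto
  moreover have "card (hole_sides (rep M)) = card (root_face (rep M))"
    using card_f[OF hole_sides_sub] card_f[OF root_sub] card_hole_root by (simp add: f_hole_sides f_root)
  moreover have "inner_sides (rep M) = {}"
    using no_inner by (simp add: f_inner_sides)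
  ultimately show "cap (rep M)" by unfold_locales
  show "perimeter (rep M) = perimeter M" by (rule f_perimeter)
qed

text \<open>The holes are filled with representatives of caps, since fillings must belong to
  \<open>QH\<close>.\<close>

lemma submap_refl:
  assumes "q \<in> QHd"
  shows "submap q q"
proof (cases q)
  case None
  then show ?thesis by (simp add: submap_def)
next
  case (Some r)
  then have r: "r \<in> QH" using assms by (auto simp: QHd_def)
  interpret holed r using r by (simp add: QH_def quad_with_holes_iff)
  have perm: "nxt r permutes sides r"
    using r by (intro planar_map_permutes) (simp add: QH_def quad_with_holes_iff)
  define v where "v = (\<lambda>m\<in>marks r. rep (cap_of r m))"
  have v: "cap (v m)" "v m \<in> QH" "perimeter (v m) = hole_deg r m" if "m \<in> marks r" for m
  proof -
    have c: "cap (cap_of r m)" by (rule cap_cap_of[OF holed_axioms perm that])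
    have "perimeter (cap_of r m) = hole_deg r m"
      by (simp add: perimeter_def cap_root[OF holed_axioms perm that] hole_deg_def card_cartesian_product)
    then show "cap (v m)" "v m \<in> QH" "perimeter (v m) = hole_deg r m"
      using cap_rep[OF c] rep_in_QH[of "cap_of r m"] c that by (auto simp: v_def cap_def)
  qed
  then have fill: "v \<in> fillings (Some r)"
    by (auto simp: v_def)
  have "glue_map r v = r"
    using v(1) by (intro glue_caps r gluingI[OF r fill])
  then show ?thesis
    unfolding Some submap_def using fill by (intro disjI2 bexI[of _ v]) auto
qed

section \<open>Countability and measurability\<close>

text \<open>A map in \<open>QH\<close> is determined by finite lists, because
  \<open>planar_map\<close> makes \<open>opp\<close> and \<open>nxt\<close> the identity off the
  finite set of sides.\<close>

lemma countable_QH: "countable QH"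
proof -
  define code where "code M = (sorted_list_of_set (sides M), map (opp M) (sorted_list_of_set (sides M)),
    map (nxt M) (sorted_list_of_set (sides M)), rt M, sorted_list_of_set (marks M))" for M :: "nat pmap"
  have "inj_on code QH"
  proof (rule inj_onI)
    fix M N :: "nat pmap" assume MN: "M \<in> QH" "N \<in> QH" and eq: "code M = code N"
    have pl: "planar_map M" "planar_map N" "holed M" "holed N"
      using MN by (auto simp: QH_def quad_with_holes_iff)
    have fin: "finite (sides M)" "finite (sides N)" "finite (marks M)" "finite (marks N)"
      using pl by (auto simp: planar_map_def dest: holed.finite_marks)
    have sides: "sides M = sides N" and marks: "marks M = marks N"
      using eq fin by (auto simp: code_def dest: arg_cong[of _ _ set])
    have "opp M x = opp N x \<and> nxt M x = nxt N x" for x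
    proof (cases "x \<in> sides M")
      case True
      then show ?thesis using eq fin sides by (auto simp: code_def)
    next
      case False
      then show ?thesis using pl sides by (auto simp: planar_map_iff)
    qed
    then show "M = N"
      using eq sides marks by (intro pmap.equality) (auto simp: code_def)
  qed
  then show ?thesis
    by (rule countable_image_inj_on[rotated]) (rule countableI_type)
qed

lemma countable_QHd: "countable QHd"
  using countable_QH by (simp add: QHd_def)

lemma countable_face: "countable (UNIV :: face set)"
proof -
  have "(UNIV :: face set) = range Inner \<union> range Phantom_Face"
    by (auto intro: face.exhaust)
  moreover have "countable (range Inner \<union> range Phantom_Face)"
    by simp
  ultimately show ?thesis by (simp only:)
qed

lemma space_dec_space [simp]: "space dec_space = UNIV"
  by (simp add: dec_space_def space_PiM PiE_UNIV_domain)

lemma space_dmap_space [simp]: "space dmap_space = QH \<times> UNIV"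
  by (simp add: dmap_space_def space_pair_measure)

lemma measurable_dec_coord: "(\<lambda>\<sigma>. \<sigma> F) \<in> dec_space \<rightarrow>\<^sub>M (borel :: (real ^ 'n) measure)"
  unfolding dec_space_def by (rule measurable_component_singleton) simp

lemma measurable_to_dec_space:
  assumes "\<And>F. (\<lambda>x. f x F) \<in> M \<rightarrow>\<^sub>M (borel :: (real ^ 'n) measure)"
  shows "f \<in> M \<rightarrow>\<^sub>M dec_space"
  unfolding dec_space_def by (rule measurable_PiM_single') (auto intro: assms)

text \<open>For fixed \<open>q\<close> and \<open>p\<close>, every value of the part is a coordinate
  of the decoration or constantly 0.\<close>

lemma measurable_part_dec:
  "(\<lambda>\<sigma> :: face \<Rightarrow> real ^ 'n. part_dec q p \<sigma> h) \<in> dec_space \<rightarrow>\<^sub>M dec_space"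
proof (rule measurable_to_dec_space)
  fix F
  have coord: "(\<lambda>\<sigma> :: face \<Rightarrow> real ^ 'n. if c then \<sigma> G else 0) \<in> borel_measurable dec_space" for c G
    by (cases c) (auto intro: measurable_dec_coord)
  show "(\<lambda>\<sigma>. part_dec q p \<sigma> h F) \<in> borel_measurable (dec_space :: (face \<Rightarrow> real ^ 'n) measure)"
  proof (cases q)
    case None
    then show ?thesis by (simp add: part_dec_def measurable_dec_coord)
  next
    case (Some q')
    show ?thesis
    proof (cases F)
      case (Inner f)
      then show ?thesis using coord by (simp add: Some part_dec_def decorate_def)
    next
      case (Phantom_Face i)
      have "(\<lambda>\<sigma> :: face \<Rightarrow> real ^ 'n. hole_bc q' (restr (Some q') p \<sigma>) h i) \<in> borel_measurable dec_space"
        unfolding hole_bc_def restr_def by (rule coord)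
      then show ?thesis by (cases "i < perimeter (hole_parts (Some q') p h)")
          (simp_all add: Some Phantom_Face part_dec_def decorate_def)
    qed
  qed
qed

lemma measurable_parts:
  assumes "submap q (Some p)" "p \<in> QH"
  shows "(\<lambda>\<sigma> :: face \<Rightarrow> real ^ 'n. parts q p \<sigma>) \<in> dec_space \<rightarrow>\<^sub>M PiM (holes q) (\<lambda>_. dmap_space)"
  unfolding parts_def
proof (rule measurable_restrict)
  fix h assume "h \<in> holes q"
  then have "hole_parts q p h \<in> QH"
    using submap_parts(1)[OF assms] by (cases q) auto
  then show "(\<lambda>\<sigma> :: face \<Rightarrow> real ^ 'n. (hole_parts q p h, part_dec q p \<sigma> h)) \<in> dec_space \<rightarrow>\<^sub>M dmap_space"
    unfolding dmap_space_def by (intro measurable_Pair measurable_const measurable_part_dec) simp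
qed

section \<open>The decoration vanishes off the faces of the map\<close>

text \<open>The event that must be excluded for the decomposition: values off the faces of the map
  are lost by restriction and extension by 0.\<close>

definition stray :: "(nat pmap \<times> (face \<Rightarrow> real ^ 'n)) set" where
  "stray = {(M, \<sigma>). M \<in> QH \<and> (\<exists>F. F \<notin> own_faces (Some M) \<and> \<sigma> F \<noteq> 0)}"

lemma sets_stray: "(stray :: (nat pmap \<times> (face \<Rightarrow> real ^ 'n)) set) \<in> sets dmap_space"
proof -
  have "(stray :: (nat pmap \<times> (face \<Rightarrow> real ^ 'n)) set) =
      (\<Union>M\<in>QH. \<Union>F\<in>- own_faces (Some M). {M} \<times> ((\<lambda>\<sigma>. \<sigma> F) -` (- {0}) \<inter> space dec_space))"
    by (auto simp: stray_def)
  also have "\<dots> \<in> sets dmap_space"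
  proof (intro sets.countable_UN'' countable_QH)
    fix M F assume "M \<in> QH"
    then show "{M} \<times> ((\<lambda>\<sigma> :: face \<Rightarrow> real ^ 'n. \<sigma> F) -` (- {0}) \<inter> space dec_space) \<in> sets dmap_space"
      unfolding dmap_space_def
      by (intro pair_measureI measurable_sets[OF measurable_dec_coord]) auto
  qed (rule countable_subset[OF subset_UNIV countable_face])
  finally show ?thesis .
qed

lemma boltzmann_law_stray:
  fixes b :: "nat \<Rightarrow> real ^ 'n"
  shows "emeasure (boltzmann_law \<beta> \<mu> w l b) stray = 0"
proof -
  have "decorate M b \<sigma> F = 0" if "F \<notin> own_faces (Some M)" for M and \<sigma> :: "nat \<Rightarrow> real ^ 'n" and F
    using that by (cases F) (auto simp: decorate_def)
  then have "(M, decorate M b \<sigma>) \<notin> stray" for M and \<sigma> :: "nat \<Rightarrow> real ^ 'n"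
    by (auto simp: stray_def)
  \<comment> \<open>If the defining set function were not a measure, \<open>measure_of\<close> would
    assign 0; otherwise the integrand vanishes. Both cases give 0, so additivity need not be
    checked.\<close>
  then show ?thesis
    unfolding boltzmann_law_def by (simp add: emeasure_measure_of_conv)
qed

lemma boltzmann_map_AE_zero:
  assumes "boltzmann_map P \<beta> \<mu> w l b \<QQ> \<phi>"
  shows "AE \<omega> in P. \<forall>F. F \<notin> own_faces (Some (\<QQ> \<omega>)) \<longrightarrow> \<phi> \<omega> F = 0"
proof -
  let ?X = "\<lambda>\<omega>. (\<QQ> \<omega>, \<phi> \<omega>)"
  have X: "?X \<in> P \<rightarrow>\<^sub>M dmap_space" and law: "distr P dmap_space ?X = boltzmann_law \<beta> \<mu> w l b"
    using assms by (auto simp: boltzmann_map_def)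
  have "emeasure P (?X -` stray \<inter> space P) = 0"
    using emeasure_distr[OF X sets_stray] by (simp add: law boltzmann_law_stray)
  then have "?X -` stray \<inter> space P \<in> null_sets P"
    using measurable_sets[OF X sets_stray] by auto
  moreover have "\<QQ> \<omega> \<in> QH" if "\<omega> \<in> space P" for \<omega>
    using measurable_space[OF X that] by simp
  ultimately show ?thesis
    by (intro AE_I') (auto simp: stray_def)
qed

section \<open>Localisation of conditional expectations\<close>

text \<open>The traces of \<open>F\<close> and \<open>G\<close> on \<open>E\<close> agree. So the
  product of the indicator of \<open>E\<close> and the conditional expectation given
  \<open>F\<close> is \<open>G\<close>-measurable and has the right integrals over sets of
  \<open>G\<close>: it is a version of the conditional expectation given \<open>G\<close> of
  \<open>f\<close> cut to \<open>E\<close>.\<close>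

lemma real_cond_exp_local:
  assumes "prob_space P" and F: "subalgebra P F" and G: "subalgebra P G"
    and E: "E \<in> sets F" "E \<in> sets G"
    and GF: "\<And>A. A \<in> sets G \<Longrightarrow> A \<inter> E \<in> sets F" and FG: "\<And>A. A \<in> sets F \<Longrightarrow> A \<inter> E \<in> sets G"
    and f: "integrable P f"
  shows "AE \<omega> in P. \<omega> \<in> E \<longrightarrow> real_cond_exp P G f \<omega> = real_cond_exp P F f \<omega>"
proof -
  interpret prob_space P by fact
  interpret F: finite_measure_subalgebra P F by unfold_locales (rule F)
  interpret G: finite_measure_subalgebra P G by unfold_locales (rule G)
  let ?k = "real_cond_exp P F f"
  have EP: "E \<in> sets P" using E(1) F by (auto simp: subalgebra_def)
  have spaces: "space F = space P" "space G = space P" using F G by (auto simp: subalgebra_def)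
  have int_f: "integrable P (\<lambda>\<omega>. indicator E \<omega> * f \<omega>)"
    using integrable_mult_indicator[OF EP f] by simp
  have k: "integrable P ?k" using f by (rule F.real_cond_exp_int)
  have int_k: "integrable P (\<lambda>\<omega>. indicator E \<omega> * ?k \<omega>)"
    using integrable_mult_indicator[OF EP k] by simp
  have 1: "AE \<omega> in P. real_cond_exp P G (\<lambda>\<omega>. indicator E \<omega> * f \<omega>) \<omega> = indicator E \<omega> * real_cond_exp P G f \<omega>"
    using E(2) f int_f by (intro G.real_cond_exp_mult) auto
  have "AE \<omega> in P. real_cond_exp P G (\<lambda>\<omega>. indicator E \<omega> * f \<omega>) \<omega> = indicator E \<omega> * ?k \<omega>"
  proof (rule G.real_cond_exp_charact)
    show "(\<lambda>\<omega>. indicator E \<omega> * ?k \<omega>) \<in> borel_measurable G"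
    proof (rule measurableI)
      fix B :: "real set" assume B: "B \<in> sets borel"
      have "?k -` B \<inter> space F \<in> sets F"
        using B by (intro measurable_sets[OF borel_measurable_cond_exp])
      then have "(?k -` B \<inter> space F) \<inter> E \<in> sets G" by (rule FG)
      moreover have "space G - E \<in> sets G" using E(2) by blast
      \<comment> \<open>Off \<open>E\<close> the product is 0, so the complement of \<open>E\<close>
        joins the preimage exactly when \<open>B\<close> contains 0.\<close>
      moreover have "(\<lambda>\<omega>. indicator E \<omega> * ?k \<omega>) -` B \<inter> space G
          = ((?k -` B \<inter> space F) \<inter> E) \<union> (if 0 \<in> B then space G - E else {})"
        using sets.sets_into_space[OF E(2)] by (auto simp: spaces indicator_def of_bool_def split: if_splits)
      ultimately show "(\<lambda>\<omega>. indicator E \<omega> * ?k \<omega>) -` B \<inter> space G \<in> sets G"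
        by (auto split: if_splits)
    qed simp
    fix A assume A: "A \<in> sets G"
    have ind: "(\<lambda>\<omega>. indicator A \<omega> *\<^sub>R (indicator E \<omega> * g \<omega>)) = (\<lambda>\<omega>. indicator (A \<inter> E) \<omega> *\<^sub>R g \<omega>)" for g :: "'a \<Rightarrow> real"
      by (auto simp: indicator_def)
    show "(LINT \<omega>:A|P. indicator E \<omega> * f \<omega>) = (LINT \<omega>:A|P. indicator E \<omega> * ?k \<omega>)"
      using F.real_cond_exp_intA[OF f GF[OF A]] by (simp only: set_lebesgue_integral_def ind)
  qed (fact int_f int_k)+
  with 1 show ?thesis
    by eventually_elim auto
qed

section \<open>Stopping maps\<close>

locale stopped_map =
  fixes P :: "'w measure" and \<F> :: "nat pmap option \<Rightarrow> 'w measure" and \<beta> w :: real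
    and \<mu> :: "(real ^ 'n) measure" and l :: nat and b :: "nat \<Rightarrow> real ^ 'n"
    and \<QQ> :: "'w \<Rightarrow> nat pmap" and \<phi> :: "'w \<Rightarrow> face \<Rightarrow> real ^ 'n" and R :: "'w \<Rightarrow> nat pmap option"
  assumes prob: "prob_space P" and filtration: "map_filtration P \<F>"
    and boltzmann: "filtered_boltzmann_map P \<F> \<beta> \<mu> w l b \<QQ> \<phi>"
    and stopping: "stopping_map P \<F> \<QQ> R"
begin

sublocale prob_space P by (rule prob)

lemma bmap: "boltzmann_map P \<beta> \<mu> w l b \<QQ> \<phi>"
  using boltzmann by (simp add: filtered_boltzmann_map_def)

lemma sub_F: "q \<in> QHd \<Longrightarrow> subalgebra P (\<F> q)"
  using filtration by (simp add: map_filtration_def)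

lemma space_F: "q \<in> QHd \<Longrightarrow> space (\<F> q) = space P"
  and sets_F: "q \<in> QHd \<Longrightarrow> A \<in> sets (\<F> q) \<Longrightarrow> A \<in> sets P"
  using sub_F by (auto simp: subalgebra_def)

lemma null_F: "q \<in> QHd \<Longrightarrow> N \<in> null_sets P \<Longrightarrow> S \<subseteq> N \<Longrightarrow> S \<in> sets (\<F> q)"
  using filtration by (auto simp: map_filtration_def)

text \<open>Completeness of one member of the filtration, here the one at the empty map, makes
  \<open>P\<close> itself complete.\<close>

lemma null_P: "N \<in> null_sets P \<Longrightarrow> S \<subseteq> N \<Longrightarrow> S \<in> sets P"
  using null_F[of None] sets_F[of None] by (auto simp: QHd_def)

lemma mono_F: "q \<in> QHd \<Longrightarrow> q' \<in> QHd \<Longrightarrow> submap q q' \<Longrightarrow> A \<in> sets (\<F> q) \<Longrightarrow> A \<in> sets (\<F> q')"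
  using filtration unfolding map_filtration_def by blast

lemma R_in: "\<omega> \<in> space P \<Longrightarrow> R \<omega> \<in> QHd"
  using stopping measurable_space[of R P "count_space QHd"] by (simp add: stopping_map_def)

lemma pair_measurable: "(\<lambda>\<omega>. (\<QQ> \<omega>, \<phi> \<omega>)) \<in> P \<rightarrow>\<^sub>M count_space QH \<Otimes>\<^sub>M dec_space"
  using bmap by (simp add: boltzmann_map_def dmap_space_def)

lemma Q_measurable: "\<QQ> \<in> P \<rightarrow>\<^sub>M count_space QH"
  and \<phi>_measurable: "\<phi> \<in> P \<rightarrow>\<^sub>M dec_space"
  using measurable_compose[OF pair_measurable measurable_fst] measurable_compose[OF pair_measurable measurable_snd]
  by simp_all

lemma Q_in: "\<omega> \<in> space P \<Longrightarrow> \<QQ> \<omega> \<in> QH"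
  using measurable_space[OF Q_measurable] by simp

definition stopped_at :: "nat pmap option \<Rightarrow> 'w set" where
  "stopped_at q = {\<omega> \<in> space P. R \<omega> = q}"

lemma submap_event: "q \<in> QHd \<Longrightarrow> {\<omega> \<in> space P. submap (R \<omega>) q} \<in> sets (\<F> q)"
  using stopping by (simp add: stopping_map_def)

text \<open>This is where reflexivity and antisymmetry of the order enter.\<close>

lemma at_F:
  assumes q: "q \<in> QHd"
  shows "stopped_at q \<in> sets (\<F> q)"
proof -
  let ?L = "{q' \<in> QHd. submap q' q \<and> q' \<noteq> q}"
  have "stopped_at q = {\<omega> \<in> space P. submap (R \<omega>) q} - (\<Union>q'\<in>?L. {\<omega> \<in> space P. submap (R \<omega>) q'})"
  proof (intro equalityI subsetI)
    fix \<omega> assume "\<omega> \<in> stopped_at q"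
    then show "\<omega> \<in> {\<omega> \<in> space P. submap (R \<omega>) q} - (\<Union>q'\<in>?L. {\<omega> \<in> space P. submap (R \<omega>) q'})"
      using submap_refl[OF q] submap_antisym[OF q] by (auto simp: stopped_at_def)
  next
    fix \<omega> assume *: "\<omega> \<in> {\<omega> \<in> space P. submap (R \<omega>) q} - (\<Union>q'\<in>?L. {\<omega> \<in> space P. submap (R \<omega>) q'})"
    then show "\<omega> \<in> stopped_at q"
      using submap_refl[OF R_in[of \<omega>]] R_in[of \<omega>] by (auto simp: stopped_at_def)
  qed
  moreover have "(\<Union>q'\<in>?L. {\<omega> \<in> space P. submap (R \<omega>) q'}) \<in> sets (\<F> q)"
  proof (rule sets.countable_UN'')
    show "countable ?L" using countable_QHd by (rule countable_subset[rotated]) auto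
    show "{\<omega> \<in> space P. submap (R \<omega>) q'} \<in> sets (\<F> q)" if "q' \<in> ?L" for q'
      using that q submap_event by (intro mono_F[of q' q]) auto
  qed
  ultimately show ?thesis using submap_event[OF q] by simp
qed

lemma at_P: "q \<in> QHd \<Longrightarrow> stopped_at q \<in> sets P"
  using at_F sets_F by blast

lemma space_at: "space P = (\<Union>q\<in>QHd. stopped_at q)"
  using R_in by (auto simp: stopped_at_def)

lemma bad_set: obtains N where "N \<in> null_sets P" "\<And>\<omega>. \<omega> \<in> space P \<Longrightarrow> \<omega> \<notin> N \<Longrightarrow> submap (R \<omega>) (Some (\<QQ> \<omega>))"
proof -
  have "AE \<omega> in P. submap (R \<omega>) (Some (\<QQ> \<omega>))"
    using stopping by (simp add: stopping_map_def)
  then obtain N where "{\<omega> \<in> space P. \<not> submap (R \<omega>) (Some (\<QQ> \<omega>))} \<subseteq> N" "emeasure P N = 0" "N \<in> sets P"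
    by (rule AE_E)
  then show ?thesis by (intro that[of N]) auto
qed

lemma sets_F_cong:
  assumes "q \<in> QHd" "N \<in> null_sets P" "A \<in> sets (\<F> q)" "A - B \<subseteq> N" "B - A \<subseteq> N"
  shows "B \<in> sets (\<F> q)"
proof -
  have "B = (A - (A - B)) \<union> (B - A)" by blast
  moreover have "A - B \<in> sets (\<F> q)" "B - A \<in> sets (\<F> q)"
    using assms null_F by blast+
  ultimately show ?thesis using assms(3) by (metis sets.Diff sets.Un)
qed

lemma sets_P_cong:
  assumes "N \<in> null_sets P" "A \<in> sets P" "A - B \<subseteq> N" "B - A \<subseteq> N"
  shows "B \<in> sets P"
proof -
  have "B = (A - (A - B)) \<union> (B - A)" by blast
  moreover have "A - B \<in> sets P" "B - A \<in> sets P"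
    using assms null_P by blast+
  ultimately show ?thesis using assms(2) by (metis sets.Diff sets.Un)
qed

text \<open>Measurability is given only for the restriction cut to the event that \<open>q\<close>
  is contained in the random map. On \<open>R = q\<close> this cut is invisible up to a null
  set.\<close>

lemma restr_at_F:
  assumes q: "q \<in> QHd" and B: "B \<in> sets dec_space"
  shows "{\<omega> \<in> stopped_at q. restr q (\<QQ> \<omega>) (\<phi> \<omega>) \<in> B} \<in> sets (\<F> q)"
proof -
  obtain N where N: "N \<in> null_sets P" "\<And>\<omega>. \<omega> \<in> space P \<Longrightarrow> \<omega> \<notin> N \<Longrightarrow> submap (R \<omega>) (Some (\<QQ> \<omega>))"
    by (rule bad_set) blast
  let ?r = "\<lambda>\<omega>. if \<omega> \<in> inside_event P q \<QQ> then restr q (\<QQ> \<omega>) (\<phi> \<omega>) else (\<lambda>_. 0)"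
  have r: "?r \<in> \<F> q \<rightarrow>\<^sub>M dec_space"
    using boltzmann q by (simp add: filtered_boltzmann_map_def)
  have *: "stopped_at q \<inter> (?r -` B \<inter> space (\<F> q)) \<in> sets (\<F> q)"
    using at_F[OF q] measurable_sets[OF r B] by (rule sets.Int)
  show ?thesis
    by (rule sets_F_cong[OF q N(1) *])
      (use N(2) space_F[OF q] in \<open>auto simp: stopped_at_def inside_event_def split: if_splits\<close>)
qed

subsection \<open>The stopped \<open>\<sigma>\<close>-algebra\<close>

abbreviation "\<G> \<equiv> stopped_sigma P \<F> R \<QQ> \<phi>"

abbreviation "gens \<equiv> stopped_events P \<F> R \<union> {(\<lambda>\<omega>. restr (R \<omega>) (\<QQ> \<omega>) (\<phi> \<omega>)) -` B \<inter> space P | B. B \<in> sets dec_space}"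

lemma stopped_events_sub: "stopped_events P \<F> R \<subseteq> Pow (space P)"
proof -
  have "(\<Union>q\<in>QHd. sets (\<F> q)) \<subseteq> Pow (space P)"
    using sets_F sets.sets_into_space by blast
  from sigma_sets_into_sp[OF this] show ?thesis
    unfolding stopped_events_def by blast
qed

lemma gens_sub: "gens \<subseteq> Pow (space P)"
  using stopped_events_sub by auto

lemma space_G: "space \<G> = space P"
  unfolding stopped_sigma_def using gens_sub by (rule space_measure_of)

lemma sets_G: "sets \<G> = sigma_sets (space P) gens"
  unfolding stopped_sigma_def using gens_sub by (rule sets_measure_of)

text \<open>Having a trace in \<open>\<F> q\<close> is stable under complements and countable
  unions, so generators suffice. The decoration of \<open>R\<close> adds nothing to the trace,
  because on \<open>R = q\<close> it is the restriction to \<open>q\<close>.\<close>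

lemma trace_G_F:
  assumes q: "q \<in> QHd" and A: "A \<in> sets \<G>"
  shows "A \<inter> stopped_at q \<in> sets (\<F> q)"
  using A unfolding sets_G
proof induction
  case (Basic A)
  then consider "A \<in> stopped_events P \<F> R"
    | B where "B \<in> sets dec_space" "A = (\<lambda>\<omega>. restr (R \<omega>) (\<QQ> \<omega>) (\<phi> \<omega>)) -` B \<inter> space P"
    by blast
  then show ?case
  proof cases
    case 1
    then have "A \<inter> {\<omega> \<in> space P. submap (R \<omega>) q} \<in> sets (\<F> q)"
      using q by (simp add: stopped_events_def)
    then have "(A \<inter> {\<omega> \<in> space P. submap (R \<omega>) q}) \<inter> stopped_at q \<in> sets (\<F> q)"
      using at_F[OF q] by (rule sets.Int)
    moreover have "(A \<inter> {\<omega> \<in> space P. submap (R \<omega>) q}) \<inter> stopped_at q = A \<inter> stopped_at q"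
      using submap_refl[OF q] by (auto simp: stopped_at_def)
    ultimately show ?thesis by simp
  next
    case (2 B)
    then have "A \<inter> stopped_at q = {\<omega> \<in> stopped_at q. restr q (\<QQ> \<omega>) (\<phi> \<omega>) \<in> B}"
      by (auto simp: stopped_at_def)
    then show ?thesis using restr_at_F[OF q 2(1)] by simp
  qed
next
  case Empty
  then show ?case by simp
next
  case (Compl A)
  have "(space P - A) \<inter> stopped_at q = stopped_at q - A \<inter> stopped_at q"
    by (auto simp: stopped_at_def)
  then show ?case using Compl at_F[OF q] by (metis sets.Diff)
next
  case (Union A)
  have "(\<Union>i. A i) \<inter> stopped_at q = (\<Union>i. A i \<inter> stopped_at q)" by blast
  moreover have "(\<Union>i. A i \<inter> stopped_at q) \<in> sets (\<F> q)"
    using Union.IH by (intro sets.countable_UN) auto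
  ultimately show ?case by simp
qed

text \<open>On \<open>R = q\<close> the event that \<open>R\<close> is contained in
  \<open>q'\<close> is everything or nothing, according to whether \<open>q\<close> is contained in
  \<open>q'\<close>. So the trace is already a stopped event.\<close>

lemma trace_F_G:
  assumes q: "q \<in> QHd" and A: "A \<in> sets (\<F> q)"
  shows "A \<inter> stopped_at q \<in> sets \<G>"
proof -
  have Aq: "A \<inter> stopped_at q \<in> sets (\<F> q)" using A at_F[OF q] by (rule sets.Int)
  have "A \<inter> stopped_at q \<inter> {\<omega> \<in> space P. submap (R \<omega>) q'} \<in> sets (\<F> q')" if q': "q' \<in> QHd" for q'
  proof (cases "submap q q'")
    case True
    then have "A \<inter> stopped_at q \<inter> {\<omega> \<in> space P. submap (R \<omega>) q'} = A \<inter> stopped_at q"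
      by (auto simp: stopped_at_def)
    then show ?thesis using mono_F[OF q q' True Aq] by simp
  next
    case False
    then have "A \<inter> stopped_at q \<inter> {\<omega> \<in> space P. submap (R \<omega>) q'} = {}"
      by (auto simp: stopped_at_def)
    then show ?thesis by simp
  qed
  moreover have "A \<inter> stopped_at q \<in> sigma_sets (space P) (\<Union>q\<in>QHd. sets (\<F> q))"
    using Aq q by (intro sigma_sets.Basic) blast
  ultimately have "A \<inter> stopped_at q \<in> stopped_events P \<F> R"
    by (simp add: stopped_events_def)
  then show ?thesis
    unfolding sets_G by (intro sigma_sets.Basic) blast
qed

lemma at_G: "q \<in> QHd \<Longrightarrow> stopped_at q \<in> sets \<G>"
  using trace_F_G[OF _ at_F, of q] by simp

text \<open>Every set is a countable union of its traces, which lie in the filtration. Measurability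
  of the restricted decoration of \<open>R\<close> comes out as a special case.\<close>

lemma sub_G: "subalgebra P \<G>"
  unfolding subalgebra_def
proof (intro conjI subsetI space_G)
  fix A assume A: "A \<in> sets \<G>"
  have "A \<subseteq> space P" using sets.sets_into_space[OF A] by (simp add: space_G)
  then have "A = (\<Union>q\<in>QHd. A \<inter> stopped_at q)" using space_at by blast
  moreover have "(\<Union>q\<in>QHd. A \<inter> stopped_at q) \<in> sets P"
    using countable_QHd trace_G_F[OF _ A] sets_F by (intro sets.countable_UN'') auto
  ultimately show "A \<in> sets P" by simp
qed

subsection \<open>The strong Markov property\<close>

text \<open>Splitting by the countably many values of \<open>\<QQ>\<close> freezes the chosen parts;
  only the dependence on the decoration remains, and it is measurable.\<close>

lemma parts_event:
  assumes q: "q \<in> QHd" and A: "A \<in> sets (PiM (holes q) (\<lambda>_. dmap_space))"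
  shows "{\<omega> \<in> inside_event P q \<QQ>. parts q (\<QQ> \<omega>) (\<phi> \<omega>) \<in> A} \<in> sets P"
proof -
  let ?I = "{p \<in> QH. submap q (Some p)}"
  let ?S = "\<lambda>p. (\<QQ> -` {p} \<inter> space P) \<inter> ((\<lambda>\<omega>. parts q p (\<phi> \<omega>)) -` A \<inter> space P)"
  have "{\<omega> \<in> inside_event P q \<QQ>. parts q (\<QQ> \<omega>) (\<phi> \<omega>) \<in> A} = (\<Union>p\<in>?I. ?S p)"
    using Q_in by (auto simp: inside_event_def)
  also have "\<dots> \<in> sets P"
  proof (rule sets.countable_UN'')
    show "countable ?I" using countable_QH by (rule countable_subset[rotated]) auto
    fix p assume p: "p \<in> ?I"
    have "(\<lambda>\<omega>. parts q p (\<phi> \<omega>)) \<in> P \<rightarrow>\<^sub>M PiM (holes q) (\<lambda>_. dmap_space)"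
      using p by (intro measurable_compose[OF \<phi>_measurable measurable_parts]) auto
    then show "?S p \<in> sets P"
      using p A by (intro sets.Int measurable_sets[OF Q_measurable] measurable_sets) auto
  qed
  finally show ?thesis .
qed

lemma stopped_cond_boltzmann: "cond_boltzmann P \<G> \<beta> \<mu> w l b \<QQ> \<phi> (space P) R"
  unfolding cond_boltzmann_def
proof (intro allI impI)
  fix A assume A: "\<forall>q\<in>QHd. A q \<in> sets (PiM (holes q) (\<lambda>_. dmap_space :: (nat pmap \<times> (face \<Rightarrow> real ^ 'n)) measure))"
  obtain N where N: "N \<in> null_sets P" "\<And>\<omega>. \<omega> \<in> space P \<Longrightarrow> \<omega> \<notin> N \<Longrightarrow> submap (R \<omega>) (Some (\<QQ> \<omega>))"
    by (rule bad_set) blast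
  define T where "T = {\<omega> \<in> space P. parts (R \<omega>) (\<QQ> \<omega>) (\<phi> \<omega>) \<in> A (R \<omega>)}"
  define S where "S q = {\<omega> \<in> inside_event P q \<QQ>. parts q (\<QQ> \<omega>) (\<phi> \<omega>) \<in> A q}" for q
  let ?law = "\<lambda>q \<omega>. measure (PiM (holes q) (hole_law \<beta> \<mu> w l b q (restr q (\<QQ> \<omega>) (\<phi> \<omega>)))) (A q)"
  have S: "S q \<in> sets P" if "q \<in> QHd" for q
    unfolding S_def using that A by (intro parts_event) auto
  have TS: "stopped_at q \<inter> S q - stopped_at q \<inter> T \<subseteq> N" "stopped_at q \<inter> T - stopped_at q \<inter> S q \<subseteq> N" for q
    using N(2) by (auto simp: stopped_at_def T_def S_def inside_event_def)
  have T: "T \<in> sets P"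
  proof -
    have "T = (\<Union>q\<in>QHd. stopped_at q \<inter> T)" using space_at by (auto simp: T_def)
    moreover have "(\<Union>q\<in>QHd. stopped_at q \<inter> T) \<in> sets P"
    proof (rule sets.countable_UN''[OF countable_QHd])
      fix q assume "q \<in> QHd"
      then have "stopped_at q \<inter> S q \<in> sets P" using at_P S by blast
      then show "stopped_at q \<inter> T \<in> sets P"
        by (rule sets_P_cong[OF N(1)]) (rule TS)+
    qed
    ultimately show ?thesis by simp
  qed
  have int_ind: "integrable P (indicator B :: 'w \<Rightarrow> real)" if "B \<in> sets P" for B
    using that by (simp add: integrable_real_indicator less_top[symmetric])
  have local: "AE \<omega> in P. R \<omega> = q \<longrightarrow> real_cond_exp P \<G> (indicator T) \<omega> = ?law q \<omega>" if q: "q \<in> QHd" for q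
  proof -
    interpret F: finite_measure_subalgebra P "\<F> q"
      by unfold_locales (rule sub_F[OF q])
    have "AE \<omega> in P. \<omega> \<in> inside_event P q \<QQ> \<longrightarrow> real_cond_exp P (\<F> q) (indicator (S q)) \<omega> = ?law q \<omega>"
      using boltzmann q A unfolding filtered_boltzmann_map_def cond_boltzmann_def S_def by blast
    moreover have "AE \<omega> in P. \<omega> \<in> stopped_at q \<longrightarrow> real_cond_exp P \<G> (indicator T) \<omega> = real_cond_exp P (\<F> q) (indicator T) \<omega>"
      using trace_G_F[OF q] trace_F_G[OF q] int_ind[OF T]
      by (intro real_cond_exp_local prob sub_F q sub_G at_F at_G) auto
    \<comment> \<open>\<open>T\<close> involves \<open>R\<close>, \<open>S q\<close> only the fixed
      map \<open>q\<close>; they agree on \<open>R = q\<close> up to a null set. Pulling out the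
      indicator of this event, which lies in \<open>\<F> q\<close>, transfers the agreement to the
      conditional expectations.\<close>
    moreover have "AE \<omega> in P. real_cond_exp P (\<F> q) (\<lambda>\<omega>. indicator (stopped_at q) \<omega> * indicator T \<omega>) \<omega>
        = indicator (stopped_at q) \<omega> * real_cond_exp P (\<F> q) (indicator T) \<omega>"
      using T at_F[OF q] at_P[OF q] by (intro F.real_cond_exp_mult) (auto intro!: int_ind simp flip: indicator_inter_arith)
    moreover have "AE \<omega> in P. real_cond_exp P (\<F> q) (\<lambda>\<omega>. indicator (stopped_at q) \<omega> * indicator (S q) \<omega>) \<omega>
        = indicator (stopped_at q) \<omega> * real_cond_exp P (\<F> q) (indicator (S q)) \<omega>"
      using S[OF q] at_F[OF q] at_P[OF q] by (intro F.real_cond_exp_mult) (auto intro!: int_ind simp flip: indicator_inter_arith)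
    moreover have "AE \<omega> in P. real_cond_exp P (\<F> q) (\<lambda>\<omega>. indicator (stopped_at q) \<omega> * indicator T \<omega>) \<omega>
        = real_cond_exp P (\<F> q) (\<lambda>\<omega>. indicator (stopped_at q) \<omega> * indicator (S q) \<omega>) \<omega>"
    proof (rule F.real_cond_exp_cong)
      show "AE \<omega> in P. indicator (stopped_at q) \<omega> * indicator T \<omega> = (indicator (stopped_at q) \<omega> * indicator (S q) \<omega> :: real)"
        using AE_not_in[OF N(1)] by eventually_elim (use TS[of q] in \<open>auto simp: indicator_def\<close>)
    qed (use T S[OF q] at_P[OF q] in auto)
    moreover have "AE \<omega> in P. \<omega> \<in> space P" by (rule AE_space)
    moreover have "AE \<omega> in P. submap (R \<omega>) (Some (\<QQ> \<omega>))"
      using stopping by (simp add: stopping_map_def)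
    ultimately show ?thesis
      by eventually_elim (auto simp: stopped_at_def inside_event_def)
  qed
  \<comment> \<open>The exceptional null set of \<open>local\<close> depends on \<open>q\<close>.
    Countability of \<open>QHd\<close> provides a common one, after which \<open>q\<close> may be
    replaced by \<open>R \<omega>\<close>.\<close>
  have "AE \<omega> in P. \<forall>q\<in>QHd. R \<omega> = q \<longrightarrow> real_cond_exp P \<G> (indicator T) \<omega> = ?law q \<omega>"
    by (subst AE_ball_countable[OF countable_QHd]) (use local in blast)
  then show "AE \<omega> in P. \<omega> \<in> space P \<longrightarrow> real_cond_exp P \<G> (indicator {\<omega> \<in> space P. parts (R \<omega>) (\<QQ> \<omega>) (\<phi> \<omega>) \<in> A (R \<omega>)}) \<omega> = ?law (R \<omega>) \<omega>"
    unfolding T_def[symmetric] by eventually_elim (use R_in in blast)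
qed

lemma stopped_decomposition:
  "AE \<omega> in P. hole_parts (R \<omega>) (\<QQ> \<omega>) \<in> fillings (R \<omega>) \<and>
     Some (\<QQ> \<omega>) = glue (R \<omega>) (hole_parts (R \<omega>) (\<QQ> \<omega>)) \<and>
     \<phi> \<omega> = (\<lambda>F. extend_base (R \<omega>) (\<QQ> \<omega>) (restr (R \<omega>) (\<QQ> \<omega>) (\<phi> \<omega>)) F
             + extend_holes (R \<omega>) (\<QQ> \<omega>) (part_dec (R \<omega>) (\<QQ> \<omega>) (\<phi> \<omega>)) F)"
proof -
  have "AE \<omega> in P. submap (R \<omega>) (Some (\<QQ> \<omega>))"
    using stopping by (simp add: stopping_map_def)
  then show ?thesis
    using boltzmann_map_AE_zero[OF bmap] AE_space
  proof eventually_elim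
    fix \<omega> assume \<omega>: "submap (R \<omega>) (Some (\<QQ> \<omega>))" "\<forall>F. F \<notin> own_faces (Some (\<QQ> \<omega>)) \<longrightarrow> \<phi> \<omega> F = 0" "\<omega> \<in> space P"
    show "hole_parts (R \<omega>) (\<QQ> \<omega>) \<in> fillings (R \<omega>) \<and>
     Some (\<QQ> \<omega>) = glue (R \<omega>) (hole_parts (R \<omega>) (\<QQ> \<omega>)) \<and>
     \<phi> \<omega> = (\<lambda>F. extend_base (R \<omega>) (\<QQ> \<omega>) (restr (R \<omega>) (\<QQ> \<omega>) (\<phi> \<omega>)) F
             + extend_holes (R \<omega>) (\<QQ> \<omega>) (part_dec (R \<omega>) (\<QQ> \<omega>) (\<phi> \<omega>)) F)"
      using submap_parts[OF \<omega>(1) Q_in[OF \<omega>(3)]]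
        decoration_decomposition[OF R_in[OF \<omega>(3)] Q_in[OF \<omega>(3)] \<omega>(1)] \<omega>(2)
      by (intro conjI ext) auto
  qed
qed

end

theorem theorem4p8:
  fixes P :: "'w measure"
    and \<F> :: "nat pmap option \<Rightarrow> 'w measure"
    and \<beta> w :: real
    and \<mu> :: "(real ^ 'n) measure"
    and l :: nat
    and b :: "nat \<Rightarrow> real ^ 'n"
    and \<QQ> :: "'w \<Rightarrow> nat pmap"
    and \<phi> :: "'w \<Rightarrow> face \<Rightarrow> real ^ 'n"
    and R :: "'w \<Rightarrow> nat pmap option"
  assumes "prob_space P"
    and "0 < \<beta>" and "0 \<le> w"
    and "sets \<mu> = sets borel" and "sigma_finite_measure \<mu>"
    and "map_filtration P \<F>"
    and "filtered_boltzmann_map P \<F> \<beta> \<mu> w l b \<QQ> \<phi>"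
    and "stopping_map P \<F> \<QQ> R"
  shows "(AE \<omega> in P.
            hole_parts (R \<omega>) (\<QQ> \<omega>) \<in> fillings (R \<omega>) \<and>
            Some (\<QQ> \<omega>) = glue (R \<omega>) (hole_parts (R \<omega>) (\<QQ> \<omega>)) \<and>
            \<phi> \<omega> = (\<lambda>F. extend_base (R \<omega>) (\<QQ> \<omega>) (restr (R \<omega>) (\<QQ> \<omega>) (\<phi> \<omega>)) F
                      + extend_holes (R \<omega>) (\<QQ> \<omega>) (part_dec (R \<omega>) (\<QQ> \<omega>) (\<phi> \<omega>)) F)) \<and>
         cond_boltzmann P (stopped_sigma P \<F> R \<QQ> \<phi>) \<beta> \<mu> w l b \<QQ> \<phi> (space P) R"
proof -
  have "stopped_map P \<F> \<beta> w \<mu> l b \<QQ> \<phi> R"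
    using assms by (intro stopped_map.intro)
  then interpret stopped_map P \<F> \<beta> w \<mu> l b \<QQ> \<phi> R .
  show ?thesis
    using stopped_decomposition stopped_cond_boltzmann by blast
qed

end
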